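(* Let $(X,\omega)$ be a compact connected Kähler manifold and let $E$ be a very ample holomorphic vector bundle on $X$. Suppose that $E$ is simple and admits a balanced metric. Then for any $H_0\in M$, the sequence of iterates $T^m(H_0)$ converges, as $m\to\infty$, to some $H_\infty\in M$ which is balanced, i.e. $T(H_\infty)=H_\infty$ (equivalently, $H_\infty=\mathrm{Hilb}(h_\infty)$ with $h_\infty=FS(H_\infty)$ a balanced Hermitian metric on $E$).
   Context: Let $n=\dim X$, $r=\operatorname{rank}E$, $N=\dim H^0(X,E)$, $V=\mathrm{Vol}(X,\omega)=\int_X\frac{\omega^n}{n!}$. $E$ is very ample if it is globally generated and the map $X\to G(r,H^0(X,E)^* )$, sending $x$ to the $r$-dimensional subspace $E_x^*\hookrightarrow H^0(X,E)^*$ dual to the evaluation map $H^0(X,E)\to E_x$, is an embedding. $E$ is simple if $\mathrm{Aut}(E)\simeq\mathbb{C}^*$. For a Hermitian metric $h$ on $E$ and a section $s$, $s^{*_h}$ denotes the dual section $h(\cdot,s)$ of $E^*$, so that $s\otimes s^{*_h}$ is a section of $\mathrm{End}(E)$. The Bergman kernel of $h$ is $B(h)=\sum_{i=1}^N s_i\otimes s_i^{*_h}$, where $s_1,\dots,s_N$ is an orthonormal basis of $H^0(X,E)$ for the $L^2$ inner product $\langle s,t\rangle=\int_X h(s,t)\frac{\omega^n}{n!}$. The metric $h$ is balanced if $B(h)$ is a constant multiple of the identity. Let $K$ be the space of Hermitian metrics on $E$ and $M$ the space of Hermitian inner products on $H^0(X,E)$ (with the standard topology coming from identifying its elements with $N\times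 N$ matrices by a choice of basis). Define $\mathrm{Hilb}:K\to M$ by $\langle s,t\rangle_{\mathrm{Hilb}(h)}=\frac{N}{Vr}\int_X h(s,t)\frac{\omega^n}{n!}$. Define $FS:M\to K$ by letting $FS(H)$ be the unique Hermitian metric on $E$ such that $\sum_{i=1}^N s_i\otimes s_i^{*_{FS(H)}}=I$ for an orthonormal basis $s_1,\dots,s_N$ of $H^0(X,E)$ with respect to $H$. Define $T=\mathrm{Hilb}\circ FS:M\to M$. *)

theory Defs
  imports
    "HOL-Analysis.Analysis"
    "HOL-Combinatorics.Combinatorics"
    "HOL-Library.Function_Algebras"
begin

section \<open>Smooth and holomorphic functions of several complex variables\<close>

text \<open>All sets \<open>S\<close> to which the following two notions are applied are open.\<close>

primrec Ck_on :: "nat \<Rightarrow> ('a::real_normed_vector \<Rightarrow> 'b::real_normed_vector) \<Rightarrow> 'a set \<Rightarrow> bool" where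
  "Ck_on 0 f S \<longleftrightarrow> continuous_on S f"
| "Ck_on (Suc k) f S \<longleftrightarrow>
     (\<forall>x\<in>S. f differentiable (at x)) \<and> (\<forall>v. Ck_on k (\<lambda>x. frechet_derivative f (at x) v) S)"

definition smooth_on :: "('a::real_normed_vector \<Rightarrow> 'b::real_normed_vector) \<Rightarrow> 'a set \<Rightarrow> bool" where
  "smooth_on f S \<longleftrightarrow> (\<forall>k. Ck_on k f S)"

definition holo_on :: "(complex^'n \<Rightarrow> complex) \<Rightarrow> (complex^'n) set \<Rightarrow> bool" where
  "holo_on f S \<longleftrightarrow>
     (\<forall>z\<in>S. \<exists>f'. (f has_derivative f') (at z) \<and> (\<forall>c v. f' (c *s v) = c * f' v))"


section \<open>Complex manifolds\<close>

type_synonym ('a, 'n) chart = "'a set \<times> ('a \<Rightarrow> complex^'n)"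

definition chart_inv :: "('a, 'n) chart \<Rightarrow> complex^'n \<Rightarrow> 'a" where
  "chart_inv c = inv_into (fst c) (snd c)"

record ('a, 'n) cmfd =
  topo :: "'a topology"
  atlas :: "('a, 'n) chart set"

abbreviation pts :: "('a, 'n, 'm) cmfd_scheme \<Rightarrow> 'a set" where
  "pts X \<equiv> topspace (topo X)"

definition complex_manifold :: "('a, 'n::finite) cmfd \<Rightarrow> bool" where
  "complex_manifold X \<longleftrightarrow>
     Hausdorff_space (topo X) \<and> second_countable (topo X) \<and>
     (\<Union>c\<in>atlas X. fst c) = pts X \<and>
     (\<forall>(U, \<phi>)\<in>atlas X. openin (topo X) U \<and> open (\<phi> ` U) \<and>
        homeomorphic_map (subtopology (topo X) U) (top_of_set (\<phi> ` U)) \<phi>) \<and>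
     (\<forall>c\<in>atlas X. \<forall>d\<in>atlas X. \<forall>i.
        holo_on (\<lambda>z. snd d (chart_inv c z) $ i) (snd c ` (fst c \<inter> fst d)))"


section \<open>Kaehler forms\<close>

text \<open>A real 2-form is given by its local representatives: \<open>\<omega> c z u v\<close> is the value at the point
  \<open>z\<close> of the coordinate domain of the chart \<open>c\<close> on the tangent vectors \<open>u\<close>, \<open>v\<close>, which are elements
  of the underlying real vector space of \<open>\<complex>\<^sup>n\<close>.\<close>

type_synonym ('a, 'n) two_form =
  "('a, 'n) chart \<Rightarrow> complex^'n \<Rightarrow> complex^'n \<Rightarrow> complex^'n \<Rightarrow> real"

definition smooth_two_form :: "('a, 'n::finite) cmfd \<Rightarrow> ('a, 'n) two_form \<Rightarrow> bool" where
  "smooth_two_form X \<omega> \<longleftrightarrow>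
     (\<forall>c\<in>atlas X.
        (\<forall>z\<in>snd c ` fst c. bilinear (\<omega> c z) \<and> (\<forall>u. \<omega> c z u u = 0)) \<and>
        (\<forall>u v. smooth_on (\<lambda>z. \<omega> c z u v) (snd c ` fst c))) \<and>
     (\<forall>c\<in>atlas X. \<forall>d\<in>atlas X. \<forall>z\<in>snd c ` (fst c \<inter> fst d). \<forall>u v.
        let \<tau> = (\<lambda>y. snd d (chart_inv c y)); D = frechet_derivative \<tau> (at z)
        in \<omega> c z u v = \<omega> d (\<tau> z) (D u) (D v))"

text \<open>The last clause is \<open>d\<omega> = 0\<close>, evaluated on constant vector fields.
  The convention relating \<open>\<omega>\<close> to the Riemannian metric is \<open>g(u, v) = \<omega>(u, J v)\<close>.\<close>

definition kaehler_form :: "('a, 'n::finite) cmfd \<Rightarrow> ('a, 'n) two_form \<Rightarrow> bool" where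
  "kaehler_form X \<omega> \<longleftrightarrow>
     smooth_two_form X \<omega> \<and>
     (\<forall>c\<in>atlas X. \<forall>z\<in>snd c ` fst c.
        (\<forall>u v. \<omega> c z (\<i> *s u) (\<i> *s v) = \<omega> c z u v) \<and>
        (\<forall>u. u \<noteq> 0 \<longrightarrow> \<omega> c z u (\<i> *s u) > 0) \<and>
        (\<forall>u v w. frechet_derivative (\<lambda>y. \<omega> c y v w) (at z) u
               + frechet_derivative (\<lambda>y. \<omega> c y w u) (at z) v
               + frechet_derivative (\<lambda>y. \<omega> c y u v) (at z) w = 0))"


section \<open>Integration against the volume form\<close>

text \<open>The real basis \<open>e\<^sub>k, \<i> e\<^sub>k\<close> of \<open>\<complex>\<^sup>n\<close>, indexed by pairs; listing the pairs
  \<open>(e\<^sub>k, \<i> e\<^sub>k)\<close> one after the other, in any order of \<open>k\<close>, gives the complex orientation.\<close>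

definition real_frame :: "'n::finite \<times> bool \<Rightarrow> complex^'n" where
  "real_frame kb = axis (fst kb) (if snd kb then \<i> else 1)"

text \<open>The coefficient of \<open>\<omega>\<^sup>n/n!\<close> with respect to \<open>dx\<^sub>1 \<and> dy\<^sub>1 \<and> \<dots> \<and> dx\<^sub>n \<and> dy\<^sub>n\<close>, that is, the value of
  this form on the oriented real frame, where
  \<open>\<omega>\<^sup>n(v\<^sub>1,\<dots>,v\<^sub>2\<^sub>n) = 2\<^sup>-\<^sup>n \<Sum>\<^sub>\<sigma> sgn(\<sigma>) \<Prod>\<^sub>k \<omega>(v\<^sub>\<sigma>\<^sub>(\<^sub>2\<^sub>k\<^sub>-\<^sub>1\<^sub>), v\<^sub>\<sigma>\<^sub>(\<^sub>2\<^sub>k\<^sub>))\<close> is the \<open>n\<close>-fold wedge power.\<close>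

definition vol_density :: "('a, 'n::finite) two_form \<Rightarrow> ('a, 'n) chart \<Rightarrow> complex^'n \<Rightarrow> real" where
  "vol_density \<omega> c z =
     (\<Sum>\<sigma> | \<sigma> permutes (UNIV :: ('n \<times> bool) set).
        of_int (sign \<sigma>) *
        (\<Prod>k\<in>UNIV. \<omega> c z (real_frame (\<sigma> (k, False))) (real_frame (\<sigma> (k, True)))))
     / (2 ^ CARD('n) * fact CARD('n))"

text \<open>Integration over a compact manifold: \<open>X\<close> is covered by finitely many compact sets, each lying in
  a chart; the corresponding disjoint Borel pieces are integrated in the coordinates of their charts.
  By the change of variables formula the result depends neither on the cover nor on the charts.\<close>

definition chart_cover :: "('a, 'n::finite) cmfd \<Rightarrow> (('a, 'n) chart \<times> 'a set) list \<Rightarrow> bool" where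
  "chart_cover X cs \<longleftrightarrow>
     (\<forall>(c, K)\<in>set cs. c \<in> atlas X \<and> compactin (topo X) K \<and> K \<subseteq> fst c) \<and>
     (\<Union>(c, K)\<in>set cs. K) = pts X"

definition vol_integral ::
    "('a, 'n::finite) cmfd \<Rightarrow> ('a, 'n) two_form \<Rightarrow> ('a \<Rightarrow> 'b) \<Rightarrow> 'b::{banach, second_countable_topology}"
  where
  "vol_integral X \<omega> f =
     (let cs = (SOME cs. chart_cover X cs)
      in \<Sum>k<length cs.
           let c = fst (cs ! k); D = snd (cs ! k) - (\<Union>j<k. snd (cs ! j))
           in set_lebesgue_integral lborel (snd c ` D)
                (\<lambda>z. vol_density \<omega> c z *\<^sub>R f (chart_inv c z)))"

definition Vol :: "('a, 'n::finite) cmfd \<Rightarrow> ('a, 'n) two_form \<Rightarrow> real" where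
  "Vol X \<omega> = vol_integral X \<omega> (\<lambda>x. 1)"


section \<open>Complex linear algebra on subspaces\<close>

text \<open>Complex vector spaces are subspaces \<open>S\<close> of a type carrying a scalar multiplication in the sense
  of the locale \<open>vector_space\<close>; maps and forms on \<open>S\<close> are normalised to be zero outside of \<open>S\<close>
  where equality between them matters.\<close>

definition clinear_on ::
    "(complex \<Rightarrow> 'v \<Rightarrow> 'v) \<Rightarrow> 'v::ab_group_add set \<Rightarrow> (complex \<Rightarrow> 'w \<Rightarrow> 'w) \<Rightarrow> ('v \<Rightarrow> 'w::ab_group_add) \<Rightarrow> bool"
  where
  "clinear_on sc S sc' f \<longleftrightarrow>
     (\<forall>u\<in>S. \<forall>v\<in>S. f (u + v) = f u + f v) \<and> (\<forall>c. \<forall>u\<in>S. f (sc c u) = sc' c (f u))"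

definition dual_space :: "(complex \<Rightarrow> 'v \<Rightarrow> 'v) \<Rightarrow> 'v::ab_group_add set \<Rightarrow> ('v \<Rightarrow> complex) set" where
  "dual_space sc S = {l. clinear_on sc S (*) l \<and> (\<forall>u. u \<notin> S \<longrightarrow> l u = 0)}"

text \<open>Inner products are linear in the first and conjugate linear in the second argument.\<close>

definition hermitian_inner ::
    "(complex \<Rightarrow> 'v \<Rightarrow> 'v) \<Rightarrow> 'v::ab_group_add set \<Rightarrow> ('v \<Rightarrow> 'v \<Rightarrow> complex) \<Rightarrow> bool" where
  "hermitian_inner sc S h \<longleftrightarrow>
     (\<forall>w\<in>S. clinear_on sc S (*) (\<lambda>u. h u w)) \<and>
     (\<forall>u\<in>S. \<forall>v\<in>S. h v u = cnj (h u v)) \<and>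
     (\<forall>u\<in>S. u \<noteq> 0 \<longrightarrow> Re (h u u) > 0) \<and>
     (\<forall>u v. u \<notin> S \<or> v \<notin> S \<longrightarrow> h u v = 0)"

definition is_basis :: "(complex \<Rightarrow> 'v \<Rightarrow> 'v) \<Rightarrow> 'v::ab_group_add set \<Rightarrow> 'v list \<Rightarrow> bool" where
  "is_basis sc S bs \<longleftrightarrow>
     distinct bs \<and> \<not> module.dependent sc (set bs) \<and> module.span sc (set bs) = S"

definition orthonormal_basis ::
    "(complex \<Rightarrow> 'v \<Rightarrow> 'v) \<Rightarrow> 'v::ab_group_add set \<Rightarrow> ('v \<Rightarrow> 'v \<Rightarrow> complex) \<Rightarrow> 'v list \<Rightarrow> bool" where
  "orthonormal_basis sc S H bs \<longleftrightarrow>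
     is_basis sc S bs \<and>
     (\<forall>i<length bs. \<forall>j<length bs. H (bs ! i) (bs ! j) = (if i = j then 1 else 0))"


section \<open>Holomorphic vector bundles\<close>

text \<open>The fibres \<open>E\<^sub>x\<close> are subspaces of one ambient complex vector space of arbitrary dimension (for an
  abstractly given bundle, e.g. the direct sum of all its fibres); the ambient space has no further
  significance. The holomorphic structure is given by the local trivialisations \<open>(U, \<theta>)\<close>, where
  \<open>\<theta> x : E\<^sub>x \<rightarrow> \<complex>\<^sup>r\<close> is a linear isomorphism for \<open>x \<in> U\<close>.\<close>

record ('a, 'v, 'r) vbundle =
  scl :: "complex \<Rightarrow> 'v \<Rightarrow> 'v"
  fibre :: "'a \<Rightarrow> 'v set"
  trivs :: "('a set \<times> ('a \<Rightarrow> 'v \<Rightarrow> complex^'r)) set"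

definition frame ::
    "('a, 'v, 'r::finite) vbundle \<Rightarrow> ('a \<Rightarrow> 'v \<Rightarrow> complex^'r) \<Rightarrow> 'a \<Rightarrow> 'r \<Rightarrow> 'v" where
  "frame E \<theta> x j = inv_into (fibre E x) (\<theta> x) (axis j 1)"

definition holomorphic_vector_bundle ::
    "('a, 'n::finite) cmfd \<Rightarrow> ('a, 'v::ab_group_add, 'r::finite) vbundle \<Rightarrow> bool" where
  "holomorphic_vector_bundle X E \<longleftrightarrow>
     vector_space (scl E) \<and>
     (\<forall>x\<in>pts X. module.subspace (scl E) (fibre E x)) \<and>
     (\<Union>(U, \<theta>)\<in>trivs E. U) = pts X \<and>
     (\<forall>(U, \<theta>)\<in>trivs E. openin (topo X) U \<and>
        (\<forall>x\<in>U. clinear_on (scl E) (fibre E x) (*s) (\<theta> x) \<and> bij_betw (\<theta> x) (fibre E x) UNIV)) \<and>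
     (\<forall>(U, \<theta>)\<in>trivs E. \<forall>(W, \<eta>)\<in>trivs E. \<forall>c\<in>atlas X. \<forall>i j.
        holo_on (\<lambda>z. \<eta> (chart_inv c z) (frame E \<theta> (chart_inv c z) j) $ i)
          (snd c ` (fst c \<inter> U \<inter> W)))"

definition H0 ::
    "('a, 'n::finite) cmfd \<Rightarrow> ('a, 'v::ab_group_add, 'r::finite) vbundle \<Rightarrow> ('a \<Rightarrow> 'v) set" where
  "H0 X E = {s. (\<forall>x\<in>pts X. s x \<in> fibre E x) \<and> (\<forall>x. x \<notin> pts X \<longrightarrow> s x = 0) \<and>
     (\<forall>(U, \<theta>)\<in>trivs E. \<forall>c\<in>atlas X. \<forall>i.
        holo_on (\<lambda>z. \<theta> (chart_inv c z) (s (chart_inv c z)) $ i) (snd c ` (fst c \<inter> U)))}"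

text \<open>The vector space structure on sections; addition is that of functions.\<close>

definition sec_scl :: "('a, 'v, 'r::finite) vbundle \<Rightarrow> complex \<Rightarrow> ('a \<Rightarrow> 'v) \<Rightarrow> ('a \<Rightarrow> 'v)" where
  "sec_scl E c s = (\<lambda>x. scl E c (s x))"

definition h0 :: "('a, 'n::finite) cmfd \<Rightarrow> ('a, 'v::ab_group_add, 'r::finite) vbundle \<Rightarrow> nat" where
  "h0 X E = vector_space.dim (sec_scl E) (H0 X E)"

definition holo_endomorphism ::
    "('a, 'n::finite) cmfd \<Rightarrow> ('a, 'v::ab_group_add, 'r::finite) vbundle \<Rightarrow> ('a \<Rightarrow> 'v \<Rightarrow> 'v) \<Rightarrow> bool" where
  "holo_endomorphism X E a \<longleftrightarrow>
     (\<forall>x\<in>pts X. clinear_on (scl E) (fibre E x) (scl E) (a x) \<and> a x ` fibre E x \<subseteq> fibre E x) \<and>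
     (\<forall>x u. x \<notin> pts X \<or> u \<notin> fibre E x \<longrightarrow> a x u = 0) \<and>
     (\<forall>(U, \<theta>)\<in>trivs E. \<forall>c\<in>atlas X. \<forall>i j.
        holo_on (\<lambda>z. let x = chart_inv c z in \<theta> x (a x (frame E \<theta> x j)) $ i) (snd c ` (fst c \<inter> U)))"

definition Aut ::
    "('a, 'n::finite) cmfd \<Rightarrow> ('a, 'v::ab_group_add, 'r::finite) vbundle \<Rightarrow> ('a \<Rightarrow> 'v \<Rightarrow> 'v) set" where
  "Aut X E = {a. holo_endomorphism X E a \<and>
     (\<exists>b. holo_endomorphism X E b \<and>
        (\<forall>x\<in>pts X. \<forall>u\<in>fibre E x. a x (b x u) = u \<and> b x (a x u) = u))}"

definition homothety ::
    "('a, 'n::finite) cmfd \<Rightarrow> ('a, 'v::ab_group_add, 'r::finite) vbundle \<Rightarrow> complex \<Rightarrow> 'a \<Rightarrow> 'v \<Rightarrow> 'v" where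
  "homothety X E c = (\<lambda>x u. if x \<in> pts X \<and> u \<in> fibre E x then scl E c u else 0)"

text \<open>\<open>Aut(E) \<simeq> \<complex>\<^sup>*\<close> refers to the natural homomorphism \<open>c \<mapsto> c \<cdot> id\<close>.\<close>

definition simple_bundle ::
    "('a, 'n::finite) cmfd \<Rightarrow> ('a, 'v::ab_group_add, 'r::finite) vbundle \<Rightarrow> bool" where
  "simple_bundle X E \<longleftrightarrow> bij_betw (homothety X E) (UNIV - {0}) (Aut X E)"


section \<open>Grassmannians and very ample bundles\<close>

text \<open>Below, \<open>W\<close> is a space of functions \<open>'w \<Rightarrow> complex\<close> and elements of \<open>'w\<close> act on it by evaluation;
  it is used for \<open>W = S\<^sup>*\<close> with \<open>S\<close> a set of elements of \<open>'w\<close>.\<close>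

definition Gr :: "'r::finite itself \<Rightarrow> ('w \<Rightarrow> complex) set \<Rightarrow> ('w \<Rightarrow> complex) set set" where
  "Gr _ W = {P. P \<subseteq> W \<and> module.subspace (\<lambda>c l w. c * l w) P \<and>
                vector_space.dim (\<lambda>(c::complex) l w. c * l w) P = CARD('r)}"

text \<open>The affine charts of the Grassmannian: an \<open>r\<close>-tuple \<open>t\<close> of elements of \<open>S\<close> determines the set of
  those \<open>P\<close> on which \<open>t\<close> is a coordinate system. Such a \<open>P\<close> has a unique basis dual to \<open>t\<close>, and the
  coordinates of \<open>P\<close> are the values of this basis on the elements of \<open>S\<close> (in terms of a basis of \<open>S\<close>
  containing \<open>t\<close>, these are the entries of the \<open>r \<times> N\<close> matrix with row space \<open>P\<close> and the \<open>t\<close>-minor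
  normalised to the identity matrix).\<close>

definition Gr_chart_dom ::
    "('w \<Rightarrow> complex) set \<Rightarrow> ('r::finite \<Rightarrow> 'w) \<Rightarrow> ('w \<Rightarrow> complex) set set" where
  "Gr_chart_dom W t =
     {P \<in> Gr TYPE('r) W. bij_betw (\<lambda>l. (\<chi> i. l (t i)) :: complex^'r) P UNIV}"

definition Gr_coord :: "('r::finite \<Rightarrow> 'w) \<Rightarrow> 'r \<Rightarrow> 'w \<Rightarrow> ('w \<Rightarrow> complex) set \<Rightarrow> complex" where
  "Gr_coord t j s P = (THE l. l \<in> P \<and> (\<forall>i. l (t i) = (if i = j then 1 else 0))) s"

definition Gr_topology ::
    "'r::finite itself \<Rightarrow> 'w set \<Rightarrow> ('w \<Rightarrow> complex) set \<Rightarrow> ('w \<Rightarrow> complex) set topology" where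
  "Gr_topology _ S W = topology_generated_by
     {{P \<in> Gr_chart_dom W t. Gr_coord t j s P \<in> G} | (t :: 'r \<Rightarrow> 'w) j s G.
        range t \<subseteq> S \<and> s \<in> S \<and> open G}"

abbreviation H0_dual ::
    "('a, 'n::finite) cmfd \<Rightarrow> ('a, 'v::ab_group_add, 'r::finite) vbundle \<Rightarrow> (('a \<Rightarrow> 'v) \<Rightarrow> complex) set" where
  "H0_dual X E \<equiv> dual_space (sec_scl E) (H0 X E)"

text \<open>The image of \<open>E\<^sub>x\<^sup>*\<close> in \<open>H\<^sup>0(X, E)\<^sup>*\<close> under the transpose of the evaluation map.\<close>

definition kodaira_map ::
    "('a, 'n::finite) cmfd \<Rightarrow> ('a, 'v::ab_group_add, 'r::finite) vbundle \<Rightarrow> 'a \<Rightarrow> (('a \<Rightarrow> 'v) \<Rightarrow> complex) set"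
  where
  "kodaira_map X E x =
     (\<lambda>f s. if s \<in> H0 X E then f (s x) else 0) ` dual_space (scl E) (fibre E x)"

definition globally_generated ::
    "('a, 'n::finite) cmfd \<Rightarrow> ('a, 'v::ab_group_add, 'r::finite) vbundle \<Rightarrow> bool" where
  "globally_generated X E \<longleftrightarrow> (\<forall>x\<in>pts X. (\<lambda>s. s x) ` H0 X E = fibre E x)"

text \<open>The map \<open>X \<rightarrow> G(r, H\<^sup>0(X, E)\<^sup>*)\<close> is an embedding of complex manifolds: it is a topological
  embedding, and in the affine charts of the Grassmannian it is holomorphic with injective
  differential.\<close>

definition very_ample ::
    "('a, 'n::finite) cmfd \<Rightarrow> ('a, 'v::ab_group_add, 'r::finite) vbundle \<Rightarrow> bool" where
  "very_ample X E \<longleftrightarrow>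
     globally_generated X E \<and>
     kodaira_map X E ` pts X \<subseteq> Gr TYPE('r) (H0_dual X E) \<and>
     embedding_map (topo X) (Gr_topology TYPE('r) (H0 X E) (H0_dual X E)) (kodaira_map X E) \<and>
     (\<forall>c\<in>atlas X. \<forall>t :: 'r \<Rightarrow> 'a \<Rightarrow> 'v. range t \<subseteq> H0 X E \<longrightarrow>
        (let D = snd c ` {x \<in> fst c. kodaira_map X E x \<in> Gr_chart_dom (H0_dual X E) t};
             F = (\<lambda>j s z. Gr_coord t j s (kodaira_map X E (chart_inv c z)))
         in open D \<and> (\<forall>j. \<forall>s\<in>H0 X E. holo_on (F j s) D) \<and>
            (\<forall>z\<in>D. \<forall>v. v \<noteq> 0 \<longrightarrow>
               (\<exists>j. \<exists>s\<in>H0 X E. frechet_derivative (F j s) (at z) v \<noteq> 0))))"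


section \<open>Hermitian metrics, balanced metrics and the map \<open>T\<close>\<close>

definition K_space ::
    "('a, 'n::finite) cmfd \<Rightarrow> ('a, 'v::ab_group_add, 'r::finite) vbundle \<Rightarrow> ('a \<Rightarrow> 'v \<Rightarrow> 'v \<Rightarrow> complex) set"
  where
  "K_space X E = {h.
     (\<forall>x\<in>pts X. hermitian_inner (scl E) (fibre E x) (h x)) \<and>
     (\<forall>x. x \<notin> pts X \<longrightarrow> h x = (\<lambda>u v. 0)) \<and>
     (\<forall>(U, \<theta>)\<in>trivs E. \<forall>c\<in>atlas X. \<forall>i j.
        smooth_on (\<lambda>z. let x = chart_inv c z in h x (frame E \<theta> x i) (frame E \<theta> x j))
          (snd c ` (fst c \<inter> U)))}"

type_synonym ('a, 'v) sec_form = "('a \<Rightarrow> 'v) \<Rightarrow> ('a \<Rightarrow> 'v) \<Rightarrow> complex"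

definition M_space ::
    "('a, 'n::finite) cmfd \<Rightarrow> ('a, 'v::ab_group_add, 'r::finite) vbundle \<Rightarrow> ('a, 'v) sec_form set" where
  "M_space X E = {H. hermitian_inner (sec_scl E) (H0 X E) H}"

definition gram_matrix :: "'w list \<Rightarrow> ('w \<Rightarrow> 'w \<Rightarrow> complex) \<Rightarrow> nat \<Rightarrow> nat \<Rightarrow> complex" where
  "gram_matrix bs H = (\<lambda>i j. if i < length bs \<and> j < length bs then H (bs ! i) (bs ! j) else 0)"

text \<open>\<open>euclidean\<close> on \<open>nat \<Rightarrow> nat \<Rightarrow> complex\<close> is the product topology, so this is the topology of
  entrywise convergence of \<open>N \<times> N\<close> matrices; it does not depend on the chosen basis.\<close>

definition M_topology ::
    "('a, 'n::finite) cmfd \<Rightarrow> ('a, 'v::ab_group_add, 'r::finite) vbundle \<Rightarrow> ('a, 'v) sec_form topology" where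
  "M_topology X E =
     pullback_topology (M_space X E)
       (gram_matrix (SOME bs. is_basis (sec_scl E) (H0 X E) bs)) euclidean"

definition L2_inner ::
    "('a, 'n::finite) cmfd \<Rightarrow> ('a, 'n) two_form \<Rightarrow> ('a, 'v::ab_group_add, 'r::finite) vbundle \<Rightarrow>
     ('a \<Rightarrow> 'v \<Rightarrow> 'v \<Rightarrow> complex) \<Rightarrow> ('a, 'v) sec_form" where
  "L2_inner X \<omega> E h = (\<lambda>s t. if s \<in> H0 X E \<and> t \<in> H0 X E
     then vol_integral X \<omega> (\<lambda>x. h x (s x) (t x)) else 0)"

text \<open>\<open>\<Sum>\<^sub>i s\<^sub>i \<otimes> s\<^sub>i\<^sup>*\<close> as an endomorphism of \<open>E\<^sub>x\<close>, for a list of sections \<open>s\<^sub>i\<close>.\<close>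

definition bergman_sum ::
    "('a, 'v::ab_group_add, 'r::finite) vbundle \<Rightarrow> ('a \<Rightarrow> 'v \<Rightarrow> 'v \<Rightarrow> complex) \<Rightarrow>
     ('a \<Rightarrow> 'v) list \<Rightarrow> 'a \<Rightarrow> 'v \<Rightarrow> 'v" where
  "bergman_sum E h ss x u = (\<Sum>s\<leftarrow>ss. scl E (h x u (s x)) (s x))"

text \<open>The Bergman kernel does not depend on the orthonormal basis \<open>ss\<close>.\<close>

definition balanced_metric ::
    "('a, 'n::finite) cmfd \<Rightarrow> ('a, 'n) two_form \<Rightarrow> ('a, 'v::ab_group_add, 'r::finite) vbundle \<Rightarrow>
     ('a \<Rightarrow> 'v \<Rightarrow> 'v \<Rightarrow> complex) \<Rightarrow> bool" where
  "balanced_metric X \<omega> E h \<longleftrightarrow> h \<in> K_space X E \<and>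
     (\<exists>ss. orthonormal_basis (sec_scl E) (H0 X E) (L2_inner X \<omega> E h) ss \<and>
        (\<exists>c. \<forall>x\<in>pts X. \<forall>u\<in>fibre E x. bergman_sum E h ss x u = scl E c u))"

definition Hilb ::
    "('a, 'n::finite) cmfd \<Rightarrow> ('a, 'n) two_form \<Rightarrow> ('a, 'v::ab_group_add, 'r::finite) vbundle \<Rightarrow>
     ('a \<Rightarrow> 'v \<Rightarrow> 'v \<Rightarrow> complex) \<Rightarrow> ('a, 'v) sec_form" where
  "Hilb X \<omega> E h = (\<lambda>s t.
     complex_of_real (real (h0 X E) / (Vol X \<omega> * real CARD('r))) * L2_inner X \<omega> E h s t)"

definition FS ::
    "('a, 'n::finite) cmfd \<Rightarrow> ('a, 'v::ab_group_add, 'r::finite) vbundle \<Rightarrow>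
     ('a, 'v) sec_form \<Rightarrow> ('a \<Rightarrow> 'v \<Rightarrow> 'v \<Rightarrow> complex)" where
  "FS X E H = (THE h. h \<in> K_space X E \<and>
     (\<exists>ss. orthonormal_basis (sec_scl E) (H0 X E) H ss \<and>
        (\<forall>x\<in>pts X. \<forall>u\<in>fibre E x. bergman_sum E h ss x u = u)))"

definition T_map ::
    "('a, 'n::finite) cmfd \<Rightarrow> ('a, 'n) two_form \<Rightarrow> ('a, 'v::ab_group_add, 'r::finite) vbundle \<Rightarrow>
     ('a, 'v) sec_form \<Rightarrow> ('a, 'v) sec_form" where
  "T_map X \<omega> E = Hilb X \<omega> E \<circ> FS X E"

end

(*
  The form T(H) is, up to the factor N / (V r), the average over X of the quotient forms of H under
  the evaluation maps H0 -> E_x.  Hence T is positively homogeneous and monotone for the order of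
  quadratic forms, and a balanced metric gives a fixed point H*.  The least b(m) with
  T^m(H) <= b(m) H* decreases to some b > 0; let K be a limit point of the orbit, so K <= b H*.
  The null space W(j) of b H* - T^j(K) decreases with j: if s lies in W(j+1), then the minimal
  lifts of its values s(x) lie in W(j), and s is their average because H* is fixed.  No W(j) vanishes,
  by minimality of b, so W(j) = W(j+1) for some j.  Then the H*-orthogonal projection onto W(j)
  descends to an idempotent holomorphic endomorphism p of E.  As 1 + p is an automorphism and E is
  simple, W(j) is everything, that is T^j(K) = b H*.  Now T^m(H) is squeezed towards b H*.
*)
theory Submission
  imports Defs "HOL-Complex_Analysis.Complex_Analysis"
begin

section \<open>Hermitian forms\<close>

text \<open>Monotonicity and homogeneity take the place of continuity of T: a form squeezed between
  (1 - eps) K and (1 + eps) K is sent to one squeezed between the same multiples of T(K), which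
  carries information from the limit point back to the orbit. Thus no W(j) vanishes: a definite
  difference would put T^j(K) below (1 - delta) b H*, and a later member of the orbit below (1 -
  delta^2) b H*. The projection onto W(j) descends because W(j) = W(j+1) makes W(j) stable under all
  maps sending s to the minimal lift of s(x); these are self-adjoint, so the projection commutes
  with them and preserves the sections vanishing at x. The detour through 1 + p is due to
  simplicity, which speaks of automorphisms only. The analysis comes from the definitions: FS(H) is
  described within smooth metrics, so quotient metrics must be shown smooth, starting from mere
  complex differentiability of sections; and strict comparison of averages needs a positive volume
  density, given by a Pfaffian.\<close>

locale fd_space = vector_space sc
  for sc :: "complex \<Rightarrow> 'v::ab_group_add \<Rightarrow> 'v" +
  fixes S :: "'v set"
  assumes subspace_S: "subspace S"
    and fin_dim: "\<exists>B. finite B \<and> S \<subseteq> span B"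
begin

abbreviation herm where "herm \<equiv> hermitian_inner sc S"

text \<open>Positivity and the normalisation outside \<open>S\<close> are dropped, so that
  differences of inner products and limits of them are covered as well.\<close>

definition hform :: "('v \<Rightarrow> 'v \<Rightarrow> complex) \<Rightarrow> bool" where
  "hform H \<longleftrightarrow> (\<forall>w\<in>S. clinear_on sc S (*) (\<lambda>u. H u w)) \<and> (\<forall>u\<in>S. \<forall>v\<in>S. H v u = cnj (H u v))"

definition form_le :: "('v \<Rightarrow> 'v \<Rightarrow> complex) \<Rightarrow> ('v \<Rightarrow> 'v \<Rightarrow> complex) \<Rightarrow> bool" where
  "form_le K H \<longleftrightarrow> (\<forall>s\<in>S. Re (K s s) \<le> Re (H s s))"

text \<open>For \<open>form_le K H\<close> this is the null space of the semidefinite form H - K,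
  although only diagonal values are compared; see \<open>eqset_iff\<close>.\<close>

definition eqset :: "('v \<Rightarrow> 'v \<Rightarrow> complex) \<Rightarrow> ('v \<Rightarrow> 'v \<Rightarrow> complex) \<Rightarrow> 'v set" where
  "eqset H K = {s\<in>S. Re (K s s) = Re (H s s)}"

definition scaled_form :: "real \<Rightarrow> ('v \<Rightarrow> 'v \<Rightarrow> complex) \<Rightarrow> 'v \<Rightarrow> 'v \<Rightarrow> complex" where
  "scaled_form c H = (\<lambda>u v. of_real c * H u v)"

definition orthonormal_upto :: "('v \<Rightarrow> 'v \<Rightarrow> complex) \<Rightarrow> (nat \<Rightarrow> 'v) \<Rightarrow> nat \<Rightarrow> bool" where
  "orthonormal_upto H e n \<longleftrightarrow> (\<forall>i<n. \<forall>j<n. H (e i) (e j) = (if i = j then 1 else 0))"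

definition onb_of :: "('v \<Rightarrow> 'v \<Rightarrow> complex) \<Rightarrow> 'v set \<Rightarrow> nat \<Rightarrow> (nat \<Rightarrow> 'v) \<Rightarrow> bool" where
  "onb_of H U n e \<longleftrightarrow> (\<forall>i<n. e i \<in> U) \<and> orthonormal_upto H e n \<and>
     (\<forall>u\<in>U. (\<Sum>i<n. sc (H u (e i)) (e i)) = u)"

definition oproj :: "('v \<Rightarrow> 'v \<Rightarrow> complex) \<Rightarrow> 'v set \<Rightarrow> 'v \<Rightarrow> 'v" where
  "oproj H U s = (THE p. p \<in> U \<and> (\<forall>u\<in>U. H (s - p) u = 0))"

section \<open>Sesquilinear calculus on a finite-dimensional subspace\<close>

lemma S_0[simp]: "0 \<in> S"
  by (rule subspace_0[OF subspace_S])

lemma S_add: "u \<in> S \<Longrightarrow> v \<in> S \<Longrightarrow> u + v \<in> S"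
  by (rule subspace_add[OF subspace_S])

lemma S_scale: "u \<in> S \<Longrightarrow> sc c u \<in> S"
  by (rule subspace_scale[OF subspace_S])

lemma S_diff: "u \<in> S \<Longrightarrow> v \<in> S \<Longrightarrow> u - v \<in> S"
  by (rule subspace_diff[OF subspace_S])

lemma S_sum: "(\<And>i. i \<in> I \<Longrightarrow> f i \<in> S) \<Longrightarrow> sum f I \<in> S"
  by (rule subspace_sum[OF subspace_S])

lemma herm_hform: "herm H \<Longrightarrow> hform H"
  unfolding hermitian_inner_def hform_def by (elim conjE, intro conjI) assumption+

lemma herm_pos: "herm H \<Longrightarrow> u \<in> S \<Longrightarrow> u \<noteq> 0 \<Longrightarrow> Re (H u u) > 0"
  unfolding hermitian_inner_def by (elim conjE) metis

lemma hform_add: "hform H \<Longrightarrow> u \<in> S \<Longrightarrow> v \<in> S \<Longrightarrow> w \<in> S \<Longrightarrow> H (u + v) w = H u w + H v w"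
  and hform_scale: "hform H \<Longrightarrow> u \<in> S \<Longrightarrow> w \<in> S \<Longrightarrow> H (sc c u) w = c * H u w"
  and hform_cnj: "hform H \<Longrightarrow> u \<in> S \<Longrightarrow> v \<in> S \<Longrightarrow> H v u = cnj (H u v)"
  unfolding hform_def clinear_on_def by metis+

lemma hform_0: "hform H \<Longrightarrow> w \<in> S \<Longrightarrow> H 0 w = 0"
  using hform_scale[of H 0 w 0] by simp

lemma hform_diff: "hform H \<Longrightarrow> u \<in> S \<Longrightarrow> v \<in> S \<Longrightarrow> w \<in> S \<Longrightarrow> H (u - v) w = H u w - H v w"
  using hform_add[of H "u - v" v w] by (simp add: S_diff)

lemma hform_add_right: "hform H \<Longrightarrow> u \<in> S \<Longrightarrow> v \<in> S \<Longrightarrow> w \<in> S \<Longrightarrow> H w (u + v) = H w u + H w v"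
  by (metis S_add complex_cnj_add hform_add hform_cnj)

lemma hform_diff_right: "hform H \<Longrightarrow> u \<in> S \<Longrightarrow> v \<in> S \<Longrightarrow> w \<in> S \<Longrightarrow> H w (u - v) = H w u - H w v"
  by (metis S_diff complex_cnj_diff hform_diff hform_cnj)

lemma hform_scale_right: "hform H \<Longrightarrow> u \<in> S \<Longrightarrow> w \<in> S \<Longrightarrow> H w (sc c u) = cnj c * H w u"
  by (metis S_scale complex_cnj_mult hform_scale hform_cnj)

lemma hform_0_right: "hform H \<Longrightarrow> w \<in> S \<Longrightarrow> H w 0 = 0"
  by (metis S_0 complex_cnj_zero hform_0 hform_cnj)

lemma hform_sum:
  assumes "hform H" "\<And>i. i \<in> I \<Longrightarrow> f i \<in> S" "w \<in> S"
  shows "H (\<Sum>i\<in>I. sc (c i) (f i)) w = (\<Sum>i\<in>I. c i * H (f i) w)"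
  using assms(2)
proof (induction I rule: infinite_finite_induct)
  case (insert x F)
  have "H (\<Sum>i\<in>insert x F. sc (c i) (f i)) w = H (sc (c x) (f x)) w + H (\<Sum>i\<in>F. sc (c i) (f i)) w"
    using insert assms by (simp add: hform_add S_scale S_sum)
  then show ?case using insert assms by (simp add: hform_scale)
qed (use assms in \<open>auto simp: hform_0\<close>)

lemma hform_sum_right:
  assumes "hform H" "\<And>i. i \<in> I \<Longrightarrow> f i \<in> S" "w \<in> S"
  shows "H w (\<Sum>i\<in>I. sc (c i) (f i)) = (\<Sum>i\<in>I. cnj (c i) * H w (f i))"
proof -
  have "H w (\<Sum>i\<in>I. sc (c i) (f i)) = cnj (H (\<Sum>i\<in>I. sc (c i) (f i)) w)"
    using assms by (intro hform_cnj) (auto intro!: S_sum S_scale)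
  also have "\<dots> = (\<Sum>i\<in>I. cnj (c i) * cnj (H (f i) w))" using assms by (simp add: hform_sum)
  also have "\<dots> = (\<Sum>i\<in>I. cnj (c i) * H w (f i))"
    using assms by (intro sum.cong refl) (metis hform_cnj)
  finally show ?thesis .
qed

lemma hform_real: "hform H \<Longrightarrow> u \<in> S \<Longrightarrow> H u u = of_real (Re (H u u))"
  by (metis Reals_cnj_iff hform_cnj of_real_Re)

lemma herm_zero_iff: "herm H \<Longrightarrow> u \<in> S \<Longrightarrow> H u u = 0 \<longleftrightarrow> u = 0"
  by (metis herm_hform herm_pos hform_0 S_0 less_irrefl zero_complex.simps(1))

lemma herm_nonneg: "herm H \<Longrightarrow> u \<in> S \<Longrightarrow> Re (H u u) \<ge> 0"
  by (metis herm_pos herm_zero_iff less_le_not_le nle_le zero_complex.simps(1))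

lemma herm_outside: "herm H \<Longrightarrow> u \<notin> S \<or> v \<notin> S \<Longrightarrow> H u v = 0"
  unfolding hermitian_inner_def by (elim conjE) metis

lemma hermI:
  assumes "hform H" "\<And>u. u \<in> S \<Longrightarrow> u \<noteq> 0 \<Longrightarrow> Re (H u u) > 0" "\<And>u v. u \<notin> S \<or> v \<notin> S \<Longrightarrow> H u v = 0"
  shows "herm H"
  unfolding hermitian_inner_def
  using assms(1)[unfolded hform_def, THEN conjunct1] assms(1)[unfolded hform_def, THEN conjunct2] assms(2,3)
  by (intro conjI) (assumption | blast)+

lemma hformI:
  assumes "\<And>u v w. u \<in> S \<Longrightarrow> v \<in> S \<Longrightarrow> w \<in> S \<Longrightarrow> H (u + v) w = H u w + H v w"
    "\<And>c u w. u \<in> S \<Longrightarrow> w \<in> S \<Longrightarrow> H (sc c u) w = c * H u w"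
    "\<And>u v. u \<in> S \<Longrightarrow> v \<in> S \<Longrightarrow> H v u = cnj (H u v)"
  shows "hform H"
  unfolding hform_def clinear_on_def by (intro conjI ballI allI assms)

lemma hform_minus:
  assumes "hform H" "hform K"
  shows "hform (\<lambda>u v. H u v - K u v)"
proof (rule hformI)
  show "H v u - K v u = cnj (H u v - K u v)" if "u \<in> S" "v \<in> S" for u v
    using hform_cnj[OF assms(1) that] hform_cnj[OF assms(2) that] by simp
qed (auto simp: hform_add hform_scale algebra_simps assms)

lemma hform_scaled_form:
  assumes "hform H"
  shows "hform (scaled_form c H)"
  unfolding scaled_form_def
proof (rule hformI)
  show "of_real c * H v u = cnj (of_real c * H u v)" if "u \<in> S" "v \<in> S" for u v
    using hform_cnj[OF assms(1) that] by simp
qed (auto simp: hform_add hform_scale algebra_simps assms)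

lemma herm_scaled_form: "herm H \<Longrightarrow> c > 0 \<Longrightarrow> herm (scaled_form c H)"
  by (rule hermI[OF hform_scaled_form[OF herm_hform]]) (auto simp: herm_outside scaled_form_def herm_pos)

text \<open>The order of forms controls diagonal values only; this identity transfers bounds and
  limits from them to all entries.\<close>

lemma hform_polarization:
  assumes "hform H" "u \<in> S" "v \<in> S"
  shows "H u v = (of_real (Re (H (u + v) (u + v)) - Re (H u u) - Re (H v v))
     + \<i> * of_real (Re (H (u + sc \<i> v) (u + sc \<i> v)) - Re (H u u) - Re (H v v))) / 2"
proof -
  have *: "H v u = cnj (H u v)" using assms hform_cnj by blast
  have 1: "Re (H (u + v) (u + v)) - Re (H u u) - Re (H v v) = 2 * Re (H u v)"
    using assms * by (simp add: hform_add hform_add_right S_add)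
  have "H (u + sc \<i> v) (u + sc \<i> v) = H u u - \<i> * H u v + \<i> * H v u + H v v"
    using assms by (simp add: hform_add hform_add_right S_add S_scale hform_scale hform_scale_right algebra_simps)
  then have 2: "Re (H (u + sc \<i> v) (u + sc \<i> v)) - Re (H u u) - Re (H v v) = 2 * Im (H u v)"
    using * by simp
  show ?thesis unfolding 1 2 by (simp add: complex_eq_iff)
qed

text \<open>On the line l s + t the form is affine in l because its value at s is zero; a nonzero
  slope would make it negative somewhere. Replacing t by i t settles the imaginary part.\<close>

lemma hform_psd_null:
  assumes H: "hform H" and psd: "\<And>u. u \<in> S \<Longrightarrow> Re (H u u) \<ge> 0"
    and s: "s \<in> S" "Re (H s s) = 0" and t: "t \<in> S"
  shows "H s t = 0"
proof -
  have *: "Re (H s t) = 0" if t: "t \<in> S" for t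
  proof (rule ccontr)
    assume a: "Re (H s t) \<noteq> 0"
    \<comment> \<open>With this l the value at l s + t is exactly -1.\<close>
    define l where "l = - (Re (H t t) + 1) / (2 * Re (H s t))"
    have ss: "H s s = 0" using hform_real[OF H s(1)] s by simp
    have "H (sc (of_real l) s + t) (sc (of_real l) s + t) = of_real l * H s t + of_real l * H t s + H t t"
      using H s t ss by (simp add: hform_add hform_add_right S_add S_scale hform_scale hform_scale_right algebra_simps)
    then have "Re (H (sc (of_real l) s + t) (sc (of_real l) s + t)) = 2 * l * Re (H s t) + Re (H t t)"
      using hform_cnj[OF H s(1) t] by simp
    also have "\<dots> = -1" using a by (simp add: l_def field_simps)
    finally show False using psd[of "sc (of_real l) s + t"] s t by (simp add: S_add S_scale)
  qed
  have "Im (H s t) = 0"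
    using *[of "sc \<i> t"] t s H by (simp add: S_scale hform_scale_right)
  then show ?thesis using *[OF t] by (simp add: complex_eq_iff)
qed

section \<open>Orthonormal systems and orthogonal projection\<close>

lemma orthonormal_upto_independent:
  assumes H: "hform H" and e: "\<And>i. i < n \<Longrightarrow> e i \<in> S" and on: "orthonormal_upto H e n"
  shows "inj_on e {..<n}" "independent (e ` {..<n})"
proof -
  show inj: "inj_on e {..<n}"
    using on by (auto simp: inj_on_def orthonormal_upto_def) (metis zero_neq_one)
  show "independent (e ` {..<n})"
  proof (rule independent_if_scalars_zero)
    fix f x assume f: "(\<Sum>x\<in>e ` {..<n}. sc (f x) x) = 0" and "x \<in> e ` {..<n}"
    then obtain j where j: "j < n" "x = e j" by auto
    have "(\<Sum>i<n. sc (f (e i)) (e i)) = 0"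
      using f inj by (simp add: sum.reindex)
    then have "0 = H (\<Sum>i<n. sc (f (e i)) (e i)) (e j)" using H e j by (simp add: hform_0)
    also have "\<dots> = (\<Sum>i<n. f (e i) * H (e i) (e j))" using H e j by (intro hform_sum) auto
    also have "\<dots> = (\<Sum>i<n. if i = j then f (e i) else 0)"
      using on j by (intro sum.cong) (auto simp: orthonormal_upto_def)
    also have "\<dots> = f x" using j by simp
    finally show "f x = 0" by simp
  qed simp
qed

lemma onb_in: "onb_of H U n e \<Longrightarrow> i < n \<Longrightarrow> e i \<in> U"
  and onb_on: "onb_of H U n e \<Longrightarrow> orthonormal_upto H e n"
  and onb_ex: "onb_of H U n e \<Longrightarrow> u \<in> U \<Longrightarrow> (\<Sum>i<n. sc (H u (e i)) (e i)) = u"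
  unfolding onb_of_def by blast+

text \<open>An orthonormal system of maximal length in a subspace spans it.\<close>

lemma ex_orthonormal:
  assumes H: "herm H" and U: "subspace U" "U \<subseteq> S"
  shows "\<exists>n e. onb_of H U n e"
proof -
  note hf = herm_hform[OF H]
  define P where "P n \<longleftrightarrow> (\<exists>e. (\<forall>i<n. e i \<in> U) \<and> orthonormal_upto H e n)" for n
  obtain B where B: "finite B" "S \<subseteq> span B" using fin_dim by blast
  \<comment> \<open>Orthonormal systems are independent, so a finite spanning set of
    \<open>S\<close> bounds their length and a maximal length exists.\<close>
  have bound: "n \<le> card B" if Pn: "P n" for n
  proof -
    obtain e where e: "\<forall>i<n. e i \<in> U" "orthonormal_upto H e n" using Pn unfolding P_def by blast
    have "independent (e ` {..<n})" "inj_on e {..<n}"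
      using orthonormal_upto_independent[OF hf _ e(2)] e(1) U by auto
    then show ?thesis
      using independent_span_bound[OF B(1), of "e ` {..<n}"] e(1) U(2) B(2)
      by (auto simp: card_image)
  qed
  have "P 0" by (simp add: P_def orthonormal_upto_def)
  define n where "n = Greatest P"
  have "P n"
    unfolding n_def by (rule GreatestI_nat[where P = P, OF \<open>P 0\<close>]) (rule bound)
  have mx: "m \<le> n" if "P m" for m
    unfolding n_def by (rule Greatest_le_nat[where P = P, OF that]) (rule bound)
  from \<open>P n\<close>
  obtain e where e: "\<And>i. i < n \<Longrightarrow> e i \<in> U" and on: "orthonormal_upto H e n"
    unfolding P_def by blast
  have "(\<Sum>i<n. sc (H u (e i)) (e i)) = u" if u: "u \<in> U" for u
  proof (rule ccontr)
    assume neq: "(\<Sum>i<n. sc (H u (e i)) (e i)) \<noteq> u"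
    define d where "d = u - (\<Sum>i<n. sc (H u (e i)) (e i))"
    have dU: "d \<in> U" unfolding d_def
      using u e U by (intro subspace_diff subspace_sum subspace_scale) auto
    have dS: "d \<in> S" using dU U by auto
    have d0: "d \<noteq> 0" using neq by (simp add: d_def)
    have orth: "H d (e j) = 0" if "j < n" for j
    proof -
      have "H d (e j) = H u (e j) - H (\<Sum>i<n. sc (H u (e i)) (e i)) (e j)"
        unfolding d_def using u e U that by (intro hform_diff[OF hf]) (auto intro!: S_sum S_scale)
      also have "H (\<Sum>i<n. sc (H u (e i)) (e i)) (e j) = (\<Sum>i<n. H u (e i) * H (e i) (e j))"
        using e U that by (intro hform_sum[OF hf]) auto
      also have "\<dots> = (\<Sum>i<n. if i = j then H u (e i) else 0)"
        using on that by (intro sum.cong) (auto simp: orthonormal_upto_def)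
      finally show ?thesis using that by simp
    qed
    define c where "c = inverse (sqrt (Re (H d d)))"
    have pos: "Re (H d d) > 0" using herm_pos[OF H dS d0] .
    have c2: "c * c * Re (H d d) = 1" unfolding c_def using pos by (simp add: field_simps)
    define e' where "e' = e(n := sc (of_real c) d)"
    have 1: "H (e' n) (e' n) = 1"
    proof -
      have "H (e' n) (e' n) = of_real c * (of_real c * H d d)"
        using dS hf by (simp add: e'_def hform_scale hform_scale_right S_scale)
      also have "\<dots> = of_real (c * c * Re (H d d))" using hform_real[OF hf dS] by simp
      finally show ?thesis using c2 by simp
    qed
    have 2: "H (e' n) (e' j) = 0" "H (e' j) (e' n) = 0" if "j < n" for j
    proof -
      have ej: "e j \<in> S" using e that U by auto
      show "H (e' n) (e' j) = 0"
        using dS hf orth[OF that] ej that by (simp add: e'_def hform_scale)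
      then show "H (e' j) (e' n) = 0"
        using hform_cnj[OF hf, of "e' n" "e' j"] dS ej that by (simp add: e'_def S_scale)
    qed
    have "orthonormal_upto H e' (Suc n)"
      using on 1 2 by (auto simp: orthonormal_upto_def less_Suc_eq) (auto simp: e'_def)
    moreover have "\<forall>i<Suc n. e' i \<in> U"
      using e dU U by (auto simp: e'_def less_Suc_eq subspace_scale)
    ultimately have "P (Suc n)" by (auto simp: P_def)
    then show False using mx by fastforce
  qed
  then have "onb_of H U n e" unfolding onb_of_def using e on by blast
  then show ?thesis by blast
qed

lemma orthonormal_parseval:
  assumes H: "hform H" and e: "\<And>i. i < n \<Longrightarrow> e i \<in> S" and on: "orthonormal_upto H e n"
    and s: "(\<Sum>i<n. sc (H s (e i)) (e i)) = s" "s \<in> S"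
  shows "Re (H s s) = (\<Sum>i<n. (cmod (H s (e i)))\<^sup>2)"
proof -
  have "H s (\<Sum>i<n. sc (H s (e i)) (e i)) = (\<Sum>i<n. cnj (H s (e i)) * H s (e i))"
    by (rule hform_sum_right[OF H]) (use e s in auto)
  then have "H s s = (\<Sum>i<n. cnj (H s (e i)) * H s (e i))" unfolding s(1) .
  also have "\<dots> = (\<Sum>i<n. of_real ((cmod (H s (e i)))\<^sup>2))"
    by (intro sum.cong refl) (metis complex_norm_square mult.commute of_real_power)
  finally show ?thesis by simp
qed

text \<open>The projection is the Fourier sum over an orthonormal system spanning U. Two candidates
  differ by a vector of U orthogonal to itself, which makes the description by \<open>THE\<close>
  legitimate.\<close>

lemma
  assumes H: "herm H" and U: "subspace U" "U \<subseteq> S" and s: "s \<in> S"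
  shows oproj_in: "oproj H U s \<in> U" and oproj_orth: "\<And>u. u \<in> U \<Longrightarrow> H (s - oproj H U s) u = 0"
proof -
  note hf = herm_hform[OF H]
  obtain n e where B: "onb_of H U n e" using ex_orthonormal[OF H U] by blast
  note e = onb_in[OF B] and on = onb_on[OF B] and ex = onb_ex[OF B]
  define p where "p = (\<Sum>i<n. sc (H s (e i)) (e i))"
  have pU: "p \<in> U" unfolding p_def using e U by (intro subspace_sum subspace_scale) auto
  have eS: "\<And>i. i < n \<Longrightarrow> e i \<in> S" and pS: "p \<in> S" using e pU U by auto
  have pe: "H (s - p) (e j) = 0" if "j < n" for j
  proof -
    have "H p (e j) = (\<Sum>i<n. H s (e i) * H (e i) (e j))"
      unfolding p_def using e U that by (intro hform_sum[OF hf]) auto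
    also have "\<dots> = (\<Sum>i<n. if i = j then H s (e i) else 0)"
      using on that by (intro sum.cong) (auto simp: orthonormal_upto_def)
    finally show ?thesis using that hform_diff[OF hf s pS eS] by simp
  qed
  have orth: "H (s - p) u = 0" if "u \<in> U" for u
  proof -
    have "H (s - p) (\<Sum>i<n. sc (H u (e i)) (e i)) = (\<Sum>i<n. cnj (H u (e i)) * H (s - p) (e i))"
      using eS s pS by (intro hform_sum_right[OF hf]) (auto intro: S_diff)
    then show ?thesis by (simp add: ex[OF that] pe)
  qed
  have uniq: "q = p" if q: "q \<in> U" "\<forall>u\<in>U. H (s - q) u = 0" for q
  proof -
    have d: "p - q \<in> U" using pU q U by (simp add: subspace_diff)
    have inS: "s - q \<in> S" "s - p \<in> S" "p - q \<in> S" using s q pU d U by (auto intro: S_diff)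
    have "H (p - q) (p - q) = H ((s - q) - (s - p)) (p - q)" by (simp add: algebra_simps)
    also have "\<dots> = H (s - q) (p - q) - H (s - p) (p - q)" by (rule hform_diff[OF hf]) (use inS in auto)
    finally have "H (p - q) (p - q) = 0" using q orth d by simp
    then show ?thesis using herm_zero_iff[OF H inS(3)] by simp
  qed
  have op: "oproj H U s = p"
    unfolding oproj_def
  proof (rule the_equality)
    show "p \<in> U \<and> (\<forall>u\<in>U. H (s - p) u = 0)" using pU orth by blast
  qed (use uniq in blast)
  then show "oproj H U s \<in> U" "\<And>u. u \<in> U \<Longrightarrow> H (s - oproj H U s) u = 0" unfolding op using pU orth by blast+
qed

lemma oproj_eqI:
  assumes H: "herm H" and U: "subspace U" "U \<subseteq> S" and s: "s \<in> S"
    and p: "p \<in> U" "\<And>u. u \<in> U \<Longrightarrow> H (s - p) u = 0"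
  shows "oproj H U s = p"
proof -
  note hf = herm_hform[OF H]
  let ?q = "oproj H U s"
  have q: "?q \<in> U" "\<And>u. u \<in> U \<Longrightarrow> H (s - ?q) u = 0" using oproj_in oproj_orth H U s by auto
  have d: "?q - p \<in> U" using p q U by (simp add: subspace_diff)
  have inS: "s - ?q \<in> S" "s - p \<in> S" "?q - p \<in> S" using s q p d U by (auto intro: S_diff)
  have "H (?q - p) (?q - p) = H ((s - p) - (s - ?q)) (?q - p)" by (simp add: algebra_simps)
  also have "\<dots> = H (s - p) (?q - p) - H (s - ?q) (?q - p)" by (rule hform_diff[OF hf]) (use inS in auto)
  finally have "H (?q - p) (?q - p) = 0" using q p d by simp
  then show ?thesis using herm_zero_iff[OF H inS(3)] by simp
qed

lemma oproj_add:
  assumes H: "herm H" and U: "subspace U" "U \<subseteq> S" and s: "s \<in> S" "t \<in> S"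
  shows "oproj H U (s + t) = oproj H U s + oproj H U t"
proof (rule oproj_eqI[OF H U])
  note i = oproj_in[OF H U s(1)] oproj_in[OF H U s(2)]
  show "oproj H U s + oproj H U t \<in> U" using i U by (simp add: subspace_add)
  fix u assume u: "u \<in> U"
  have "H (s + t - (oproj H U s + oproj H U t)) u = H ((s - oproj H U s) + (t - oproj H U t)) u"
    by (simp add: algebra_simps)
  also have "\<dots> = H (s - oproj H U s) u + H (t - oproj H U t) u"
    using i s u U by (intro hform_add herm_hform H S_diff) auto
  finally show "H (s + t - (oproj H U s + oproj H U t)) u = 0"
    using oproj_orth[OF H U s(1) u] oproj_orth[OF H U s(2) u] by simp
qed (use s S_add in auto)

lemma oproj_scale:
  assumes H: "herm H" and U: "subspace U" "U \<subseteq> S" and s: "s \<in> S"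
  shows "oproj H U (sc c s) = sc c (oproj H U s)"
proof (rule oproj_eqI[OF H U])
  note i = oproj_in[OF H U s]
  show "sc c (oproj H U s) \<in> U" using i U by (simp add: subspace_scale)
  fix u assume u: "u \<in> U"
  have "H (sc c s - sc c (oproj H U s)) u = c * H (s - oproj H U s) u"
    using i s u U unfolding scale_right_diff_distrib[symmetric]
    by (intro hform_scale herm_hform H S_diff) auto
  then show "H (sc c s - sc c (oproj H U s)) u = 0" using oproj_orth[OF H U s u] by simp
qed (use s S_scale in auto)

lemma ex_orthonormal_basis:
  assumes H: "herm H"
  shows "\<exists>bs. orthonormal_basis sc S H bs"
proof -
  obtain n e where B: "onb_of H S n e" using ex_orthonormal[OF H subspace_S order_refl] by blast
  note e = onb_in[OF B] and on = onb_on[OF B] and ex = onb_ex[OF B]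
  note ind = orthonormal_upto_independent[OF herm_hform[OF H] e on]
  let ?bs = "map e [0..<n]"
  have set: "set ?bs = e ` {..<n}" by auto
  have "S \<subseteq> span (e ` {..<n})"
  proof
    fix u assume "u \<in> S"
    have "(\<Sum>i<n. sc (H u (e i)) (e i)) \<in> span (e ` {..<n})" by (intro span_sum span_scale span_base) auto
    then show "u \<in> span (e ` {..<n})" unfolding ex[OF \<open>u \<in> S\<close>] .
  qed
  moreover have "span (e ` {..<n}) \<subseteq> S" using e by (intro span_minimal subspace_S) auto
  ultimately have "orthonormal_basis sc S H ?bs"
    using ind on by (auto simp: orthonormal_basis_def is_basis_def set distinct_map orthonormal_upto_def
        atLeast0LessThan)
  then show ?thesis by blast
qed

lemma basis_length: "is_basis sc S bs \<Longrightarrow> length bs = dim S"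
  unfolding is_basis_def by (metis basis_card_eq_dim distinct_card span_superset subset_refl)

lemma basis_in: "is_basis sc S bs \<Longrightarrow> i < length bs \<Longrightarrow> bs ! i \<in> S"
  unfolding is_basis_def by (metis nth_mem span_base)

lemma basis_expand:
  assumes "is_basis sc S bs" "u \<in> S"
  obtains a where "(\<Sum>i<length bs. sc (a i) (bs ! i)) = u"
proof -
  have "u \<in> span (set bs)" using assms by (simp add: is_basis_def)
  then have "\<exists>f. u = (\<Sum>v\<in>set bs. sc (f v) v)" by (simp only: span_finite[OF finite_set] image_iff bex_UNIV)
  then obtain f where "u = (\<Sum>v\<in>set bs. sc (f v) v)" by (rule exE)
  moreover have bij: "bij_betw ((!) bs) {..<length bs} (set bs)"
    using assms by (intro bij_betw_nth) (simp_all add: is_basis_def)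
  ultimately have "(\<Sum>i<length bs. sc (f (bs ! i)) (bs ! i)) = u"
    using sum.reindex_bij_betw[OF bij, of "\<lambda>v. sc (f v) v"] by simp
  then show thesis by (rule that)
qed

text \<open>Passage from the lists of the definitions to indexed systems with a reproducing
  expansion, on which the later computations rest.\<close>

lemma orthonormal_basis_onb:
  assumes H: "hform H" and bs: "orthonormal_basis sc S H bs"
  shows "onb_of H S (length bs) ((!) bs)"
proof -
  have b: "is_basis sc S bs" using bs by (simp add: orthonormal_basis_def)
  have on: "orthonormal_upto H ((!) bs) (length bs)"
    using bs by (simp add: orthonormal_basis_def orthonormal_upto_def)
  have "(\<Sum>i<length bs. sc (H u (bs ! i)) (bs ! i)) = u" if u: "u \<in> S" for u
  proof -
    obtain a where a: "(\<Sum>i<length bs. sc (a i) (bs ! i)) = u" by (rule basis_expand[OF b u])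
    have "H u (bs ! j) = a j" if j: "j < length bs" for j
    proof -
      have "H (\<Sum>i<length bs. sc (a i) (bs ! i)) (bs ! j) = (\<Sum>i<length bs. a i * H (bs ! i) (bs ! j))"
        using basis_in[OF b] j by (intro hform_sum[OF H]) auto
      also have "\<dots> = (\<Sum>i<length bs. if i = j then a i else 0)"
        using on j by (intro sum.cong) (auto simp: orthonormal_upto_def)
      finally show ?thesis unfolding a using j by simp
    qed
    then have "(\<Sum>i<length bs. sc (H u (bs ! i)) (bs ! i)) = (\<Sum>i<length bs. sc (a i) (bs ! i))"
      by (intro sum.cong) auto
    also have "\<dots> = u" by (rule a)
    finally show ?thesis .
  qed
  then show ?thesis using basis_in[OF b] on unfolding onb_of_def by blast
qed

section \<open>Comparison of forms\<close>

lemma hform_bound: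
  assumes D: "hform D" and H: "hform H" and e: "\<And>i. i < n \<Longrightarrow> e i \<in> S" and on: "orthonormal_upto H e n"
    and s: "(\<Sum>i<n. sc (H s (e i)) (e i)) = s" "s \<in> S"
  shows "cmod (D s s) \<le> (\<Sum>i<n. \<Sum>j<n. cmod (D (e i) (e j))) * Re (H s s)"
proof -
  define a where "a i = H s (e i)" for i
  have le: "(cmod (a i))\<^sup>2 \<le> Re (H s s)" if "i < n" for i
  proof -
    have "Re (H s s) = (\<Sum>i<n. (cmod (a i))\<^sup>2)"
      unfolding a_def by (rule orthonormal_parseval[OF H _ on s]) (rule e)
    then show ?thesis using that member_le_sum[of i "{..<n}" "\<lambda>i. (cmod (a i))\<^sup>2"] by simp
  qed
  have "D (\<Sum>i<n. sc (a i) (e i)) s = (\<Sum>i<n. a i * D (e i) s)"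
    by (rule hform_sum[OF D]) (use e s in auto)
  then have "D s s = (\<Sum>i<n. a i * D (e i) s)" using s by (simp add: a_def)
  also have "\<dots> = (\<Sum>i<n. \<Sum>j<n. a i * (cnj (a j) * D (e i) (e j)))"
  proof (intro sum.cong refl)
    fix i assume i: "i \<in> {..<n}"
    have "D (e i) (\<Sum>j<n. sc (a j) (e j)) = (\<Sum>j<n. cnj (a j) * D (e i) (e j))"
      by (rule hform_sum_right[OF D]) (use e i in auto)
    then show "a i * D (e i) s = (\<Sum>j<n. a i * (cnj (a j) * D (e i) (e j)))"
      using s by (simp add: a_def sum_distrib_left)
  qed
  finally have "cmod (D s s) \<le> (\<Sum>i<n. \<Sum>j<n. cmod (a i * (cnj (a j) * D (e i) (e j))))"
    by (simp only:) (rule order_trans[OF norm_sum sum_mono[OF norm_sum]])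
  also have "\<dots> \<le> (\<Sum>i<n. \<Sum>j<n. Re (H s s) * cmod (D (e i) (e j)))"
  proof (intro sum_mono)
    fix i j assume "i \<in> {..<n}" "j \<in> {..<n}"
    \<comment> \<open>The product is at most the mean of the two squares, and each square is at most
      H(s,s) by Parseval.\<close>
    then have "cmod (a i) * cmod (a j) \<le> Re (H s s)"
      using le[of i] le[of j] sum_squares_bound[of "cmod (a i)" "cmod (a j)"] by simp
    then show "cmod (a i * (cnj (a j) * D (e i) (e j))) \<le> Re (H s s) * cmod (D (e i) (e j))"
      using mult_right_mono[of "cmod (a i) * cmod (a j)" _ "cmod (D (e i) (e j))"] by (simp add: norm_mult mult.assoc)
  qed
  also have "\<dots> = (\<Sum>i<n. \<Sum>j<n. cmod (D (e i) (e j))) * Re (H s s)"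
    by (simp add: sum_distrib_left mult.commute[of _ "Re (H s s)"])
  finally show ?thesis .
qed

text \<open>Adding 1 to the sum of the entry moduli of \<open>D\<close> keeps the constant strictly
  positive even when \<open>D\<close> vanishes, so that its inverse can be used for lower
  bounds.\<close>

lemma herm_dominates:
  assumes H: "herm H" and D: "hform D"
  obtains C where "C > 0" "\<And>s. s \<in> S \<Longrightarrow> Re (D s s) \<le> C * Re (H s s)"
proof -
  obtain n e where B: "onb_of H S n e" using ex_orthonormal[OF H subspace_S order_refl] by blast
  note e = onb_in[OF B] and on = onb_on[OF B] and ex = onb_ex[OF B]
  define C where "C = (\<Sum>i<n. \<Sum>j<n. cmod (D (e i) (e j)))"
  have "C \<ge> 0" unfolding C_def by (intro sum_nonneg) (rule norm_ge_zero)
  have "Re (D s s) \<le> (C + 1) * Re (H s s)" if s: "s \<in> S" for s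
  proof -
    have "Re (D s s) \<le> C * Re (H s s)"
      unfolding C_def by (rule order_trans[OF complex_Re_le_cmod hform_bound[OF D herm_hform[OF H] e on ex[OF s] s]])
    then show ?thesis using herm_nonneg[OF H s] by (metis add_increasing2 distrib_right mult_1)
  qed
  with \<open>C \<ge> 0\<close> show thesis by (intro that[of "C + 1"]) auto
qed

text \<open>The error is measured relative to the definite limit \<open>K\<close>, because such a
  bound is a two-sided comparison with multiples of \<open>K\<close>, to which a monotone
  homogeneous map can be applied.\<close>

lemma eventually_close:
  assumes K: "herm K" and F: "\<And>m. hform (F m)"
    and lim: "\<And>s t. s \<in> S \<Longrightarrow> t \<in> S \<Longrightarrow> (\<lambda>m. F m s t) \<longlonglongrightarrow> K s t" and eps: "\<epsilon> > 0"
  shows "eventually (\<lambda>m. \<forall>s\<in>S. \<bar>Re (F m s s) - Re (K s s)\<bar> \<le> \<epsilon> * Re (K s s)) sequentially"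
proof -
  obtain n e where B: "onb_of K S n e" using ex_orthonormal[OF K subspace_S order_refl] by blast
  note e = onb_in[OF B] and on = onb_on[OF B] and ex = onb_ex[OF B]
  have "(\<lambda>m. \<Sum>i<n. \<Sum>j<n. cmod (F m (e i) (e j) - K (e i) (e j))) \<longlonglongrightarrow>
     (\<Sum>i<n. \<Sum>j<n. cmod (K (e i) (e j) - K (e i) (e j)))"
    by (intro tendsto_intros lim) (use e in auto)
  then have "eventually (\<lambda>m. (\<Sum>i<n. \<Sum>j<n. cmod (F m (e i) (e j) - K (e i) (e j))) < \<epsilon>) sequentially"
    using eps by (intro order_tendstoD(2)[of _ 0]) auto
  then show ?thesis
  proof eventually_elim
    case (elim m)
    show ?case
    proof
      fix s assume s: "s \<in> S"
      have "\<bar>Re (F m s s) - Re (K s s)\<bar> \<le> cmod (F m s s - K s s)"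
        by (metis abs_Re_le_cmod minus_complex.simps(1))
      also have "\<dots> \<le> (\<Sum>i<n. \<Sum>j<n. cmod (F m (e i) (e j) - K (e i) (e j))) * Re (K s s)"
        using hform_bound[OF hform_minus[OF F herm_hform[OF K]] herm_hform[OF K] e on ex[OF s] s] .
      also have "\<dots> \<le> \<epsilon> * Re (K s s)" using elim herm_nonneg[OF K s] by (intro mult_right_mono) auto
      finally show "\<bar>Re (F m s s) - Re (K s s)\<bar> \<le> \<epsilon> * Re (K s s)" .
    qed
  qed
qed

text \<open>H - K is semidefinite, so a vector with zero diagonal value lies in its radical. A
  quadratic condition is thereby replaced by linear ones.\<close>

lemma eqset_iff:
  assumes "hform H" "hform K" "form_le K H"
  shows "s \<in> eqset H K \<longleftrightarrow> s \<in> S \<and> (\<forall>t\<in>S. H s t = K s t)"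
proof -
  have psd: "Re (H u u - K u u) \<ge> 0" if "u \<in> S" for u using assms(3) that by (auto simp: form_le_def)
  show ?thesis
    using hform_psd_null[OF hform_minus[OF assms(1,2)] psd, of s] by (auto simp: eqset_def)
qed

lemma eqset_subspace:
  assumes H: "hform H" and K: "hform K" and "form_le K H"
  shows "subspace (eqset H K)"
proof -
  note iff = eqset_iff[OF assms]
  show ?thesis
    unfolding subspace_def
  proof (intro conjI ballI allI)
    fix u v c assume "u \<in> eqset H K"
    then have u: "u \<in> S" "\<And>t. t \<in> S \<Longrightarrow> H u t = K u t" using iff by blast+
    show "sc c u \<in> eqset H K"
      unfolding iff using u hform_scale[OF H u(1)] hform_scale[OF K u(1)] by (simp add: S_scale)
    assume "v \<in> eqset H K"
    then have v: "v \<in> S" "\<And>t. t \<in> S \<Longrightarrow> H v t = K v t" using iff by blast+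
    show "u + v \<in> eqset H K"
      unfolding iff using u v hform_add[OF H u(1) v(1)] hform_add[OF K u(1) v(1)] by (simp add: S_add)
  qed (use iff hform_0[OF H] hform_0[OF K] in simp)
qed

end

section \<open>Quotient forms\<close>

context fd_space
begin

definition lift :: "('v \<Rightarrow> 'v \<Rightarrow> complex) \<Rightarrow> ('v \<Rightarrow> 'w::ab_group_add) \<Rightarrow> 'w \<Rightarrow> 'v" where
  "lift H ev u = (THE s. s \<in> S \<and> ev s = u \<and> (\<forall>t\<in>S. ev t = 0 \<longrightarrow> H s t = 0))"

text \<open>The quotient form: its value at (u, u) is the least value of H on the preimages of u.
  The value 0 off the image is the normalisation demanded by \<open>hermitian_inner\<close>.\<close>

definition qform :: "('v \<Rightarrow> 'v \<Rightarrow> complex) \<Rightarrow> ('v \<Rightarrow> 'w::ab_group_add) \<Rightarrow> 'w \<Rightarrow> 'w \<Rightarrow> complex" where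
  "qform H ev u v = (if u \<in> ev ` S \<and> v \<in> ev ` S then H (lift H ev u) (lift H ev v) else 0)"

end

text \<open>Besides evaluation of sections at a point, this is instantiated with an endomorphism of
  a single fibre, for the sake of its linearity rules.\<close>

locale evaluation = fd_space sc S + tgt: vector_space sc'
  for sc :: "complex \<Rightarrow> 'v::ab_group_add \<Rightarrow> 'v" and S and sc' :: "complex \<Rightarrow> 'w::ab_group_add \<Rightarrow> 'w" +
  fixes ev :: "'v \<Rightarrow> 'w"
  assumes ev_linear: "clinear_on sc S sc' ev"
begin

lemma ev_add: "s \<in> S \<Longrightarrow> t \<in> S \<Longrightarrow> ev (s + t) = ev s + ev t"
  and ev_scale: "s \<in> S \<Longrightarrow> ev (sc c s) = sc' c (ev s)"
  using ev_linear by (auto simp: clinear_on_def)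

lemma ev_0: "ev 0 = 0"
  using ev_add[of 0 0] by simp

lemma ev_diff: "s \<in> S \<Longrightarrow> t \<in> S \<Longrightarrow> ev (s - t) = ev s - ev t"
  using ev_add[of "s - t" t] by (simp add: S_diff)

lemma ev_sum: "(\<And>i. i \<in> I \<Longrightarrow> f i \<in> S) \<Longrightarrow> ev (sum f I) = (\<Sum>i\<in>I. ev (f i))"
  by (induction I rule: infinite_finite_induct) (simp_all add: ev_0 ev_add S_sum)

lemma kernel_subspace: "subspace {t\<in>S. ev t = 0}"
  by (auto simp: subspace_def ev_0 ev_add ev_scale S_add S_scale)

text \<open>Subtracting from any preimage its projection onto the kernel gives existence; two
  solutions differ by a kernel vector orthogonal to itself.\<close>

lemma lift_ex:
  assumes H: "herm H" and u: "u \<in> ev ` S"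
  shows "\<exists>!s. s \<in> S \<and> ev s = u \<and> (\<forall>t\<in>S. ev t = 0 \<longrightarrow> H s t = 0)"
proof -
  note hf = herm_hform[OF H]
  obtain s where s: "s \<in> S" "ev s = u" using u by auto
  let ?N = "{t\<in>S. ev t = 0}"
  have N: "subspace ?N" "?N \<subseteq> S" using kernel_subspace by auto
  let ?p = "oproj H ?N s"
  have p: "?p \<in> S" "ev ?p = 0" using oproj_in[OF H N s(1)] by auto
  show ?thesis
  proof (rule ex1I[of _ "s - ?p"])
    show "s - ?p \<in> S \<and> ev (s - ?p) = u \<and> (\<forall>t\<in>S. ev t = 0 \<longrightarrow> H (s - ?p) t = 0)"
      using s p oproj_orth[OF H N s(1)] by (auto simp: ev_diff S_diff)
    fix q assume q: "q \<in> S \<and> ev q = u \<and> (\<forall>t\<in>S. ev t = 0 \<longrightarrow> H q t = 0)"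
    let ?d = "q - (s - ?p)"
    have d: "?d \<in> S" "ev ?d = 0" using q s p by (auto simp: ev_diff S_diff)
    have "H ?d ?d = H q ?d - H (s - ?p) ?d" using q s p d by (intro hform_diff[OF hf] S_diff) auto
    also have "\<dots> = 0" using q d oproj_orth[OF H N s(1)] by simp
    finally show "q = s - ?p" using herm_zero_iff[OF H d(1)] by simp
  qed
qed

lemma
  assumes H: "herm H" and u: "u \<in> ev ` S"
  shows lift_in: "lift H ev u \<in> S" and ev_lift: "ev (lift H ev u) = u"
    and lift_orth: "\<And>t. t \<in> S \<Longrightarrow> ev t = 0 \<Longrightarrow> H (lift H ev u) t = 0"
  using theI'[OF lift_ex[OF assms]] unfolding lift_def by blast+

lemma lift_eqI:
  assumes "herm H" "s \<in> S" "ev s = u" "\<And>t. t \<in> S \<Longrightarrow> ev t = 0 \<Longrightarrow> H s t = 0"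
  shows "lift H ev u = s"
  unfolding lift_def by (rule the1_equality[OF lift_ex]) (use assms in blast)+

lemma range_subspace: "tgt.subspace (ev ` S)"
  unfolding tgt.subspace_def
proof (intro conjI ballI allI)
  show "0 \<in> ev ` S" using ev_0 S_0 by (metis imageI)
  fix u c assume "u \<in> ev ` S"
  then show "sc' c u \<in> ev ` S" by (metis (no_types, lifting) S_scale ev_scale image_iff)
  fix v assume "u \<in> ev ` S" "v \<in> ev ` S"
  then show "u + v \<in> ev ` S" by (metis (no_types, lifting) S_add ev_add image_iff)
qed

lemma lift_add:
  assumes H: "herm H" and u: "u \<in> ev ` S" "v \<in> ev ` S"
  shows "lift H ev (u + v) = lift H ev u + lift H ev v"
  using assms hform_add[OF herm_hform[OF H]]
  by (intro lift_eqI) (auto simp: lift_in ev_lift ev_add lift_orth S_add)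

lemma lift_scale:
  assumes H: "herm H" and u: "u \<in> ev ` S"
  shows "lift H ev (sc' c u) = sc c (lift H ev u)"
  using assms hform_scale[OF herm_hform[OF H]]
  by (intro lift_eqI) (auto simp: lift_in ev_lift ev_scale lift_orth S_scale)

text \<open>s and the lift of ev s differ by an element of the kernel, which is orthogonal to every
  lift. So the lift is the adjoint of \<open>ev\<close> for \<open>H\<close> and the quotient
  form.\<close>

lemma lift_adjoint:
  assumes H: "herm H" and u: "u \<in> ev ` S" and s: "s \<in> S"
  shows "H (lift H ev u) s = qform H ev u (ev s)"
proof -
  have es: "ev s \<in> ev ` S" using s by simp
  let ?l = "lift H ev (ev s)"
  have l: "?l \<in> S" "ev ?l = ev s" using lift_in[OF H es] ev_lift[OF H es] .
  have "H (lift H ev u) (s - ?l) = 0"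
    using lift_orth[OF H u, of "s - ?l"] l s by (simp add: S_diff ev_diff)
  then have "H (lift H ev u) s = H (lift H ev u) ?l"
    using hform_diff_right[OF herm_hform[OF H] s l(1) lift_in[OF H u]] by simp
  then show ?thesis using u es by (simp add: qform_def)
qed

lemma qform_diag: "u \<in> ev ` S \<Longrightarrow> qform H ev u u = H (lift H ev u) (lift H ev u)"
  by (simp add: qform_def)

lemma qform_herm:
  assumes H: "herm H"
  shows "hermitian_inner sc' (ev ` S) (qform H ev)"
  unfolding hermitian_inner_def clinear_on_def
proof (intro conjI ballI allI impI)
  note hf = herm_hform[OF H]
  fix w assume w: "w \<in> ev ` S"
  fix u assume u: "u \<in> ev ` S"
  note mem = lift_in[OF H u] lift_in[OF H w]
  show "qform H ev (sc' c u) w = c * qform H ev u w" for c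
    using u w mem tgt.subspace_scale[OF range_subspace u, of c]
    by (simp add: qform_def lift_scale[OF H u] hform_scale[OF hf])
  show "qform H ev w u = cnj (qform H ev u w)"
    using u w hform_cnj[OF hf mem] by (simp add: qform_def)
  fix v assume v: "v \<in> ev ` S"
  show "qform H ev (u + v) w = qform H ev u w + qform H ev v w"
    using u v w mem lift_in[OF H v] tgt.subspace_add[OF range_subspace u v]
    by (simp add: qform_def lift_add[OF H u v] hform_add[OF hf])
next
  fix u assume u: "u \<in> ev ` S" "u \<noteq> 0"
  have "lift H ev u \<noteq> 0" using ev_lift[OF H u(1)] u(2) ev_0 by auto
  then show "Re (qform H ev u u) > 0"
    using herm_pos[OF H lift_in[OF H u(1)]] u by (simp add: qform_diag)
qed (auto simp: qform_def)

text \<open>Pythagoras for the splitting of s into the lift of its value and a kernel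
  element.\<close>

lemma qform_le:
  assumes H: "herm H" and s: "s \<in> S"
  shows "Re (qform H ev (ev s) (ev s)) \<le> Re (H s s)"
proof -
  note hf = herm_hform[OF H]
  have es: "ev s \<in> ev ` S" using s by simp
  let ?l = "lift H ev (ev s)"
  have l: "?l \<in> S" "ev ?l = ev s" using lift_in[OF H es] ev_lift[OF H es] .
  let ?d = "s - ?l"
  have d: "?d \<in> S" "ev ?d = 0" using l s by (auto simp: S_diff ev_diff)
  have z: "H ?l ?d = 0" using lift_orth[OF H es d] .
  then have z': "H ?d ?l = 0" using hform_cnj[OF hf l(1) d(1)] by simp
  have "H (?l + ?d) (?l + ?d) = (H ?l ?l + H ?d ?l) + (H ?l ?d + H ?d ?d)"
    by (simp only: hform_add_right[OF hf l(1) d(1) S_add[OF l(1) d(1)]] hform_add[OF hf l(1) d(1) l(1)]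
        hform_add[OF hf l(1) d(1) d(1)])
  then have "H s s = H ?l ?l + H ?d ?d" unfolding z z' by simp
  then show ?thesis using herm_nonneg[OF H d(1)] by (simp add: qform_diag[OF es])
qed

text \<open>The lift for \<open>H\<close> is a competitor in the minimisation that defines the
  quotient norm for \<open>K\<close>.\<close>

lemma qform_mono:
  assumes H: "herm H" and K: "herm K" and le: "form_le K H" and u: "u \<in> ev ` S"
  shows "Re (qform K ev u u) \<le> Re (qform H ev u u)"
proof -
  have l: "lift H ev u \<in> S" "ev (lift H ev u) = u" using lift_in[OF H u] ev_lift[OF H u] .
  have "Re (qform K ev u u) \<le> Re (K (lift H ev u) (lift H ev u))" using qform_le[OF K l(1)] l(2) by simp
  also have "\<dots> \<le> Re (H (lift H ev u) (lift H ev u))" using le l(1) by (auto simp: form_le_def)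
  finally show ?thesis using u by (simp add: qform_diag)
qed

text \<open>Equality in \<open>qform_mono\<close> forces equality at the competitor used there,
  namely the lift with respect to the larger form.\<close>

lemma qform_eq_imp_eqset:
  assumes H: "herm H" and K: "herm K" and le: "form_le K H" and u: "u \<in> ev ` S"
    and eq: "Re (qform K ev u u) = Re (qform H ev u u)"
  shows "lift H ev u \<in> eqset H K"
proof -
  have l: "lift H ev u \<in> S" "ev (lift H ev u) = u" using lift_in[OF H u] ev_lift[OF H u] .
  have "Re (qform K ev u u) \<le> Re (K (lift H ev u) (lift H ev u))" using qform_le[OF K l(1)] l(2) by simp
  moreover have "Re (K (lift H ev u) (lift H ev u)) \<le> Re (H (lift H ev u) (lift H ev u))"
    using le l(1) by (auto simp: form_le_def)
  ultimately show ?thesis using u l eq by (simp add: qform_diag eqset_def)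
qed

text \<open>Sending s to the lift of ev s is the orthogonal projection onto the complement of the
  kernel; both sides equal the quotient form of the two values.\<close>

lemma lift_self_adjoint:
  assumes H: "herm H" and s: "s \<in> S" "t \<in> S"
  shows "H (lift H ev (ev s)) t = H s (lift H ev (ev t))"
proof -
  have e: "ev s \<in> ev ` S" "ev t \<in> ev ` S" using s by auto
  have "H s (lift H ev (ev t)) = cnj (H (lift H ev (ev t)) s)"
    using hform_cnj[OF herm_hform[OF H] lift_in[OF H e(2)] s(1)] .
  also have "\<dots> = cnj (qform H ev (ev t) (ev s))" by (simp add: lift_adjoint[OF H e(2) s(1)])
  also have "\<dots> = qform H ev (ev s) (ev t)"
    using qform_herm[OF H] e unfolding hermitian_inner_def by metis
  finally show ?thesis by (simp add: lift_adjoint[OF H e(1) s(2)])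
qed

lemma lift_scaled_form: "lift (scaled_form c H) ev u = lift H ev u" if "c > 0"
  using that by (simp add: lift_def scaled_form_def)

lemma qform_scaled_form: "c > 0 \<Longrightarrow> qform (scaled_form c H) ev u v = of_real c * qform H ev u v"
  by (simp add: qform_def lift_scaled_form) (simp add: scaled_form_def)

text \<open>The sum is the image under \<open>ev\<close> of the Fourier expansion of the lift of u,
  since the coefficients coincide by adjointness.\<close>

lemma qform_bergman:
  assumes H: "herm H" and B: "onb_of H S n e" and u: "u \<in> ev ` S"
  shows "(\<Sum>i<n. sc' (qform H ev u (ev (e i))) (ev (e i))) = u"
proof -
  note e = onb_in[OF B]
  have "(\<Sum>i<n. sc' (qform H ev u (ev (e i))) (ev (e i))) = (\<Sum>i<n. ev (sc (H (lift H ev u) (e i)) (e i)))"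
    by (intro sum.cong refl) (simp add: e lift_adjoint[OF H u] ev_scale)
  also have "\<dots> = ev (\<Sum>i<n. sc (H (lift H ev u) (e i)) (e i))"
    by (rule ev_sum[symmetric]) (auto intro: e S_scale)
  also have "\<dots> = u" using onb_ex[OF B lift_in[OF H u]] ev_lift[OF H u] by simp
  finally show ?thesis .
qed

lemma target_fd_space:
  assumes H: "herm H"
  shows "fd_space sc' (ev ` S)"
proof
  show "tgt.subspace (ev ` S)" by (rule range_subspace)
  obtain n e where B: "onb_of H S n e" using ex_orthonormal[OF H subspace_S order_refl] by blast
  note e = onb_in[OF B]
  have "ev s \<in> tgt.span ((\<lambda>i. ev (e i)) ` {..<n})" if s: "s \<in> S" for s
  proof -
    have "ev (\<Sum>i<n. sc (H s (e i)) (e i)) = (\<Sum>i<n. ev (sc (H s (e i)) (e i)))"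
      by (rule ev_sum) (auto intro!: S_scale e)
    also have "\<dots> = (\<Sum>i<n. sc' (H s (e i)) (ev (e i)))"
      by (intro sum.cong refl) (simp add: ev_scale e)
    also have "\<dots> \<in> tgt.span ((\<lambda>i. ev (e i)) ` {..<n})"
      by (intro tgt.span_sum tgt.span_scale tgt.span_base) auto
    finally show ?thesis unfolding onb_ex[OF B s] .
  qed
  then show "\<exists>B. finite B \<and> ev ` S \<subseteq> tgt.span B"
    by (intro exI[of _ "(\<lambda>i. ev (e i)) ` {..<n}"]) auto
qed

text \<open>The identity says that L u, the sum of h(u, ev e_i) e_i, is a preimage of u, and
  expanding s shows that L is adjoint to \<open>ev\<close> for h. Hence L u is orthogonal to the
  kernel and is the lift of u, which expresses h through \<open>H\<close>.\<close>

lemma qform_unique: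
  assumes H: "herm H" and B: "onb_of H S n e" and h: "hermitian_inner sc' (ev ` S) h"
    and berg: "\<And>u. u \<in> ev ` S \<Longrightarrow> (\<Sum>i<n. sc' (h u (ev (e i))) (ev (e i))) = u"
  shows "h = qform H ev"
proof -
  note hf = herm_hform[OF H] and e = onb_in[OF B]
  interpret F: fd_space sc' "ev ` S" by (rule target_fd_space[OF H])
  note hh = F.herm_hform[OF h]
  have ee: "i < n \<Longrightarrow> ev (e i) \<in> ev ` S" for i using e by blast
  define L where "L u = (\<Sum>i<n. sc (h u (ev (e i))) (e i))" for u
  have LS: "L u \<in> S" for u unfolding L_def by (auto intro!: S_sum S_scale e)
  have evL: "ev (L u) = u" if u: "u \<in> ev ` S" for u
  proof -
    have "ev (L u) = (\<Sum>i<n. ev (sc (h u (ev (e i))) (e i)))"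
      unfolding L_def by (rule ev_sum) (auto intro!: S_scale e)
    also have "\<dots> = (\<Sum>i<n. sc' (h u (ev (e i))) (ev (e i)))"
      by (intro sum.cong refl) (simp add: ev_scale e)
    finally show ?thesis using berg[OF u] by simp
  qed
  have adj: "H (L u) s = h u (ev s)" if u: "u \<in> ev ` S" and s: "s \<in> S" for u s
  proof -
    have "H (L u) s = (\<Sum>i<n. h u (ev (e i)) * H (e i) s)"
      unfolding L_def by (rule hform_sum[OF hf]) (use e s in auto)
    also have "\<dots> = (\<Sum>i<n. cnj (H s (e i)) * h u (ev (e i)))"
    proof (intro sum.cong refl)
      fix i assume "i \<in> {..<n}"
      then show "h u (ev (e i)) * H (e i) s = cnj (H s (e i)) * h u (ev (e i))"
        using hform_cnj[OF hf s, of "e i"] e by simp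
    qed
    also have "\<dots> = h u (\<Sum>i<n. sc' (H s (e i)) (ev (e i)))"
      by (rule F.hform_sum_right[OF hh, symmetric]) (use ee u in auto)
    also have "(\<Sum>i<n. sc' (H s (e i)) (ev (e i))) = (\<Sum>i<n. ev (sc (H s (e i)) (e i)))"
      by (intro sum.cong refl) (simp add: ev_scale e)
    also have "\<dots> = ev (\<Sum>i<n. sc (H s (e i)) (e i))"
      by (rule ev_sum[symmetric]) (auto intro!: S_scale e)
    finally show ?thesis using onb_ex[OF B s] by simp
  qed
  have L: "lift H ev u = L u" if u: "u \<in> ev ` S" for u
    by (rule lift_eqI[OF H LS evL[OF u]]) (simp add: adj[OF u] F.hform_0_right[OF hh u])
  show ?thesis
  proof (intro ext)
    fix u v show "h u v = qform H ev u v"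
    proof (cases "u \<in> ev ` S \<and> v \<in> ev ` S")
      case True
      then have "qform H ev u v = h u (ev (L v))" by (simp add: qform_def L adj LS)
      then show ?thesis using True evL by simp
    next
      case False
      then show ?thesis using F.herm_outside[OF h, of u v] by (auto simp: qform_def)
    qed
  qed
qed

end

section \<open>Iteration of monotone homogeneous maps\<close>

lemma finite_bounded_convergent_subseq:
  fixes f :: "nat \<Rightarrow> 'i \<Rightarrow> complex"
  assumes "finite I" "\<And>i. i \<in> I \<Longrightarrow> bounded (range (\<lambda>m. f m i))"
  shows "\<exists>r. strict_mono r \<and> (\<forall>i\<in>I. convergent (\<lambda>m. f (r m) i))"
  using assms
proof (induction I rule: finite_induct)
  case empty
  then show ?case using strict_mono_id by blast
next
  case (insert x I)
  obtain r where r: "strict_mono r" "\<forall>i\<in>I. convergent (\<lambda>m. f (r m) i)" using insert by auto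
  have "bounded (range (\<lambda>m. f (r m) x))"
    using insert.prems[of x] by (rule bounded_subset) auto
  then obtain q l where q: "strict_mono q" "((\<lambda>m. f (r m) x) \<circ> q) \<longlonglongrightarrow> l"
    using bounded_imp_convergent_subsequence by blast
  have "convergent (\<lambda>m. f ((r \<circ> q) m) i)" if i: "i \<in> insert x I" for i
  proof (cases "i = x")
    case True
    then show ?thesis using q(2) by (auto simp: convergent_def o_def)
  next
    case False
    then have "convergent (\<lambda>m. f (r m) i)" using r(2) i by blast
    then obtain l' where "(\<lambda>m. f (r m) i) \<longlonglongrightarrow> l'" unfolding convergent_def by blast
    then have "((\<lambda>m. f (r m) i) \<circ> q) \<longlonglongrightarrow> l'" using q(1) by (rule LIMSEQ_subseq_LIMSEQ)
    then show ?thesis by (auto simp: convergent_def o_def)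
  qed
  then show ?case using strict_mono_o[OF r(1) q(1)] by blast
qed

context fd_space
begin

lemma form_le_trans: "form_le K H \<Longrightarrow> form_le H G \<Longrightarrow> form_le K G"
  and form_le_scaled_form: "c \<ge> 0 \<Longrightarrow> form_le K H \<Longrightarrow> form_le (scaled_form c K) (scaled_form c H)"
  and scaled_form_scaled_form: "scaled_form c (scaled_form d H) = scaled_form (c * d) H"
  and scaled_form_1: "scaled_form 1 H = H"
  by (auto simp: form_le_def scaled_form_def mult.assoc fun_eq_iff intro: order_trans mult_left_mono)

lemma Re_scaled_form: "Re (scaled_form c H u v) = c * Re (H u v)"
  by (simp add: scaled_form_def)

lemma subspace_eq_dimI:
  assumes U: "subspace U" and W: "subspace W" "U \<subseteq> W" "W \<subseteq> S" and d: "dim W \<le> dim U"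
  shows "U = W"
proof (rule ccontr)
  assume "U \<noteq> W"
  then obtain w where w: "w \<in> W" "w \<notin> U" using W by blast
  obtain B where B: "B \<subseteq> U" "independent B" "U \<subseteq> span B" "card B = dim U" by (rule basis_exists)
  obtain C where C: "C \<subseteq> W" "independent C" "W \<subseteq> span C" "card C = dim W" by (rule basis_exists)
  obtain A where A: "finite A" "S \<subseteq> span A" using fin_dim by blast
  have finC: "finite C" using independent_span_bound[OF A(1) C(2)] C(1) W(3) A(2) by blast
  have "span B \<subseteq> U" by (rule span_minimal[OF B(1) U])
  then have "w \<notin> span B" using w by blast
  then have ind: "independent (insert w B)" using B(2) by (simp add: independent_insert)
  have "w \<notin> B" using w B by blast
  have "insert w B \<subseteq> span C" using w B(1) W(2) C(3) by blast
  then have "finite (insert w B) \<and> card (insert w B) \<le> card C" by (rule independent_span_bound[OF finC ind])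
  then show False using \<open>w \<notin> B\<close> B(4) C(4) d by auto
qed

text \<open>All geometry is packed into \<open>r1\<close> and \<open>r2\<close>: null spaces shrink
  under T, and a nonzero null space that does not shrink is everything. The vector z makes multiples
  of Hs comparable through their factors.\<close>

theorem iteration_convergence:
  assumes TM: "\<And>H. herm H \<Longrightarrow> herm (T H)"
    and mono: "\<And>H K. herm H \<Longrightarrow> herm K \<Longrightarrow> form_le K H \<Longrightarrow> form_le (T K) (T H)"
    and homog: "\<And>H c. herm H \<Longrightarrow> c > 0 \<Longrightarrow> T (scaled_form c H) = scaled_form c (T H)"
    and Hs: "herm Hs" "T Hs = Hs"
    and r1: "\<And>K. herm K \<Longrightarrow> form_le K Hs \<Longrightarrow> eqset Hs (T K) \<subseteq> eqset Hs K"
    and r2: "\<And>K. herm K \<Longrightarrow> form_le K Hs \<Longrightarrow> eqset Hs (T K) = eqset Hs K \<Longrightarrow> eqset Hs K \<noteq> {0} \<Longrightarrow>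
      eqset Hs K = S"
    and H: "herm H" and nontriv: "z \<in> S" "z \<noteq> 0"
  shows "\<exists>b>0. \<forall>s\<in>S. \<forall>t\<in>S. (\<lambda>m. (T ^^ m) H s t) \<longlonglongrightarrow> of_real b * Hs s t"
proof -
  define F where "F m = (T ^^ m) H" for m
  have pow: "herm ((T ^^ j) K)" if "herm K" for j K
    using that by (induction j) (auto intro: TM)
  have pow_mono: "form_le ((T ^^ j) K) ((T ^^ j) G)" if "herm K" "herm G" "form_le K G" for j K G
    using that by (induction j) (auto intro: mono pow)
  have pow_homog: "(T ^^ j) (scaled_form c K) = scaled_form c ((T ^^ j) K)" if "herm K" "c > 0" for j c K
    using that by (induction j) (auto simp: homog pow)
  have pow_fix: "(T ^^ j) Hs = Hs" for j by (induction j) (auto simp: Hs)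
  have FH: "herm (F m)" for m unfolding F_def by (rule pow[OF H])
  have Fadd: "F (j + m) = (T ^^ j) (F m)" for j m by (simp add: F_def funpow_add)
  have zpos: "Re (Hs z z) > 0" using herm_pos[OF Hs(1) nontriv] .

  \<comment> \<open>Multiples of Hs are fixed, so by monotonicity an upper bound c Hs for one member
    of the orbit holds for all later ones.\<close>
  have ub_mono: "form_le (F m') (scaled_form c Hs)" if "form_le (F m) (scaled_form c Hs)" "c > 0" "m \<le> m'" for m m' c
  proof -
    have "form_le ((T ^^ (m' - m)) (F m)) ((T ^^ (m' - m)) (scaled_form c Hs))"
      by (rule pow_mono[OF FH herm_scaled_form[OF Hs(1)]]) (use that in auto)
    then show ?thesis using that Fadd[of "m' - m" m] pow_homog[OF Hs(1) that(2)] pow_fix by simp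
  qed
  have lb_mono: "form_le (scaled_form c Hs) (F m')" if "form_le (scaled_form c Hs) (F m)" "c > 0" "m \<le> m'" for m m' c
  proof -
    have "form_le ((T ^^ (m' - m)) (scaled_form c Hs)) ((T ^^ (m' - m)) (F m))"
      by (rule pow_mono[OF herm_scaled_form[OF Hs(1)] FH]) (use that in auto)
    then show ?thesis using that Fadd[of "m' - m" m] pow_homog[OF Hs(1) that(2)] pow_fix by simp
  qed

  obtain a where a: "a > 0" "\<And>m. form_le (scaled_form a Hs) (F m)"
  proof -
    obtain C where C: "C > 0" "\<And>s. s \<in> S \<Longrightarrow> Re (Hs s s) \<le> C * Re (H s s)"
      using herm_dominates[OF H herm_hform[OF Hs(1)]] by metis
    have "form_le (scaled_form (1 / C) Hs) (F 0)"
      using C by (auto simp: form_le_def Re_scaled_form F_def field_simps)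
    then show thesis using that[of "1 / C"] C lb_mono[of "1 / C" 0] by auto
  qed
  obtain c0 where c0: "c0 > 0" "\<And>m. form_le (F m) (scaled_form c0 Hs)"
  proof -
    obtain C where C: "C > 0" "\<And>s. s \<in> S \<Longrightarrow> Re (H s s) \<le> C * Re (Hs s s)"
      using herm_dominates[OF Hs(1) herm_hform[OF H]] by metis
    have "form_le (F 0) (scaled_form C Hs)" using C by (auto simp: form_le_def Re_scaled_form F_def)
    then show thesis using that[of C] C ub_mono[of 0 C] by auto
  qed
  \<comment> \<open>The infimum b of these constants will be the factor in the limit; the lower
    bound a keeps it positive.\<close>
  define A where "A = {c. c > 0 \<and> (\<exists>m. form_le (F m) (scaled_form c Hs))}"
  have lower: "a \<le> c" if "c \<in> A" for c
  proof -
    obtain m where "form_le (F m) (scaled_form c Hs)" using \<open>c \<in> A\<close> by (auto simp: A_def)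
    then have "form_le (scaled_form a Hs) (scaled_form c Hs)" using a(2)[of m] form_le_trans by blast
    then have "a * Re (Hs z z) \<le> c * Re (Hs z z)" using nontriv by (auto simp: form_le_def Re_scaled_form)
    then show ?thesis using zpos by simp
  qed
  have Ane: "A \<noteq> {}" using c0 by (auto simp: A_def)
  have bdd: "bdd_below A" by (rule bdd_belowI[of _ a]) (rule lower)
  define b where "b = Inf A"
  have b: "b > 0" using cInf_greatest[OF Ane lower] a(1) by (simp add: b_def)
  have b_upper: "eventually (\<lambda>m. form_le (F m) (scaled_form (b + \<epsilon>) Hs)) sequentially" if eps: "\<epsilon> > 0" for \<epsilon>
  proof -
    obtain c where c: "c \<in> A" "c < b + \<epsilon>"
      using cInf_less_iff[OF Ane bdd, of "b + \<epsilon>"] eps by (auto simp: b_def)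
    then obtain m where m: "form_le (F m) (scaled_form c Hs)" "c > 0" by (auto simp: A_def)
    have "form_le (scaled_form c Hs) (scaled_form (b + \<epsilon>) Hs)"
      using c herm_nonneg[OF Hs(1)] by (auto simp: form_le_def Re_scaled_form intro: mult_right_mono)
    then show ?thesis
      unfolding eventually_sequentially using ub_mono[OF m] form_le_trans by blast
  qed
  have b_least: False if "form_le (F m) (scaled_form c Hs)" "c > 0" "c < b" for m c
  proof -
    have "c \<in> A" using that by (auto simp: A_def)
    then have "b \<le> c" unfolding b_def by (rule cInf_lower[OF _ bdd])
    then show False using that by simp
  qed

  obtain n e where B: "onb_of Hs S n e" using ex_orthonormal[OF Hs(1) subspace_S order_refl] by blast
  note e = onb_in[OF B]
  have diag_bdd: "\<exists>C. \<forall>m. \<bar>Re (F m s s)\<bar> \<le> C" if "s \<in> S" for s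
    using c0(2) herm_nonneg[OF FH that] that by (auto simp: form_le_def intro!: exI[of _ "Re (scaled_form c0 Hs s s)"])
  \<comment> \<open>The form c0 Hs bounds the diagonal values, and polarisation then bounds all
    other entries.\<close>
  have bddF: "bounded (range (\<lambda>m. F m s t))" if s: "s \<in> S" and t: "t \<in> S" for s t
  proof -
    obtain C1 where C1: "\<forall>m. \<bar>Re (F m s s)\<bar> \<le> C1" using diag_bdd[OF s] by blast
    obtain C2 where C2: "\<forall>m. \<bar>Re (F m t t)\<bar> \<le> C2" using diag_bdd[OF t] by blast
    obtain C3 where C3: "\<forall>m. \<bar>Re (F m (s + t) (s + t))\<bar> \<le> C3" using diag_bdd[OF S_add[OF s t]] by blast
    obtain C4 where C4: "\<forall>m. \<bar>Re (F m (s + sc \<i> t) (s + sc \<i> t))\<bar> \<le> C4"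
      using diag_bdd[OF S_add[OF s S_scale[OF t]]] by blast
    have tri: "\<bar>(x - y - w) / 2\<bar> \<le> (c + a + b) / 2"
      if "\<bar>x\<bar> \<le> c" "\<bar>y\<bar> \<le> a" "\<bar>w\<bar> \<le> b" for x y w a b c :: real
      using that by (auto simp: abs_le_iff)
    have "cmod (F m s t) \<le> C1 + C2 + C3 + C4" for m
    proof -
      let ?x = "(Re (F m (s + t) (s + t)) - Re (F m s s) - Re (F m t t)) / 2"
      let ?y = "(Re (F m (s + sc \<i> t) (s + sc \<i> t)) - Re (F m s s) - Re (F m t t)) / 2"
      have eq: "F m s t = of_real ?x + \<i> * of_real ?y"
        by (subst hform_polarization[OF herm_hform[OF FH] s t, of m]) (simp add: add_divide_distrib)
      have "cmod (F m s t) \<le> \<bar>Re (F m s t)\<bar> + \<bar>Im (F m s t)\<bar>" by (rule cmod_le)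
      also have "Re (F m s t) = ?x" by (subst eq) simp
      also have "Im (F m s t) = ?y" by (subst eq) simp
      also have "\<bar>?x\<bar> + \<bar>?y\<bar> \<le> (C3 + C1 + C2) / 2 + (C4 + C1 + C2) / 2"
        using C1 C2 C3 C4 by (intro add_mono tri) auto
      also have "\<dots> \<le> C1 + C2 + C3 + C4"
        using C3[rule_format, of m] C4[rule_format, of m] by (simp add: field_simps)
      finally show ?thesis .
    qed
    then show ?thesis by (auto simp: bounded_iff)
  qed
  have "\<exists>r. strict_mono r \<and> (\<forall>p\<in>{..<n}\<times>{..<n}. convergent (\<lambda>m. F (r m) (e (fst p)) (e (snd p))))"
    by (rule finite_bounded_convergent_subseq) (auto intro!: bddF e)
  then obtain r where r: "strict_mono r"
    and rc: "\<And>i j. i < n \<Longrightarrow> j < n \<Longrightarrow> convergent (\<lambda>m. F (r m) (e i) (e j))" by force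
  have conv: "convergent (\<lambda>m. F (r m) s t)" if s: "s \<in> S" and t: "t \<in> S" for s t
  proof -
    \<comment> \<open>Every entry is a combination, with coefficients independent of k, of the
      finitely many entries at the orthonormal system, so one subsequence serves all pairs.\<close>
    have eq: "F k s t = (\<Sum>i<n. \<Sum>j<n. Hs s (e i) * (cnj (Hs t (e j)) * F k (e i) (e j)))" for k
    proof -
      note hf = herm_hform[OF FH, of k]
      have "F k (\<Sum>i<n. sc (Hs s (e i)) (e i)) t = (\<Sum>i<n. Hs s (e i) * F k (e i) t)"
        by (rule hform_sum[OF hf]) (use e t in auto)
      also have "\<dots> = (\<Sum>i<n. \<Sum>j<n. Hs s (e i) * (cnj (Hs t (e j)) * F k (e i) (e j)))"
      proof (intro sum.cong refl)
        fix i assume i: "i \<in> {..<n}"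
        have "F k (e i) (\<Sum>j<n. sc (Hs t (e j)) (e j)) = (\<Sum>j<n. cnj (Hs t (e j)) * F k (e i) (e j))"
          by (rule hform_sum_right[OF hf]) (use e i in auto)
        then show "Hs s (e i) * F k (e i) t = (\<Sum>j<n. Hs s (e i) * (cnj (Hs t (e j)) * F k (e i) (e j)))"
          by (simp add: onb_ex[OF B t] sum_distrib_left)
      qed
      finally show ?thesis by (simp add: onb_ex[OF B s])
    qed
    have "\<exists>L. \<forall>i<n. \<forall>j<n. (\<lambda>m. F (r m) (e i) (e j)) \<longlonglongrightarrow> L i j"
      using rc by (intro exI[of _ "\<lambda>i j. lim (\<lambda>m. F (r m) (e i) (e j))"]) (auto simp: convergent_LIMSEQ_iff)
    then obtain L where "\<And>i j. i < n \<Longrightarrow> j < n \<Longrightarrow> (\<lambda>m. F (r m) (e i) (e j)) \<longlonglongrightarrow> L i j" by blast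
    then have "(\<lambda>m. F (r m) s t) \<longlonglongrightarrow> (\<Sum>i<n. \<Sum>j<n. Hs s (e i) * (cnj (Hs t (e j)) * L i j))"
      unfolding eq by (intro tendsto_intros) auto
    then show ?thesis by (auto simp: convergent_def)
  qed
  define K where "K s t = (if s \<in> S \<and> t \<in> S then lim (\<lambda>m. F (r m) s t) else 0)" for s t
  have limK: "(\<lambda>m. F (r m) s t) \<longlonglongrightarrow> K s t" if "s \<in> S" "t \<in> S" for s t
    using conv[OF that] that by (simp add: K_def convergent_LIMSEQ_iff)
  have hK: "hform K"
  proof (rule hformI)
    fix u v w assume m: "u \<in> S" "v \<in> S" "w \<in> S"
    have "(\<lambda>k. F (r k) (u + v) w) \<longlonglongrightarrow> K u w + K v w"
      using hform_add[OF herm_hform[OF FH] m] tendsto_add[OF limK[OF m(1,3)] limK[OF m(2,3)]] by simp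
    then show "K (u + v) w = K u w + K v w"
      using LIMSEQ_unique limK[OF S_add[OF m(1,2)] m(3)] by blast
  next
    fix c u w assume m: "u \<in> S" "w \<in> S"
    have "(\<lambda>k. F (r k) (sc c u) w) \<longlonglongrightarrow> c * K u w"
      using hform_scale[OF herm_hform[OF FH] m] tendsto_mult[OF tendsto_const limK[OF m]] by simp
    then show "K (sc c u) w = c * K u w"
      using LIMSEQ_unique limK[OF S_scale[OF m(1)] m(2)] by blast
  next
    fix u v assume m: "u \<in> S" "v \<in> S"
    have "(\<lambda>k. cnj (F (r k) u v)) \<longlonglongrightarrow> cnj (K u v)" by (rule tendsto_cnj[OF limK[OF m]])
    then have "(\<lambda>k. F (r k) v u) \<longlonglongrightarrow> cnj (K u v)" using hform_cnj[OF herm_hform[OF FH] m] by simp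
    then show "K v u = cnj (K u v)" using LIMSEQ_unique limK[OF m(2,1)] by blast
  qed
  have K: "herm K"
  proof (rule hermI[OF hK])
    fix u assume u: "u \<in> S" "u \<noteq> 0"
    \<comment> \<open>Definiteness survives the limit because the whole orbit stays above a
      Hs.\<close>
    have "a * Re (Hs u u) \<le> Re (F (r k) u u)" for k
      using a(2)[of "r k"] u by (auto simp: form_le_def Re_scaled_form)
    then have "a * Re (Hs u u) \<le> Re (K u u)"
      using tendsto_Re[OF limK[OF u(1) u(1)]] by (intro LIMSEQ_le_const) auto
    then show "Re (K u u) > 0" using herm_pos[OF Hs(1) u] a(1) by (smt (verit) mult_pos_pos)
  qed (auto simp: K_def)
  have Kb: "Re (K s s) \<le> b * Re (Hs s s)" if s: "s \<in> S" for s
  proof -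
    have "Re (K s s) \<le> (b + \<epsilon>) * Re (Hs s s)" if "\<epsilon> > 0" for \<epsilon>
    proof -
      have "eventually (\<lambda>m. form_le (F (r m)) (scaled_form (b + \<epsilon>) Hs)) sequentially"
        using eventually_subseq[OF r b_upper[OF that]] .
      then have "eventually (\<lambda>m. Re (F (r m) s s) \<le> (b + \<epsilon>) * Re (Hs s s)) sequentially"
        by eventually_elim (use s in \<open>auto simp: form_le_def Re_scaled_form\<close>)
      then show ?thesis using tendsto_Re[OF limK[OF s s]] by (intro tendsto_upperbound) auto
    qed
    note le = this
    show ?thesis
    proof (rule field_le_epsilon)
      fix d :: real assume d: "d > 0"
      \<comment> \<open>The added 1 avoids division by zero at s = 0.\<close>
      define \<epsilon> where "\<epsilon> = d / (Re (Hs s s) + 1)"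
      have pos: "Re (Hs s s) \<ge> 0" using herm_nonneg[OF Hs(1) s] .
      then have "\<epsilon> > 0" using d by (simp add: \<epsilon>_def)
      have "\<epsilon> * Re (Hs s s) \<le> d" using pos d by (simp add: \<epsilon>_def divide_simps mult_left_mono)
      then show "Re (K s s) \<le> b * Re (Hs s s) + d" using le[OF \<open>\<epsilon> > 0\<close>] by (simp add: distrib_right)
    qed
  qed
  \<comment> \<open>Dividing by b brings the limit point below Hs itself, the situation of
    \<open>r1\<close> and \<open>r2\<close>.\<close>
  define K' where "K' = scaled_form (1 / b) K"
  have K': "herm K'" unfolding K'_def using herm_scaled_form[OF K] b by simp
  have bK': "scaled_form b K' = K" using b by (simp add: K'_def scaled_form_scaled_form scaled_form_1)
  have K'le: "form_le K' Hs"
    using Kb b by (auto simp: form_le_def K'_def Re_scaled_form field_simps)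
  define KK where "KK j = (T ^^ j) K'" for j
  have KK: "herm (KK j)" for j unfolding KK_def by (rule pow[OF K'])
  have KKle: "form_le (KK j) Hs" for j
    using pow_mono[OF K' Hs(1) K'le, of j] by (simp add: KK_def pow_fix)
  have KKSuc: "KK (Suc j) = T (KK j)" for j by (simp add: KK_def)
  define W where "W j = eqset Hs (KK j)" for j
  have WS: "W j \<subseteq> S" for j by (auto simp: W_def eqset_def)
  have Wsub: "subspace (W j)" for j
    unfolding W_def by (rule eqset_subspace[OF herm_hform[OF Hs(1)] herm_hform[OF KK] KKle])
  have Wdec: "W (Suc j) \<subseteq> W j" for j unfolding W_def KKSuc by (rule r1[OF KK KKle])
  \<comment> \<open>The factors 1 + eps and 1 - eps pass through T^j unchanged; b appears because
    the limit point is b K'.\<close>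
  have close: "eventually (\<lambda>m. form_le (F (j + r m)) (scaled_form ((1 + \<epsilon>) * b) (KK j)) \<and>
      form_le (scaled_form ((1 - \<epsilon>) * b) (KK j)) (F (j + r m))) sequentially" if eps: "0 < \<epsilon>" "\<epsilon> < 1" for \<epsilon> j
  proof -
    have "eventually (\<lambda>m. \<forall>s\<in>S. \<bar>Re (F (r m) s s) - Re (K s s)\<bar> \<le> \<epsilon> * Re (K s s)) sequentially"
      by (rule eventually_close[OF K herm_hform[OF FH] limK eps(1)])
    then show ?thesis
    proof eventually_elim
      case (elim m)
      have p: "(1 + \<epsilon>) * b > 0" "(1 - \<epsilon>) * b > 0" using eps b by auto
      have "scaled_form ((1 + \<epsilon>) * b) K' = scaled_form (1 + \<epsilon>) K" "scaled_form ((1 - \<epsilon>) * b) K' = scaled_form (1 - \<epsilon>) K"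
        using bK' by (metis scaled_form_scaled_form)+
      then have 1: "form_le (F (r m)) (scaled_form ((1 + \<epsilon>) * b) K')" "form_le (scaled_form ((1 - \<epsilon>) * b) K') (F (r m))"
        using elim by (auto simp: form_le_def Re_scaled_form algebra_simps abs_le_iff)
      show ?case
        using pow_mono[OF FH herm_scaled_form[OF K' p(1)] 1(1), of j] pow_mono[OF herm_scaled_form[OF K' p(2)] FH 1(2), of j]
        by (simp add: pow_homog[OF K' p(1)] pow_homog[OF K' p(2)] KK_def Fadd)
    qed
  qed
  have Wne: "W j \<noteq> {0}" for j
  proof
    assume W0: "W j = {0}"
    let ?D = "\<lambda>u v. Hs u v - KK j u v"
    have D: "herm ?D"
    proof (rule hermI[OF hform_minus[OF herm_hform[OF Hs(1)] herm_hform[OF KK]]])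
      fix u assume u: "u \<in> S" "u \<noteq> 0"
      then have "u \<notin> W j" using W0 by auto
      then have "Re (KK j u u) \<noteq> Re (Hs u u)" using u by (auto simp: W_def eqset_def)
      moreover have "Re (KK j u u) \<le> Re (Hs u u)" using KKle[of j] u by (auto simp: form_le_def)
      ultimately show "Re (?D u u) > 0" by simp
    qed (simp add: herm_outside[OF Hs(1)] herm_outside[OF KK])
    obtain C where C: "C > 0" "\<And>s. s \<in> S \<Longrightarrow> Re (Hs s s) \<le> C * Re (?D s s)"
      using herm_dominates[OF D herm_hform[OF Hs(1)]] by metis
    \<comment> \<open>From Hs <= (C + 1) D follows delta Hs <= D, a gap of relative size delta below
      Hs. Taking C + 1 instead of C makes delta < 1.\<close>
    define \<delta> where "\<delta> = 1 / (C + 1)"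
    have d: "0 < \<delta>" "\<delta> < 1" using C by (auto simp: \<delta>_def)
    have le: "form_le (KK j) (scaled_form (1 - \<delta>) Hs)"
      unfolding form_le_def Re_scaled_form
    proof
      fix s assume s: "s \<in> S"
      have D0: "Re (?D s s) \<ge> 0" using herm_nonneg[OF D s] by simp
      have "Re (Hs s s) \<le> (C + 1) * Re (?D s s)" using C(2)[OF s] D0 by (simp only: distrib_right mult_1)
      then have "\<delta> * Re (Hs s s) \<le> Re (?D s s)" using C(1) by (simp add: \<delta>_def field_simps)
      then show "Re (KK j s s) \<le> (1 - \<delta>) * Re (Hs s s)" by (simp add: algebra_simps)
    qed
    \<comment> \<open>The same delta serves as the error: (1 + delta)(1 - delta) < 1, so an orbit
      member falls below a multiple of Hs smaller than b Hs.\<close>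
    obtain m where m: "form_le (F (j + r m)) (scaled_form ((1 + \<delta>) * b) (KK j))"
      using close[OF d, of j] by (auto simp: eventually_sequentially)
    have "form_le (scaled_form ((1 + \<delta>) * b) (KK j)) (scaled_form ((1 + \<delta>) * b) (scaled_form (1 - \<delta>) Hs))"
      by (rule form_le_scaled_form[OF _ le]) (use d b in auto)
    then have "form_le (F (j + r m)) (scaled_form ((1 + \<delta>) * b * (1 - \<delta>)) Hs)"
      using form_le_trans[OF m] by (simp add: scaled_form_scaled_form)
    moreover have "(1 + \<delta>) * b * (1 - \<delta>) < b"
    proof -
      have "(1 + \<delta>) * b * (1 - \<delta>) = b - \<delta> * \<delta> * b" by (simp add: algebra_simps)
      then show ?thesis using d b by simp
    qed
    moreover have "(1 + \<delta>) * b * (1 - \<delta>) > 0" using d b by simp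
    ultimately show False using b_least by blast
  qed
  \<comment> \<open>A decreasing chain of subspaces is stationary where its dimension is
    least.\<close>
  obtain j where j: "\<And>i. dim (W j) \<le> dim (W i)"
    using ex_has_least_nat[of "\<lambda>_. True" 0 "\<lambda>j. dim (W j)"] by auto
  have "W (Suc j) = W j"
    by (rule subspace_eq_dimI[OF Wsub Wsub Wdec WS j])
  then have WjS: "W j = S"
    using r2[OF KK KKle, of j] Wne[of j] by (simp add: W_def KKSuc)
  have KKeq: "Re (KK j s s) = Re (Hs s s)" if "s \<in> S" for s
    using WjS that by (auto simp: W_def eqset_def)
  \<comment> \<open>One index suffices, since lower bounds by multiples of Hs persist along the
    orbit.\<close>
  have lower_ev: "eventually (\<lambda>m. form_le (scaled_form ((1 - \<epsilon>) * b) Hs) (F m)) sequentially"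
    if eps: "0 < \<epsilon>" "\<epsilon> < 1" for \<epsilon>
  proof -
    obtain m where "form_le (scaled_form ((1 - \<epsilon>) * b) (KK j)) (F (j + r m))"
      using close[OF eps, of j] by (auto simp: eventually_sequentially)
    then have "form_le (scaled_form ((1 - \<epsilon>) * b) Hs) (F (j + r m))" using KKeq by (auto simp: form_le_def Re_scaled_form)
    then show ?thesis
      unfolding eventually_sequentially using lb_mono[of "(1 - \<epsilon>) * b" "j + r m"] eps b by auto
  qed
  have diag: "(\<lambda>m. Re (F m s s)) \<longlonglongrightarrow> b * Re (Hs s s)" if s: "s \<in> S" for s
  proof (rule order_tendstoI)
    have pos: "Re (Hs s s) \<ge> 0" using herm_nonneg[OF Hs(1) s] .
    fix y assume y: "y < b * Re (Hs s s)"
    define d where "d = b * Re (Hs s s) - y"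
    \<comment> \<open>The minimum with 1/2 secures eps < 1, and the factor 2 in the denominator
      makes the resulting inequality strict.\<close>
    define \<epsilon> where "\<epsilon> = min (1/2) (d / (2 * (b * Re (Hs s s) + 1)))"
    have dp: "d > 0" using y by (simp add: d_def)
    have q: "b * Re (Hs s s) \<ge> 0" using b pos by simp
    have eps: "0 < \<epsilon>" "\<epsilon> < 1" using dp q by (auto simp: \<epsilon>_def)
    have "\<epsilon> * (b * Re (Hs s s) + 1) \<le> d / (2 * (b * Re (Hs s s) + 1)) * (b * Re (Hs s s) + 1)"
      using q by (intro mult_right_mono) (auto simp: \<epsilon>_def)
    also have "\<dots> = d / 2" using q by (simp add: field_simps)
    finally have "\<epsilon> * (b * Re (Hs s s)) < d" using dp eps by (simp add: distrib_left)
    then have lt: "y < (1 - \<epsilon>) * b * Re (Hs s s)" by (simp add: d_def algebra_simps)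
    show "eventually (\<lambda>m. y < Re (F m s s)) sequentially"
      using lower_ev[OF eps]
    proof eventually_elim
      case (elim m)
      then have "(1 - \<epsilon>) * b * Re (Hs s s) \<le> Re (F m s s)" using s by (auto simp: form_le_def Re_scaled_form)
      then show ?case using lt by linarith
    qed
  next
    have pos: "Re (Hs s s) \<ge> 0" using herm_nonneg[OF Hs(1) s] .
    fix y assume y: "b * Re (Hs s s) < y"
    define \<epsilon> where "\<epsilon> = (y - b * Re (Hs s s)) / (2 * (Re (Hs s s) + 1))"
    have eps: "0 < \<epsilon>" using y pos by (auto simp: \<epsilon>_def)
    have "\<epsilon> * (Re (Hs s s) + 1) = (y - b * Re (Hs s s)) / 2" using pos by (simp add: \<epsilon>_def field_simps)
    then have "\<epsilon> * Re (Hs s s) < y - b * Re (Hs s s)" using eps y by (simp add: distrib_left)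
    then have lt: "(b + \<epsilon>) * Re (Hs s s) < y" by (simp add: algebra_simps)
    show "eventually (\<lambda>m. Re (F m s s) < y) sequentially"
      using b_upper[OF eps]
    proof eventually_elim
      case (elim m)
      then have "Re (F m s s) \<le> (b + \<epsilon>) * Re (Hs s s)" using s by (auto simp: form_le_def Re_scaled_form)
      then show ?case using lt by linarith
    qed
  qed
  have "(\<lambda>m. F m s t) \<longlonglongrightarrow> of_real b * Hs s t" if s: "s \<in> S" and t: "t \<in> S" for s t
  proof -
    have m: "s + t \<in> S" "s + sc \<i> t \<in> S" using s t by (auto intro: S_add S_scale)
    let ?P = "\<lambda>G. (complex_of_real (Re (G (s + t) (s + t)) - Re (G s s) - Re (G t t))
     + \<i> * of_real (Re (G (s + sc \<i> t) (s + sc \<i> t)) - Re (G s s) - Re (G t t))) / 2"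
    have "(\<lambda>k. ?P (F k)) \<longlonglongrightarrow> (of_real (b * Re (Hs (s + t) (s + t)) - b * Re (Hs s s) - b * Re (Hs t t))
     + \<i> * of_real (b * Re (Hs (s + sc \<i> t) (s + sc \<i> t)) - b * Re (Hs s s) - b * Re (Hs t t))) / 2"
      by (intro tendsto_intros diag m s t) simp
    also have "(of_real (b * Re (Hs (s + t) (s + t)) - b * Re (Hs s s) - b * Re (Hs t t))
     + \<i> * of_real (b * Re (Hs (s + sc \<i> t) (s + sc \<i> t)) - b * Re (Hs s s) - b * Re (Hs t t))) / 2
      = of_real b * ?P Hs" by (simp add: algebra_simps add_divide_distrib diff_divide_distrib)
    also have "?P Hs = Hs s t" by (rule hform_polarization[OF herm_hform[OF Hs(1)] s t, symmetric])
    also have "(\<lambda>k. ?P (F k)) = (\<lambda>k. F k s t)"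
      by (rule ext) (rule hform_polarization[OF herm_hform[OF FH] s t, symmetric])
    finally show ?thesis .
  qed
  then show ?thesis using b unfolding F_def by blast
qed

end

section \<open>Smooth and holomorphic functions\<close>

text \<open>\<open>frechet_derivative\<close> at x depends only on the germ at x, so on an open set
  agreement of values passes to all iterated derivatives.\<close>

lemma Ck_on_cong:
  assumes "open S" "\<And>x. x \<in> S \<Longrightarrow> f x = g x" "Ck_on k f S"
  shows "Ck_on k g S"
  using assms(2,3)
proof (induction k arbitrary: f g)
  case 0
  then show ?case by (metis Ck_on.simps(1) continuous_on_cong)
next
  case (Suc k)
  have der: "(g has_derivative frechet_derivative f (at x)) (at x)" if x: "x \<in> S" for x
  proof -
    have "(f has_derivative frechet_derivative f (at x)) (at x)"
      using Suc.prems(2) x by (simp add: frechet_derivative_works)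
    then show ?thesis by (rule has_derivative_transform_within_open[OF _ assms(1) x Suc.prems(1)])
  qed
  have eq: "frechet_derivative f (at x) = frechet_derivative g (at x)" if "x \<in> S" for x
    using frechet_derivative_at[OF der[OF that]] .
  show ?case
    unfolding Ck_on.simps
  proof (intro conjI ballI allI)
    show "g differentiable (at x)" if "x \<in> S" for x using der[OF that] by (auto simp: differentiable_def)
    show "Ck_on k (\<lambda>x. frechet_derivative g (at x) v) S" for v
      by (rule Suc.IH[of "\<lambda>x. frechet_derivative f (at x) v"]) (use eq Suc.prems in auto)
  qed
qed

text \<open>Replaces the choice made by \<open>frechet_derivative\<close> with any derivative
  formula at hand, as the product and inverse rules produce them.\<close>

lemma Ck_on_SucI:
  assumes "open S" "\<And>x. x \<in> S \<Longrightarrow> (f has_derivative f' x) (at x)" "\<And>v. Ck_on k (\<lambda>x. f' x v) S"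
  shows "Ck_on (Suc k) f S"
  unfolding Ck_on.simps
proof (intro conjI ballI allI)
  show "f differentiable (at x)" if "x \<in> S" for x using assms(2)[OF that] by (auto simp: differentiable_def)
  show "Ck_on k (\<lambda>x. frechet_derivative f (at x) v) S" for v
    by (rule Ck_on_cong[OF assms(1) _ assms(3)[of v]]) (simp add: frechet_derivative_at[OF assms(2), symmetric])
qed

lemma Ck_on_SucD: "Ck_on (Suc k) f S \<Longrightarrow> Ck_on k f S"
proof (induction k arbitrary: f)
  case 0
  then show ?case
    by (auto intro!: continuous_at_imp_continuous_on differentiable_imp_continuous_within)
next
  case (Suc k)
  then show ?case by (metis Ck_on.simps(2))
qed

lemma Ck_on_has_derivative:
  "Ck_on (Suc k) f S \<Longrightarrow> x \<in> S \<Longrightarrow> (f has_derivative frechet_derivative f (at x)) (at x)"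
  by (simp add: frechet_derivative_works)

lemma Ck_on_const: "open S \<Longrightarrow> Ck_on k (\<lambda>x. c) S"
proof (induction k arbitrary: c)
  case (Suc k)
  then show ?case by (intro Ck_on_SucI[where f' = "\<lambda>x v. 0"]) auto
qed simp

lemma Ck_on_bounded_linear:
  assumes "bounded_linear A" "open S" "Ck_on k f S"
  shows "Ck_on k (\<lambda>x. A (f x)) S"
  using assms(3)
proof (induction k arbitrary: f)
  case 0
  then show ?case using bounded_linear.continuous_on[OF assms(1)] by simp
next
  case (Suc k)
  show ?case
  proof (rule Ck_on_SucI[OF assms(2)])
    show "((\<lambda>x. A (f x)) has_derivative (\<lambda>v. A (frechet_derivative f (at x) v))) (at x)" if "x \<in> S" for x
      by (rule bounded_linear.has_derivative[OF assms(1) Ck_on_has_derivative[OF Suc.prems that]])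
    show "Ck_on k (\<lambda>x. A (frechet_derivative f (at x) v)) S" for v
      using Suc by simp
  qed
qed

lemma Ck_on_add:
  assumes "open S" "Ck_on k f S" "Ck_on k g S"
  shows "Ck_on k (\<lambda>x. f x + g x) S"
  using assms(2,3)
proof (induction k arbitrary: f g)
  case 0
  then show ?case by (auto intro: continuous_intros)
next
  case (Suc k)
  show ?case
  proof (rule Ck_on_SucI[OF assms(1)])
    show "((\<lambda>x. f x + g x) has_derivative
        (\<lambda>v. frechet_derivative f (at x) v + frechet_derivative g (at x) v)) (at x)" if "x \<in> S" for x
      using Ck_on_has_derivative[OF Suc.prems(1) that] Ck_on_has_derivative[OF Suc.prems(2) that]
      by (rule has_derivative_add)
    show "Ck_on k (\<lambda>x. frechet_derivative f (at x) v + frechet_derivative g (at x) v) S" for v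
      using Suc by simp
  qed
qed

lemma Ck_on_mult:
  fixes f g :: "'a::real_normed_vector \<Rightarrow> 'b::real_normed_algebra"
  assumes "open S" "Ck_on k f S" "Ck_on k g S"
  shows "Ck_on k (\<lambda>x. f x * g x) S"
  using assms(2,3)
proof (induction k arbitrary: f g)
  case 0
  then show ?case by (auto intro: continuous_intros)
next
  case (Suc k)
  show ?case
  proof (rule Ck_on_SucI[OF assms(1)])
    show "((\<lambda>x. f x * g x) has_derivative
        (\<lambda>v. f x * frechet_derivative g (at x) v + frechet_derivative f (at x) v * g x)) (at x)" if "x \<in> S" for x
      using Ck_on_has_derivative[OF Suc.prems(1) that] Ck_on_has_derivative[OF Suc.prems(2) that]
      by (rule has_derivative_mult)
    show "Ck_on k (\<lambda>x. f x * frechet_derivative g (at x) v + frechet_derivative f (at x) v * g x) S" for v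
      using Suc Ck_on_SucD[OF Suc.prems(1)] Ck_on_SucD[OF Suc.prems(2)] by (intro Ck_on_add assms(1)) auto
  qed
qed

text \<open>The derivative contains the inverse itself but no derivative of it, so the induction
  hypothesis at order k covers it.\<close>

lemma Ck_on_inverse:
  fixes f :: "'a::real_normed_vector \<Rightarrow> 'b::real_normed_field"
  assumes "open S" "Ck_on k f S" "\<And>x. x \<in> S \<Longrightarrow> f x \<noteq> 0"
  shows "Ck_on k (\<lambda>x. inverse (f x)) S"
  using assms(2)
proof (induction k)
  case 0
  then show ?case using assms(3) by (auto intro: continuous_intros)
next
  case (Suc k)
  show ?case
  proof (rule Ck_on_SucI[OF assms(1)])
    show "((\<lambda>x. inverse (f x)) has_derivative
        (\<lambda>v. - (inverse (f x) * frechet_derivative f (at x) v * inverse (f x)))) (at x)" if "x \<in> S" for x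
      by (rule Deriv.has_derivative_inverse[OF assms(3)[OF that] Ck_on_has_derivative[OF Suc.prems that]])
    have i: "Ck_on k (\<lambda>x. inverse (f x)) S" by (rule Suc.IH[OF Ck_on_SucD[OF Suc.prems]])
    have "Ck_on k (\<lambda>x. inverse (f x) * frechet_derivative f (at x) v * inverse (f x)) S" for v
      using Suc.prems by (intro Ck_on_mult assms(1) i) simp
    then show "Ck_on k (\<lambda>x. - (inverse (f x) * frechet_derivative f (at x) v * inverse (f x))) S" for v
      by (rule Ck_on_bounded_linear[OF bounded_linear_minus[OF bounded_linear_ident] assms(1)])
  qed
qed

lemma Ck_on_sum:
  assumes "open S" "\<And>i. i \<in> I \<Longrightarrow> Ck_on k (f i) S"
  shows "Ck_on k (\<lambda>x. \<Sum>i\<in>I. f i x) S"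
  using assms(2) by (induction I rule: infinite_finite_induct) (auto intro: Ck_on_const Ck_on_add assms(1))

lemma Ck_on_prod:
  fixes f :: "'i \<Rightarrow> 'a::real_normed_vector \<Rightarrow> 'b::real_normed_field"
  assumes "open S" "\<And>i. i \<in> I \<Longrightarrow> Ck_on k (f i) S"
  shows "Ck_on k (\<lambda>x. \<Prod>i\<in>I. f i x) S"
  using assms(2) by (induction I rule: infinite_finite_induct) (auto intro: Ck_on_const Ck_on_mult assms(1))

lemma Ck_on_cnj:
  "open S \<Longrightarrow> Ck_on k f S \<Longrightarrow> Ck_on k (\<lambda>x. cnj (f x)) S"
  by (rule Ck_on_bounded_linear[OF bounded_linear_cnj])

lemma smooth_on_const: "open S \<Longrightarrow> smooth_on (\<lambda>x. c) S"
  and smooth_on_mult: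
    "open S \<Longrightarrow> smooth_on (f :: 'a::real_normed_vector \<Rightarrow> 'b::real_normed_algebra) S \<Longrightarrow> smooth_on g S \<Longrightarrow>
      smooth_on (\<lambda>x. f x * g x) S"
  and smooth_on_inverse:
    "open S \<Longrightarrow> smooth_on (u :: 'a \<Rightarrow> 'c::real_normed_field) S \<Longrightarrow> (\<And>x. x \<in> S \<Longrightarrow> u x \<noteq> 0) \<Longrightarrow>
      smooth_on (\<lambda>x. inverse (u x)) S"
  and smooth_on_sum:
    "open S \<Longrightarrow> (\<And>i. i \<in> I \<Longrightarrow> smooth_on (F i :: 'a \<Rightarrow> 'd::real_normed_vector) S) \<Longrightarrow>
      smooth_on (\<lambda>x. \<Sum>i\<in>I. F i x) S"
  and smooth_on_prod:
    "open S \<Longrightarrow> (\<And>i. i \<in> I \<Longrightarrow> smooth_on (G i :: 'a \<Rightarrow> 'c) S) \<Longrightarrow>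
      smooth_on (\<lambda>x. \<Prod>i\<in>I. G i x) S"
  and smooth_on_cnj: "open S \<Longrightarrow> smooth_on w S \<Longrightarrow> smooth_on (\<lambda>x. cnj (w x)) S"
  and smooth_on_cong: "open S \<Longrightarrow> (\<And>x. x \<in> S \<Longrightarrow> p x = q x) \<Longrightarrow> smooth_on p S \<Longrightarrow> smooth_on q S"
  by (auto simp: smooth_on_def intro: Ck_on_const Ck_on_mult Ck_on_inverse Ck_on_sum Ck_on_prod Ck_on_cnj
      Ck_on_cong)

lemma smooth_on_continuous_on: "smooth_on f S \<Longrightarrow> continuous_on S f"
  unfolding smooth_on_def by (metis Ck_on.simps(1))

lemma smooth_on_det:
  fixes A :: "'a::real_normed_vector \<Rightarrow> 'b::real_normed_field^'n^'n"
  assumes "open S" "\<And>i j. smooth_on (\<lambda>x. A x $ i $ j) S"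
  shows "smooth_on (\<lambda>x. det (A x)) S"
  unfolding det_def using assms by (intro smooth_on_sum smooth_on_mult smooth_on_prod smooth_on_const) auto

section \<open>Cramer's rule, and regularity of holomorphic functions of several variables\<close>

lemma matrix_inv_entry:
  fixes A :: "'b::field^'n^'n"
  assumes AB: "A ** B = mat 1"
  shows "B $ i $ j = det (\<chi> k l. if l = i then (if k = j then 1 else 0) else A $ k $ l) / det A" and "det A \<noteq> 0"
proof -
  have "det A * det B = 1" using AB by (metis det_I det_mul)
  then show d: "det A \<noteq> 0" by auto
  have "A *v column j B = axis j 1"
    using AB by (simp add: vec_eq_iff matrix_vector_mult_def column_def axis_def matrix_matrix_mult_def mat_def)
  then have "column j B = (\<chi> i. det (\<chi> k l. if l = i then axis j 1 $ k else A $ k $ l) / det A)"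
    using cramer[OF d] by blast
  then have "column j B $ i = det (\<chi> k l. if l = i then axis j 1 $ k else A $ k $ l) / det A" by simp
  moreover have "(\<chi> k l. if l = i then axis j 1 $ k else A $ k $ l) =
      (\<chi> k l. if l = i then (if k = j then 1 else 0) else A $ k $ l)"
    by (simp add: vec_eq_iff axis_def)
  ultimately show "B $ i $ j = det (\<chi> k l. if l = i then (if k = j then 1 else 0) else A $ k $ l) / det A"
    by (simp only:) (simp add: column_def)
qed

text \<open>By Cramer's rule each entry of the inverse is a quotient of two determinants with smooth
  entries.\<close>

lemma smooth_on_matrix_inverse:
  fixes A B :: "'a::real_normed_vector \<Rightarrow> 'b::real_normed_field^'n^'n"
  assumes S: "open S" and A: "\<And>i j. smooth_on (\<lambda>x. A x $ i $ j) S"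
    and inv: "\<And>x. x \<in> S \<Longrightarrow> A x ** B x = mat 1"
  shows "smooth_on (\<lambda>x. B x $ i $ j) S"
proof (rule smooth_on_cong[OF S])
  let ?C = "\<lambda>x. (\<chi> k l. if l = i then (if k = j then 1 else 0) else A x $ k $ l) :: 'b^'n^'n"
  show "det (?C x) * inverse (det (A x)) = B x $ i $ j" if "x \<in> S" for x
    using matrix_inv_entry(1)[OF inv[OF that], of i j] by (simp add: divide_inverse)
  have "smooth_on (\<lambda>x. ?C x $ k $ l) S" for k l
    using A[of k l] smooth_on_const[OF S] by (cases "l = i") auto
  then show "smooth_on (\<lambda>x. det (?C x) * inverse (det (A x))) S"
    using matrix_inv_entry(2)[OF inv] by (intro smooth_on_mult smooth_on_inverse smooth_on_det S A) auto
qed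

text \<open>One-variable Cauchy formula on the complex line through z in direction v. The right-hand
  side contains values of f only, so its dependence on z can be studied although nothing is yet
  known about the derivative.\<close>

lemma holo_on_directional_integral:
  fixes f :: "complex^'n \<Rightarrow> complex"
  assumes hol: "holo_on f S" and r: "r > 0" and sub: "\<And>\<zeta>. norm \<zeta> \<le> r \<Longrightarrow> z + \<zeta> *s v \<in> S"
  shows "frechet_derivative f (at z) v =
    1 / (2 * of_real pi * \<i>) * integral {0..1}
      (\<lambda>t. f (z + circlepath 0 r t *s v) / (circlepath 0 r t)\<^sup>2 * vector_derivative (circlepath 0 r) (at t))"
proof -
  let ?g = "\<lambda>\<zeta>. f (z + \<zeta> *s v)"
  have lin: "bounded_linear (\<lambda>\<zeta>::complex. \<zeta> *s v)"
    by (rule linear_conv_bounded_linear[THEN iffD1])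
       (auto intro!: linearI simp: vec_eq_iff distrib_right)
  have der: "(?g has_field_derivative frechet_derivative f (at (z + \<zeta> *s v)) v) (at \<zeta>)"
    if le: "norm \<zeta> \<le> r" for \<zeta>
  proof -
    obtain f' where f': "(f has_derivative f') (at (z + \<zeta> *s v))" "\<And>c v. f' (c *s v) = c * f' v"
      using hol sub[OF le] unfolding holo_on_def by blast
    have fd: "frechet_derivative f (at (z + \<zeta> *s v)) = f'" using frechet_derivative_at[OF f'(1)] by simp
    have "((\<lambda>\<zeta>. z + \<zeta> *s v) has_derivative (\<lambda>c. 0 + c *s v)) (at \<zeta>)"
      by (intro has_derivative_add has_derivative_const bounded_linear.has_derivative[OF lin] has_derivative_ident)
    then have "(?g has_derivative (\<lambda>c. f' (0 + c *s v))) (at \<zeta>)"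
      by (rule has_derivative_compose) (rule f'(1))
    moreover have "(\<lambda>c. f' (0 + c *s v)) = (*) (f' v)" by (auto simp: f'(2))
    ultimately show ?thesis unfolding has_field_derivative_def fd by simp
  qed
  have hol': "?g holomorphic_on ball 0 r" "continuous_on (cball 0 r) ?g"
  proof -
    show "?g holomorphic_on ball 0 r"
      unfolding holomorphic_on_def field_differentiable_def
      using der has_field_derivative_at_within by (metis less_imp_le mem_ball_0)
    show "continuous_on (cball 0 r) ?g"
      by (rule DERIV_continuous_on, rule has_field_derivative_at_within, rule der) simp
  qed
  note cauchy = Cauchy_derivative_integral_circlepath[OF hol'(2,1), of 0]
  have "(?g has_field_derivative (1 / (2 * of_real pi * \<i>) * contour_integral (circlepath 0 r) (\<lambda>u. ?g u / (u - 0)\<^sup>2))) (at 0)"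
    using cauchy(2) r by simp
  moreover have "(?g has_field_derivative frechet_derivative f (at z) v) (at 0)"
    using der[of 0] r by simp
  ultimately show ?thesis
    using DERIV_unique unfolding contour_integral_integral by fastforce
qed

text \<open>\<open>holo_on\<close> demands only pointwise complex differentiability. Differentiating
  the Cauchy formula under the integral sign gives more; the differentiated integrand involves
  derivatives of f, whose continuity is therefore settled beforehand.\<close>

lemma holo_on_derivative:
  fixes f :: "complex^'n \<Rightarrow> complex"
  assumes S: "open S" and hol: "holo_on f S"
  shows "holo_on (\<lambda>z. frechet_derivative f (at z) v) S"
proof -
  have gc: "continuous_on {0..1} (circlepath 0 r)" for r
    using path_circlepath by (simp add: path_def)
  have vd: "vector_derivative (circlepath 0 r) (at t) = 2 * of_real pi * \<i> * r * exp (2 * of_real pi * \<i> * t)" for r t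
    by (simp add: vector_derivative_circlepath)
  have ne: "circlepath 0 r t \<noteq> 0" if "r > 0" for r t using that by (simp add: circlepath)
  have nrm: "norm (circlepath 0 r t) = r" if "r > 0" for r t
    using that by (simp add: circlepath norm_mult)
  have fder: "(f has_derivative frechet_derivative f (at z)) (at z)" if "z \<in> S" for z
    using hol that unfolding holo_on_def by (metis frechet_derivative_at)
  have flin: "frechet_derivative f (at z) (c *s w) = c * frechet_derivative f (at z) w" if "z \<in> S" for z c w
    using hol that unfolding holo_on_def by (metis frechet_derivative_at)
  have fcont: "continuous_on S f"
    using fder by (meson continuous_at_imp_continuous_on has_derivative_continuous)
  \<comment> \<open>One radius for all base points near z0 keeps the circles of integration inside
    S.\<close>
  have loc: "\<exists>\<rho>>0. \<exists>r>0. ball z0 \<rho> \<subseteq> S \<and> (\<forall>z\<in>ball z0 \<rho>. \<forall>\<zeta>. norm \<zeta> \<le> r \<longrightarrow> z + \<zeta> *s w \<in> S)"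
    if "z0 \<in> S" for z0 w
  proof -
    obtain e where e: "e > 0" "ball z0 e \<subseteq> S" using S \<open>z0 \<in> S\<close> openE by blast
    define r where "r = e / (2 * (norm w + 1))"
    have r: "r > 0" using e by (simp add: r_def add_nonneg_pos)
    have bound: "norm (\<zeta> *s w) < e / 2" if "norm \<zeta> \<le> r" for \<zeta>
    proof -
      have "norm (\<zeta> *s w) = norm \<zeta> * norm w" by (simp add: norm_vec_def norm_mult L2_set_right_distrib)
      also have "\<dots> \<le> r * norm w" using that by (intro mult_right_mono) auto
      also have "\<dots> < r * (norm w + 1)" using r by simp
      also have "\<dots> = e / 2" using norm_ge_zero[of w] by (simp add: r_def field_simps add_nonneg_eq_0_iff)
      finally show ?thesis .
    qed
    have "z + \<zeta> *s w \<in> S" if "z \<in> ball z0 (e/2)" "norm \<zeta> \<le> r" for z \<zeta>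
    proof -
      have "dist z0 (z + \<zeta> *s w) \<le> dist z0 z + dist z (z + \<zeta> *s w)" by (rule dist_triangle)
      also have "\<dots> < e / 2 + e / 2"
      proof (rule add_strict_mono)
        show "dist z0 z < e / 2" using that(1) by simp
        have "dist z (z + \<zeta> *s w) = norm (\<zeta> *s w)" by (simp add: dist_norm)
        then show "dist z (z + \<zeta> *s w) < e / 2" using bound[OF that(2)] by simp
      qed
      finally have "z + \<zeta> *s w \<in> ball z0 e" by simp
      then show ?thesis using e(2) by blast
    qed
    moreover have "ball z0 (e/2) \<subseteq> S" using e subset_ball[of "e / 2" e z0] by simp
    ultimately show ?thesis using r e by (metis half_gt_zero)
  qed
  let ?I = "\<lambda>r w z t. f (z + circlepath 0 r t *s w) / (circlepath 0 r t)\<^sup>2 * vector_derivative (circlepath 0 r) (at t)"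
  have smul: "continuous_on UNIV (\<lambda>p::complex \<times> (complex^'n). fst p *s snd p)"
    unfolding vector_scalar_mult_def by (intro continuous_intros)
  have argc: "continuous_on A (\<lambda>p. fst p + circlepath 0 r (snd p) *s w)"
    if "A \<subseteq> UNIV \<times> {0..1}" for A :: "((complex^'n) \<times> real) set" and r w
  proof -
    have "continuous_on A (\<lambda>p. circlepath 0 r (snd p))"
      by (rule continuous_on_compose2[OF gc]) (use that in \<open>auto intro: continuous_intros\<close>)
    then have "continuous_on A (\<lambda>p. (circlepath 0 r (snd p), w))" by (intro continuous_intros)
    from continuous_on_compose2[OF smul this] show ?thesis by (intro continuous_intros) auto
  qed
  have kerc: "continuous_on A (\<lambda>p. vector_derivative (circlepath 0 r) (at (snd p)) / (circlepath 0 r (snd p))\<^sup>2)"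
    if "A \<subseteq> UNIV \<times> {0..1}" "r > 0" for A :: "((complex^'n) \<times> real) set" and r
  proof -
    have "continuous_on A (\<lambda>p. circlepath 0 r (snd p))"
      by (rule continuous_on_compose2[OF gc]) (use that in \<open>auto intro: continuous_intros\<close>)
    then show ?thesis unfolding vd using ne[OF that(2)] by (intro continuous_intros) auto
  qed
  have pc: "continuous_on {0..1} (\<lambda>t::real. (a :: complex^'n, t))" for a by (intro continuous_intros)
  have Icont: "continuous_on (D \<times> cbox 0 1) (\<lambda>(z, t). ?I r w z t)"
    if r: "r > 0" and sub: "\<And>z \<zeta>. z \<in> D \<Longrightarrow> norm \<zeta> \<le> r \<Longrightarrow> z + \<zeta> *s w \<in> S" for D r w
  proof -
    have "continuous_on (D \<times> {0..1}) (\<lambda>p. f (fst p + circlepath 0 r (snd p) *s w))"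
      by (rule continuous_on_compose2[OF fcont argc]) (use sub nrm[OF r] in auto)
    then have "continuous_on (D \<times> {0..1}) (\<lambda>p. f (fst p + circlepath 0 r (snd p) *s w) *
        (vector_derivative (circlepath 0 r) (at (snd p)) / (circlepath 0 r (snd p))\<^sup>2))"
      by (intro continuous_on_mult kerc r) auto
    then show ?thesis by (simp add: case_prod_beta' mult.commute mult.left_commute)
  qed
  \<comment> \<open>The Cauchy integrand is jointly continuous in the base point and the parameter
    of the circle, hence its integral is continuous in z.\<close>
  have dcont: "continuous_on S (\<lambda>z. frechet_derivative f (at z) w)" for w
  proof (rule continuous_at_imp_continuous_on, rule ballI)
    fix z0 assume "z0 \<in> S"
    then obtain \<rho> r where p: "\<rho> > 0" "r > 0" "ball z0 \<rho> \<subseteq> S"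
      and sub: "\<And>z \<zeta>. z \<in> ball z0 \<rho> \<Longrightarrow> norm \<zeta> \<le> r \<Longrightarrow> z + \<zeta> *s w \<in> S" using loc by metis
    have "continuous_on (ball z0 \<rho> \<times> cbox 0 1) (\<lambda>(z, t). ?I r w z t)" by (rule Icont[OF p(2) sub])
    then have "continuous_on (ball z0 \<rho>) (\<lambda>z. integral (cbox 0 1) (?I r w z))"
      by (rule integral_continuous_on_param)
    then have "continuous_on (ball z0 \<rho>) (\<lambda>z. 1 / (2 * of_real pi * \<i>) * integral {0..1} (?I r w z))"
      by (intro continuous_intros) simp
    then have "continuous_on (ball z0 \<rho>) (\<lambda>z. frechet_derivative f (at z) w)"
      by (rule continuous_on_eq) (rule holo_on_directional_integral[OF hol p(2) sub, symmetric])
    then show "continuous (at z0) (\<lambda>z. frechet_derivative f (at z) w)"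
      using p(1) by (auto simp: continuous_on_eq_continuous_at)
  qed
  show ?thesis
    unfolding holo_on_def
  proof
    fix z0 assume "z0 \<in> S"
    then obtain \<rho> r where p: "\<rho> > 0" "r > 0" "ball z0 \<rho> \<subseteq> S"
      and sub: "\<And>z \<zeta>. z \<in> ball z0 \<rho> \<Longrightarrow> norm \<zeta> \<le> r \<Longrightarrow> z + \<zeta> *s v \<in> S" using loc by metis
    let ?k = "\<lambda>t. vector_derivative (circlepath 0 r) (at t) / (circlepath 0 r t)\<^sup>2"
    \<comment> \<open>The Leibniz rule wants the derivative of the integrand as a continuous family
      of bounded operators; in finite dimension continuity on each fixed vector is enough.\<close>
    define fx where "fx z t = Blinfun (\<lambda>w. ?k t * frechet_derivative f (at (z + circlepath 0 r t *s v)) w)"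
      for z t
    have inS: "z + circlepath 0 r t *s v \<in> S" if "z \<in> ball z0 \<rho>" for z t
      using sub[OF that, of "circlepath 0 r t"] nrm[OF p(2)] by simp
    have bl: "bounded_linear (\<lambda>w. ?k t * frechet_derivative f (at (z + circlepath 0 r t *s v)) w)"
      if "z \<in> ball z0 \<rho>" for z t
      by (intro bounded_linear_const_mult has_derivative_bounded_linear[OF fder[OF inS[OF that]]])
    have fx: "blinfun_apply (fx z t) w = ?k t * frechet_derivative f (at (z + circlepath 0 r t *s v)) w"
      if "z \<in> ball z0 \<rho>" for z t w
      using bounded_linear_Blinfun_apply[OF bl[OF that]] by (simp add: fx_def)
    have fxc: "continuous_on (ball z0 \<rho> \<times> cbox 0 1) (\<lambda>p. fx (fst p) (snd p))"
    proof (rule continuous_on_blinfun_componentwise)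
      fix w :: "complex^'n"
      have "continuous_on (ball z0 \<rho> \<times> {0..1}) (\<lambda>p. frechet_derivative f (at (fst p + circlepath 0 r (snd p) *s v)) w)"
        by (rule continuous_on_compose2[OF dcont argc]) (use inS in auto)
      then have "continuous_on (ball z0 \<rho> \<times> {0..1}) (\<lambda>p. ?k (snd p) * frechet_derivative f (at (fst p + circlepath 0 r (snd p) *s v)) w)"
        by (intro continuous_on_mult kerc p) auto
      then show "continuous_on (ball z0 \<rho> \<times> cbox 0 1) (\<lambda>p. blinfun_apply (fx (fst p) (snd p)) w)"
        unfolding cbox_interval by (rule continuous_on_eq) (auto simp: fx)
    qed
    have "((\<lambda>z. integral (cbox 0 1) (?I r v z)) has_derivative integral (cbox 0 1) (fx z0)) (at z0 within ball z0 \<rho>)"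
    proof (rule leibniz_rule)
      fix z t assume z: "z \<in> ball z0 \<rho>"
      have "((\<lambda>z. z + circlepath 0 r t *s v) has_derivative (\<lambda>w. w + 0)) (at z within ball z0 \<rho>)"
        by (intro has_derivative_add has_derivative_ident has_derivative_const)
      then have "((\<lambda>z. f (z + circlepath 0 r t *s v)) has_derivative
          (\<lambda>w. frechet_derivative f (at (z + circlepath 0 r t *s v)) (w + 0))) (at z within ball z0 \<rho>)"
        by (rule has_derivative_compose) (rule fder[OF inS[OF z]])
      from has_derivative_mult_right[OF this, of "?k t"]
      have "((\<lambda>z. ?k t * f (z + circlepath 0 r t *s v)) has_derivative
          (\<lambda>w. ?k t * frechet_derivative f (at (z + circlepath 0 r t *s v)) w)) (at z within ball z0 \<rho>)"
        by (simp only: add_0_right)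
      moreover have "blinfun_apply (fx z t) = (\<lambda>w. ?k t * frechet_derivative f (at (z + circlepath 0 r t *s v)) w)"
        using fx[OF z] by blast
      ultimately show "((\<lambda>z. ?I r v z t) has_derivative blinfun_apply (fx z t)) (at z within ball z0 \<rho>)"
        by (simp add: mult.commute mult.left_commute)
    next
      fix z assume z: "z \<in> ball z0 \<rho>"
      have "continuous_on (ball z0 \<rho> \<times> {0..1}) (\<lambda>(z, t). ?I r v z t)"
        using Icont[OF p(2) sub] unfolding cbox_interval .
      moreover have "(\<lambda>t. (z, t)) ` {0..1::real} \<subseteq> ball z0 \<rho> \<times> {0..1}" using z by auto
      ultimately have "continuous_on (cbox 0 1) (?I r v z)"
        using continuous_on_compose2[OF _ pc[of z]] by fastforce
      then show "?I r v z integrable_on cbox 0 1" by (rule integrable_continuous)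
    next
      show "continuous_on (ball z0 \<rho> \<times> cbox 0 1) (\<lambda>(z, t). fx z t)" using fxc by (simp add: case_prod_beta')
    qed (use p in auto)
    then have "((\<lambda>z. 1 / (2 * of_real pi * \<i>) * integral {0..1} (?I r v z)) has_derivative
        (\<lambda>w. 1 / (2 * of_real pi * \<i>) * integral (cbox 0 1) (fx z0) w)) (at z0 within ball z0 \<rho>)"
      by (intro has_derivative_mult_right) simp
    then have "((\<lambda>z. 1 / (2 * of_real pi * \<i>) * integral {0..1} (?I r v z)) has_derivative
        (\<lambda>w. 1 / (2 * of_real pi * \<i>) * integral (cbox 0 1) (fx z0) w)) (at z0)"
      using p(1) by (simp add: at_within_open[OF centre_in_ball[THEN iffD2]])
    then have der: "((\<lambda>z. frechet_derivative f (at z) v) has_derivative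
        (\<lambda>w. 1 / (2 * of_real pi * \<i>) * integral (cbox 0 1) (fx z0) w)) (at z0)"
      by (rule has_derivative_transform_within_open[of _ _ _ _ "ball z0 \<rho>"])
         (use p holo_on_directional_integral[OF hol p(2) sub] in auto)
    have z0: "z0 \<in> ball z0 \<rho>" using p by simp
    have fxint: "fx z0 integrable_on cbox 0 1"
    proof (rule integrable_continuous)
      have "continuous_on (ball z0 \<rho> \<times> {0..1}) (\<lambda>p. fx (fst p) (snd p))"
        using fxc unfolding cbox_interval .
      moreover have "(\<lambda>t. (z0, t)) ` {0..1::real} \<subseteq> ball z0 \<rho> \<times> {0..1}" using z0 by auto
      ultimately show "continuous_on (cbox 0 1) (fx z0)"
        using continuous_on_compose2[OF _ pc[of z0]] by fastforce
    qed
    have app: "blinfun_apply (integral (cbox 0 1) (fx z0)) w = integral (cbox 0 1) (\<lambda>t. blinfun_apply (fx z0 t) w)" for w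
      using integral_linear[OF fxint blinfun.bounded_linear_left[of w]] by (simp add: o_def)
    show "\<exists>f'. ((\<lambda>z. frechet_derivative f (at z) v) has_derivative f') (at z0) \<and> (\<forall>c w. f' (c *s w) = c * f' w)"
    proof (intro exI conjI allI, rule der)
      fix c w
      have "blinfun_apply (fx z0 t) (c *s w) = c * blinfun_apply (fx z0 t) w" for t
        by (simp add: fx[OF z0] flin[OF inS[OF z0]])
      then show "1 / (2 * of_real pi * \<i>) * integral (cbox 0 1) (fx z0) (c *s w) =
          c * (1 / (2 * of_real pi * \<i>) * integral (cbox 0 1) (fx z0) w)"
        unfolding app by simp
    qed
  qed
qed

lemma holo_on_imp_smooth_on:
  assumes "open S" "holo_on f S"
  shows "smooth_on f S"
proof -
  have "Ck_on k f S" for k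
    using assms(2)
  proof (induction k arbitrary: f)
    case 0
    then show ?case
      unfolding holo_on_def Ck_on.simps
      by (meson continuous_at_imp_continuous_on has_derivative_continuous)
  next
    case (Suc k)
    have "f differentiable (at x)" if "x \<in> S" for x
      using Suc.prems that unfolding holo_on_def differentiable_def by blast
    then show ?case
      unfolding Ck_on.simps using Suc.IH[OF holo_on_derivative[OF assms(1) Suc.prems]] by blast
  qed
  then show ?thesis by (simp add: smooth_on_def)
qed

section \<open>Positivity of the volume form\<close>

text \<open>This is \<open>2\<^sup>n n!\<close> times the Pfaffian of \<open>\<Omega>\<close>.\<close>

definition pfaffian_sum :: "('n::finite \<times> bool \<Rightarrow> 'n \<times> bool \<Rightarrow> real) \<Rightarrow> real" where
  "pfaffian_sum \<Omega> = (\<Sum>\<sigma> | \<sigma> permutes (UNIV :: ('n \<times> bool) set).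
     of_int (sign \<sigma>) * (\<Prod>k\<in>UNIV. \<Omega> (\<sigma> (k, False)) (\<sigma> (k, True))))"

text \<open>The rule Pf(A^t Omega A) = det(A) Pf(Omega). Expanding the product of double sums gives
  determinants whose rows are rows of A selected by a self-map of the index set; only bijective
  selections survive, each contributing its sign times det A.\<close>

lemma pfaffian_sum_transform:
  fixes \<Omega> :: "'n::finite \<times> bool \<Rightarrow> 'n \<times> bool \<Rightarrow> real" and A :: "real^('n \<times> bool)^('n \<times> bool)"
  shows "pfaffian_sum (\<lambda>a b. \<Sum>i\<in>UNIV. \<Sum>j\<in>UNIV. A $ i $ a * \<Omega> i j * A $ j $ b) = det A * pfaffian_sum \<Omega>"
proof -
  let ?P = "{\<sigma>. \<sigma> permutes (UNIV :: ('n \<times> bool) set)}"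
  \<comment> \<open>A choice g of a pair of row indices for each k is the same as a self-map of the
    set of pairs, the form in which determinants apply.\<close>
  define F where "F g x = (if snd x then snd (g (fst x)) else fst (g (fst x)))"
    for g :: "'n \<Rightarrow> ('n \<times> bool) \<times> ('n \<times> bool)" and x :: "'n \<times> bool"
  define w where "w g = (\<Prod>k\<in>UNIV. \<Omega> (fst (g k)) (snd (g k)))" for g :: "'n \<Rightarrow> ('n \<times> bool) \<times> ('n \<times> bool)"
  have expand: "(\<Prod>k\<in>UNIV. \<Sum>i\<in>UNIV. \<Sum>j\<in>UNIV. A $ i $ \<sigma> (k, False) * \<Omega> i j * A $ j $ \<sigma> (k, True)) =
      (\<Sum>g\<in>UNIV. w g * (\<Prod>x\<in>UNIV. A $ F g x $ \<sigma> x))" for \<sigma>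
  proof -
    have "(\<Prod>k\<in>UNIV. \<Sum>i\<in>UNIV. \<Sum>j\<in>UNIV. A $ i $ \<sigma> (k, False) * \<Omega> i j * A $ j $ \<sigma> (k, True)) =
      (\<Prod>k\<in>UNIV. \<Sum>p\<in>UNIV. A $ fst p $ \<sigma> (k, False) * \<Omega> (fst p) (snd p) * A $ snd p $ \<sigma> (k, True))"
      by (simp add: sum.cartesian_product case_prod_beta')
    also have "\<dots> = (\<Sum>g\<in>PiE UNIV (\<lambda>_. UNIV). \<Prod>k\<in>UNIV.
        A $ fst (g k) $ \<sigma> (k, False) * \<Omega> (fst (g k)) (snd (g k)) * A $ snd (g k) $ \<sigma> (k, True))"
      by (rule prod_sum_PiE) auto
    also have "\<dots> = (\<Sum>g\<in>UNIV. w g * (\<Prod>x\<in>UNIV. A $ F g x $ \<sigma> x))"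
    proof (rule sum.cong)
      show "PiE UNIV (\<lambda>_. UNIV) = (UNIV :: ('n \<Rightarrow> ('n \<times> bool) \<times> ('n \<times> bool)) set)" by (auto simp: PiE_def extensional_def)
      fix g :: "'n \<Rightarrow> ('n \<times> bool) \<times> ('n \<times> bool)"
      have "(\<Prod>x\<in>UNIV. A $ F g x $ \<sigma> x) = (\<Prod>k\<in>UNIV. \<Prod>b\<in>UNIV. A $ F g (k, b) $ \<sigma> (k, b))"
        by (simp add: prod.cartesian_product case_prod_beta')
      also have "\<dots> = (\<Prod>k\<in>UNIV. A $ fst (g k) $ \<sigma> (k, False) * A $ snd (g k) $ \<sigma> (k, True))"
        by (simp add: UNIV_bool F_def)
      finally show "(\<Prod>k\<in>UNIV. A $ fst (g k) $ \<sigma> (k, False) * \<Omega> (fst (g k)) (snd (g k)) * A $ snd (g k) $ \<sigma> (k, True))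
        = w g * (\<Prod>x\<in>UNIV. A $ F g x $ \<sigma> x)"
        by (simp add: w_def prod.distrib mult_ac)
    qed
    finally show ?thesis .
  qed
  have "pfaffian_sum (\<lambda>a b. \<Sum>i\<in>UNIV. \<Sum>j\<in>UNIV. A $ i $ a * \<Omega> i j * A $ j $ b) =
      (\<Sum>\<sigma>\<in>?P. \<Sum>g\<in>UNIV. w g * (of_int (sign \<sigma>) * (\<Prod>x\<in>UNIV. A $ F g x $ \<sigma> x)))"
    unfolding pfaffian_sum_def expand by (simp add: sum_distrib_left mult_ac)
  also have "\<dots> = (\<Sum>g\<in>UNIV. w g * det (\<chi> x. A $ F g x))"
    by (subst sum.swap) (simp add: det_def sum_distrib_left)
  also have "\<dots> = (\<Sum>g\<in>{g. F g permutes UNIV}. w g * det (\<chi> x. A $ F g x))"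
  proof (rule sum.mono_neutral_right)
    show "\<forall>g\<in>UNIV - {g. F g permutes UNIV}. w g * det (\<chi> x. A $ F g x) = 0"
    proof
      fix g assume "g \<in> UNIV - {g. F g permutes UNIV}"
      then have "\<not> bij (F g)" using bij_imp_permutes[of "F g" UNIV] by auto
      then have "\<not> inj (F g)" using finite_UNIV_inj_surj[of "F g"] by (auto simp: bij_def)
      then obtain x y where xy: "x \<noteq> y" "F g x = F g y" unfolding inj_def by blast
      have "det (\<chi> x. A $ F g x) = 0"
        by (rule det_identical_rows[OF xy(1)]) (simp add: row_def xy(2))
      then show "w g * det (\<chi> x. A $ F g x) = 0" by simp
    qed
  qed auto
  also have "\<dots> = (\<Sum>g\<in>{g. F g permutes UNIV}. w g * (of_int (sign (F g)) * det A))"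
    by (intro sum.cong refl) (simp add: det_permute_rows)
  also have "\<dots> = (\<Sum>\<sigma>\<in>?P. (\<Prod>k\<in>UNIV. \<Omega> (\<sigma> (k, False)) (\<sigma> (k, True))) * (of_int (sign \<sigma>) * det A))"
  proof (rule sum.reindex_bij_witness[of _ "\<lambda>\<sigma> k. (\<sigma> (k, False), \<sigma> (k, True))" F])
    show "(\<lambda>k. (\<sigma> (k, False), \<sigma> (k, True))) \<in> {g. F g permutes UNIV}" if "\<sigma> \<in> ?P" for \<sigma>
    proof -
      have "F (\<lambda>k. (\<sigma> (k, False), \<sigma> (k, True))) = \<sigma>" by (auto simp: F_def fun_eq_iff)
      then show ?thesis using that by simp
    qed
  qed (auto simp: F_def w_def fun_eq_iff)
  also have "\<dots> = det A * pfaffian_sum \<Omega>"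
    by (simp add: pfaffian_sum_def sum_distrib_left mult_ac)
  finally show ?thesis .
qed

text \<open>What a Kaehler form gives at a single point of a chart. The conditions are convex, which
  the deformation to the standard form exploits.\<close>

definition kform :: "(complex^'n::finite \<Rightarrow> complex^'n \<Rightarrow> real) \<Rightarrow> bool" where
  "kform w \<longleftrightarrow> bilinear w \<and> (\<forall>u. w u u = 0) \<and> (\<forall>u v. w (\<i> *s u) (\<i> *s v) = w u v) \<and>
     (\<forall>u. u \<noteq> 0 \<longrightarrow> w u (\<i> *s u) > 0)"

text \<open>The standard Kaehler form, the sum of the dx_k wedge dy_k.\<close>

definition kform0 :: "complex^'n::finite \<Rightarrow> complex^'n \<Rightarrow> real" where
  "kform0 u v = (\<Sum>k\<in>UNIV. Re (u $ k) * Im (v $ k) - Im (u $ k) * Re (v $ k))"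

lemma kform_kform0: "kform (kform0 :: complex^'n::finite \<Rightarrow> complex^'n \<Rightarrow> real)"
  unfolding kform_def
proof (intro conjI allI impI)
  show "bilinear (kform0 :: complex^'n \<Rightarrow> complex^'n \<Rightarrow> real)"
    unfolding bilinear_def
    by (auto intro!: linearI simp: kform0_def algebra_simps sum.distrib sum_distrib_left sum_subtractf)
  fix u :: "complex^'n"
  assume u: "u \<noteq> 0"
  have eq: "kform0 u (\<i> *s u) = (\<Sum>k\<in>UNIV. (cmod (u $ k))\<^sup>2)"
    by (simp add: kform0_def cmod_power2 flip: power2_eq_square)
  obtain k where k: "u $ k \<noteq> 0" using u by (auto simp: vec_eq_iff)
  show "kform0 u (\<i> *s u) > 0" unfolding eq
    by (rule sum_pos2[of _ k]) (use k in auto)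
qed (simp_all add: kform0_def algebra_simps)

lemma kform_convex:
  assumes "kform w" "kform w'" "0 \<le> t" "t \<le> 1"
  shows "kform (\<lambda>u v. (1 - t) * w u v + t * w' u v)"
  unfolding kform_def
proof (intro conjI allI impI)
  have b: "bilinear w" "bilinear w'" using assms by (auto simp: kform_def)
  show "bilinear (\<lambda>u v. (1 - t) * w u v + t * w' u v)"
    unfolding bilinear_def
    by (intro conjI allI linearI)
      (simp_all add: b[THEN bilinear_ladd] b[THEN bilinear_radd] b[THEN bilinear_lmul] b[THEN bilinear_rmul] algebra_simps)
  fix u :: "complex^'a" assume u: "u \<noteq> 0"
  then have p: "w u (\<i> *s u) > 0" "w' u (\<i> *s u) > 0" using assms by (auto simp: kform_def)
  show "(1 - t) * w u (\<i> *s u) + t * w' u (\<i> *s u) > 0"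
  proof (cases "t = 0")
    case False
    then show ?thesis using p assms by (intro add_nonneg_pos mult_nonneg_nonneg mult_pos_pos) auto
  qed (use p in auto)
qed (use assms in \<open>auto simp: kform_def\<close>)

lemma real_frame_expand:
  fixes u :: "complex^'n::finite"
  shows "u = (\<Sum>y\<in>UNIV. (if snd y then Im (u $ fst y) else Re (u $ fst y)) *\<^sub>R real_frame y)"
proof -
  have "(\<Sum>y\<in>UNIV. (if snd y then Im (u $ fst y) else Re (u $ fst y)) *\<^sub>R real_frame y) =
      (\<Sum>k\<in>UNIV. \<Sum>b\<in>UNIV. (if b then Im (u $ k) else Re (u $ k)) *\<^sub>R (real_frame (k, b) :: complex^'n))"
    by (simp add: sum.cartesian_product case_prod_beta')
  also have "\<dots> = (\<Sum>k\<in>UNIV. axis k (u $ k))"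
  proof (rule sum.cong[OF refl])
    fix k :: 'n
    have "Re (u $ k) *\<^sub>R axis k 1 + Im (u $ k) *\<^sub>R axis k \<i> = (axis k (u $ k) :: complex^'n)"
      by (simp add: vec_eq_iff axis_def complex_eq_iff)
    then show "(\<Sum>b\<in>UNIV. (if b then Im (u $ k) else Re (u $ k)) *\<^sub>R (real_frame (k, b) :: complex^'n)) = axis k (u $ k)"
      by (simp add: UNIV_bool real_frame_def)
  qed
  also have "\<dots> = u" by (simp add: vec_eq_iff axis_def if_distrib cong: if_cong)
  finally show ?thesis by simp
qed

text \<open>The form is minus the imaginary part of a Hermitian inner product, so an orthonormal
  basis for that inner product brings it to standard shape.\<close>

lemma kform_unitary_basis:
  fixes w :: "complex^'n::finite \<Rightarrow> complex^'n \<Rightarrow> real"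
  assumes w: "kform w"
  shows "\<exists>U :: 'n \<Rightarrow> complex^'n. \<forall>j k. w (U j) (\<i> *s U k) = (if j = k then 1 else 0) \<and> w (U j) (U k) = 0"
proof -
  have bil: "bilinear w" and alt: "\<And>u. w u u = 0" and J: "\<And>u v. w (\<i> *s u) (\<i> *s v) = w u v"
    and pos: "\<And>u. u \<noteq> 0 \<Longrightarrow> w u (\<i> *s u) > 0" using w by (auto simp: kform_def)
  note lr = bilinear_ladd[OF bil] bilinear_radd[OF bil] bilinear_lmul[OF bil] bilinear_rmul[OF bil]
  have skew: "w v u = - w u v" for u v
  proof -
    have "w (u + v) (u + v) = w u u + w u v + (w v u + w v v)" by (simp only: lr add.assoc)
    then show ?thesis by (simp add: alt)
  qed
  have ii: "\<i> *s (\<i> *s u) = - u" for u :: "complex^'n" by (simp add: vec_eq_iff)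
  have Jl: "w (\<i> *s u) v = - w u (\<i> *s v)" for u v
  proof -
    have "w (\<i> *s u) v = w (\<i> *s (\<i> *s u)) (\<i> *s v)" by (rule J[symmetric])
    also have "\<dots> = - w u (\<i> *s v)" by (simp add: ii bilinear_lneg[OF bil])
    finally show ?thesis .
  qed
  \<comment> \<open>The sign of the imaginary part is the one that makes g complex linear in its
    first argument.\<close>
  define g where "g u v = Complex (w u (\<i> *s v)) (- w u v)" for u v
  interpret fd_space "(*s) :: complex \<Rightarrow> complex^'n \<Rightarrow> complex^'n" UNIV
  proof
    show "\<exists>B. finite B \<and> UNIV \<subseteq> vec.span (B :: (complex^'n) set)"
      using vec.span_Basis vec.finite_Basis by blast
  qed simp
  have csc: "c *s u = Re c *\<^sub>R u + Im c *\<^sub>R (\<i> *s u)" for c and u :: "complex^'n"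
    by (simp add: vec_eq_iff complex_eq_iff)
  have g: "hermitian_inner (*s) UNIV g"
  proof (rule hermI[OF hformI])
    show "g (u + v) x = g u x + g v x" for u v x by (simp add: g_def lr complex_eq_iff)
    show "g (c *s u) x = c * g u x" for c u x
      unfolding csc[of c u] by (simp add: g_def lr Jl ii bilinear_rneg[OF bil] complex_eq_iff algebra_simps)
    show "g v u = cnj (g u v)" for u v
      using skew[of u v] skew[of v "\<i> *s u"] Jl[of u v] by (simp add: g_def complex_eq_iff)
    show "Re (g u u) > 0" if "u \<noteq> 0" for u using pos[OF that] by (simp add: g_def)
  qed auto
  obtain bs where bs: "orthonormal_basis (*s) UNIV g bs" using ex_orthonormal_basis[OF g] by blast
  have len: "length bs = CARD('n)"
    using basis_length[of bs] bs vec_dim_card[where 'a=complex and 'n='n] by (auto simp: orthonormal_basis_def)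
  obtain f where f: "bij_betw f (UNIV :: 'n set) {..<CARD('n)}"
    using ex_bij_betw_finite_nat[of "UNIV :: 'n set"] by (auto simp: atLeast0LessThan)
  define U where "U k = bs ! f k" for k
  have fl: "f k < length bs" for k using f len by (auto simp: bij_betw_def)
  have fi: "f j = f k \<longleftrightarrow> j = k" for j k using f by (auto simp: bij_betw_def inj_def)
  have gv: "g (U j) (U k) = (if j = k then 1 else 0)" for j k
    using bs fl fi by (simp add: orthonormal_basis_def U_def)
  have "w (U j) (\<i> *s U k) = (if j = k then 1 else 0) \<and> w (U j) (U k) = 0" for j k
    using gv[of j k] by (cases "j = k") (auto simp: g_def complex_eq_iff)
  then show ?thesis by blast
qed

text \<open>The map exchanges the two elements of each pair indexed by K, hence is a product of
  \<open>card K\<close> transpositions.\<close>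

lemma sign_flip:
  fixes K :: "'n::finite set"
  shows "(\<lambda>x. (fst x, snd x \<noteq> (fst x \<in> K))) permutes UNIV \<and> sign (\<lambda>x. (fst x, snd x \<noteq> (fst x \<in> K))) = (-1) ^ card K"
  using finite[of K]
proof (induction K rule: finite_induct)
  case empty
  then show ?case by (simp add: permutes_id[unfolded id_def])
next
  case (insert k K)
  let ?f = "\<lambda>K x. (fst x, snd x \<noteq> (fst x \<in> K)) :: 'n \<times> bool"
  let ?t = "Transposition.transpose (k, False) (k, True)"
  have eq: "?f (insert k K) = ?t \<circ> ?f K"
    using insert by (auto simp: fun_eq_iff Transposition.transpose_def)
  have t: "?t permutes UNIV" by (rule permutes_swap_id) auto
  have "sign (?t \<circ> ?f K) = sign ?t * sign (?f K)"
    using insert t by (intro sign_compose) (auto simp: permutation_permutes)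
  then show ?case unfolding eq using insert t
    by (auto simp: sign_swap_id intro: permutes_compose)
qed

text \<open>A transposition of the indices acts on both copies and so becomes a product of two
  transpositions.\<close>

lemma sign_double:
  fixes p :: "'n::finite \<Rightarrow> 'n"
  assumes "p permutes UNIV"
  shows "(\<lambda>x. (p (fst x), snd x)) permutes (UNIV :: ('n \<times> bool) set) \<and>
     sign (\<lambda>x. (p (fst x), snd x) :: 'n \<times> bool) = 1"
  using assms finite
proof (induction p rule: permutes_induct)
  case id
  then show ?case by (simp add: permutes_id[unfolded id_def])
next
  case (swap a b p)
  let ?d = "\<lambda>p x. (p (fst x), snd x) :: 'n \<times> bool"
  let ?t = "\<lambda>c::bool. Transposition.transpose (a, c) (b, c)"
  have eq: "?d (Transposition.transpose a b \<circ> p) = ?t False \<circ> (?t True \<circ> ?d p)"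
    by (auto simp: fun_eq_iff Transposition.transpose_def)
  have t: "?t c permutes UNIV" for c by (rule permutes_swap_id) auto
  have pt: "permutation (?t c)" for c by (rule permutes_imp_permutation[OF finite t])
  have pd: "permutation (?d p)" using swap by (intro permutes_imp_permutation[OF finite]) auto
  have "sign (?t False \<circ> (?t True \<circ> ?d p)) = sign (?t False) * (sign (?t True) * sign (?d p))"
    using pt pd by (simp add: sign_compose permutation_compose)
  also have "\<dots> = 1" using swap by (simp add: sign_swap_id)
  finally show ?case unfolding eq using swap t by (auto intro!: permutes_compose)
qed

lemma kform0_real_frame:
  "kform0 (real_frame a) (real_frame b :: complex^'n::finite) =
     (if fst a = fst b then (if snd a = snd b then 0 else if snd a then -1 else 1) else 0)" (is "_ = ?r")
proof -
  have "kform0 (real_frame a) (real_frame b :: complex^'n) = (\<Sum>m\<in>UNIV. if m = fst a then ?r else 0)"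
    unfolding kform0_def by (intro sum.cong refl) (auto simp: real_frame_def axis_def)
  then show ?thesis by simp
qed

text \<open>A term is nonzero only if the permutation maps pairs to pairs; it is then a permutation
  of the pairs composed with flips inside them. Each flip contributes -1 to the sign and -1 to the
  product, so every term is nonnegative, and the identity contributes 1.\<close>

lemma pfaffian_sum_kform0_pos: "pfaffian_sum (\<lambda>a b. kform0 (real_frame a) (real_frame b :: complex^'n::finite)) > 0"
proof -
  let ?S = "\<lambda>a b. kform0 (real_frame a) (real_frame b :: complex^'n)"
  note S = kform0_real_frame
  let ?P = "{\<sigma>. \<sigma> permutes (UNIV :: ('n \<times> bool) set)}"
  let ?w = "\<lambda>\<sigma>. of_int (sign \<sigma>) * (\<Prod>k\<in>UNIV. ?S (\<sigma> (k, False)) (\<sigma> (k, True)))"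
  have nonneg: "?w \<sigma> \<ge> 0" if \<sigma>: "\<sigma> \<in> ?P" for \<sigma>
  proof (cases "\<forall>k. ?S (\<sigma> (k, False)) (\<sigma> (k, True)) \<noteq> 0")
    case True
    then have fs: "fst (\<sigma> (k, True)) = fst (\<sigma> (k, False))" "snd (\<sigma> (k, True)) \<noteq> snd (\<sigma> (k, False))" for k
      unfolding S by (metis (full_types))+
    define p where "p k = fst (\<sigma> (k, False))" for k
    define K where "K = {k. snd (\<sigma> (k, False))}"
    let ?f = "\<lambda>x. (fst x, snd x \<noteq> (fst x \<in> K)) :: 'n \<times> bool"
    let ?d = "\<lambda>x. (p (fst x), snd x) :: 'n \<times> bool"
    have eq: "\<sigma> = ?d \<circ> ?f"
    proof
      fix x :: "'n \<times> bool"
      obtain k b where x: "x = (k, b)" by (cases x)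
      show "\<sigma> x = (?d \<circ> ?f) x"
        unfolding x using fs[of k] by (cases b) (auto simp: p_def K_def prod_eq_iff)
    qed
    have inj\<sigma>: "inj \<sigma>" using \<sigma> permutes_inj by blast
    have "inj p"
    proof (rule injI)
      fix j k assume jk: "p j = p k"
      have "\<exists>b c. \<sigma> (j, b) = \<sigma> (k, c)"
      proof -
        have "\<sigma> (j, j \<in> K) = (p j, False)" "\<sigma> (k, k \<in> K) = (p k, False)"
          by (subst eq, simp)+
        then show ?thesis using jk by metis
      qed
      then show "j = k" using injD[OF inj\<sigma>] by blast
    qed
    then have "p permutes UNIV" using bij_imp_permutes[of p UNIV] finite_UNIV_inj_surj[of p] by (auto simp: bij_def)
    note d = sign_double[OF this] and f = sign_flip[of K]
    have sg: "sign \<sigma> = (-1) ^ card K"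
      unfolding eq using d f permutes_imp_permutation[OF finite] by (subst sign_compose) auto
    have "(\<Prod>k\<in>UNIV. ?S (\<sigma> (k, False)) (\<sigma> (k, True))) = (\<Prod>k\<in>UNIV. if k \<in> K then -1 else 1)"
      unfolding S using fs by (intro prod.cong refl) (auto simp: K_def)
    also have "\<dots> = (-1) ^ card K"
      by (simp add: prod.If_cases)
    finally show ?thesis unfolding sg by (simp flip: power_add power2_eq_square)
  next
    case False
    then have "(\<Prod>k\<in>UNIV. ?S (\<sigma> (k, False)) (\<sigma> (k, True))) = 0" by auto
    then show ?thesis by (simp only: mult_zero_right order_refl)
  qed
  have "?w id > 0" unfolding S by simp
  then have "(\<Sum>\<sigma>\<in>?P. ?w \<sigma>) > 0"
    by (intro sum_pos2[of _ id]) (auto simp: nonneg[simplified] permutes_id finite_permutations)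
  then show ?thesis by (simp add: pfaffian_sum_def)
qed

text \<open>In a unitary basis the form is the standard one, so the positive standard value equals
  det A times the value in question. The sign of det A stays open here; the deformation argument
  below settles it.\<close>

lemma pfaffian_sum_kform_nonzero:
  fixes w :: "complex^'n::finite \<Rightarrow> complex^'n \<Rightarrow> real"
  assumes w: "kform w"
  shows "pfaffian_sum (\<lambda>a b. w (real_frame a) (real_frame b)) \<noteq> 0"
proof -
  have bil: "bilinear w" and alt: "\<And>u. w u u = 0" and J: "\<And>u v. w (\<i> *s u) (\<i> *s v) = w u v"
    using w by (auto simp: kform_def)
  have skew: "w v u = - w u v" for u v
  proof -
    have "w (u + v) (u + v) = w u u + w u v + (w v u + w v v)"
      by (simp only: bilinear_ladd[OF bil] bilinear_radd[OF bil] add.assoc)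
    then show ?thesis by (simp add: alt)
  qed
  obtain U :: "'n \<Rightarrow> complex^'n" where U: "\<And>j k. w (U j) (U k) = 0"
    "\<And>j k. w (U j) (\<i> *s U k) = (if j = k then 1 else 0)" using kform_unitary_basis[OF w] by blast
  define W where "W x = (if snd x then \<i> *s U (fst x) else U (fst x))" for x
  define A :: "real^('n \<times> bool)^('n \<times> bool)"
    where "A = (\<chi> y x. if snd y then Im (W x $ fst y) else Re (W x $ fst y))"
  have "w (W a) (W b) = (\<Sum>i\<in>UNIV. \<Sum>j\<in>UNIV. A $ i $ a * w (real_frame i) (real_frame j) * A $ j $ b)" for a b
  proof -
    have e: "W x = (\<Sum>y\<in>UNIV. (A $ y $ x) *\<^sub>R real_frame y)" for x
      by (subst real_frame_expand) (simp add: A_def)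
    have "w (W a) (W b) = (\<Sum>(i, j)\<in>UNIV \<times> UNIV. w ((A $ i $ a) *\<^sub>R real_frame i) ((A $ j $ b) *\<^sub>R real_frame j))"
      unfolding e by (rule bilinear_sum[OF bil]) 
    also have "\<dots> = (\<Sum>i\<in>UNIV. \<Sum>j\<in>UNIV. w ((A $ i $ a) *\<^sub>R real_frame i) ((A $ j $ b) *\<^sub>R real_frame j))"
      by (rule sum.cartesian_product[symmetric])
    finally show ?thesis by (simp add: bilinear_lmul[OF bil] bilinear_rmul[OF bil] mult_ac)
  qed
  then have "pfaffian_sum (\<lambda>a b. w (W a) (W b)) = det A * pfaffian_sum (\<lambda>a b. w (real_frame a) (real_frame b))"
    by (simp add: pfaffian_sum_transform)
  moreover have "w (W a) (W b) = kform0 (real_frame a) (real_frame b :: complex^'n)" for a b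
    using U skew[of "U (fst b)" "\<i> *s U (fst a)"]
    unfolding kform0_real_frame by (auto simp: W_def J)
  ultimately show ?thesis using pfaffian_sum_kform0_pos[where 'n='n] by auto
qed

text \<open>The sum has no zero on the segment from the standard form to \<open>w\<close>, so it keeps its sign.\<close>

lemma pfaffian_sum_kform_pos:
  fixes w :: "complex^'n::finite \<Rightarrow> complex^'n \<Rightarrow> real"
  assumes w: "kform w"
  shows "pfaffian_sum (\<lambda>a b. w (real_frame a) (real_frame b)) > 0"
proof (rule ccontr)
  assume neg: "\<not> ?thesis"
  define G where "G t = pfaffian_sum (\<lambda>a b. (1 - t) * kform0 (real_frame a) (real_frame b :: complex^'n) +
    t * w (real_frame a) (real_frame b))" for t
  have "continuous_on {0..1} G" unfolding G_def pfaffian_sum_def by (intro continuous_intros)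
  moreover have "G 1 \<le> 0" "0 \<le> G 0" using neg pfaffian_sum_kform0_pos[where 'n='n] by (simp_all add: G_def)
  ultimately obtain t where "0 \<le> t" "t \<le> 1" "G t = 0" using IVT2'[of G 1 0 0] by auto
  then show False
    using pfaffian_sum_kform_nonzero[OF kform_convex[OF kform_kform0 w], of t] by (simp add: G_def)
qed

lemma vol_density_pos:
  fixes \<omega> :: "('a, 'n::finite) two_form"
  assumes "kaehler_form X \<omega>" "c \<in> atlas X" "z \<in> snd c ` fst c"
  shows "vol_density \<omega> c z > 0"
proof -
  have "kform (\<omega> c z)"
    using assms unfolding kaehler_form_def smooth_two_form_def kform_def by blast
  then show ?thesis
    using pfaffian_sum_kform_pos[of "\<omega> c z"] by (simp add: vol_density_def pfaffian_sum_def)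
qed

lemma vol_density_continuous_on:
  fixes \<omega> :: "('a, 'n::finite) two_form"
  assumes "kaehler_form X \<omega>" "c \<in> atlas X"
  shows "continuous_on (snd c ` fst c) (vol_density \<omega> c)"
proof -
  have "continuous_on (snd c ` fst c) (\<lambda>z. \<omega> c z u v)" for u v
  proof -
    have "smooth_on (\<lambda>z. \<omega> c z u v) (snd c ` fst c)"
      using assms unfolding kaehler_form_def smooth_two_form_def by blast
    then show ?thesis unfolding smooth_on_def by (metis Ck_on.simps(1))
  qed
  then show ?thesis unfolding vol_density_def by (intro continuous_intros) auto
qed

section \<open>Integration over compact manifolds\<close>

locale compact_kaehler_manifold =
  fixes X :: "('a, 'n::finite) cmfd" and \<omega> :: "('a, 'n) two_form"
  assumes manifold: "complex_manifold X" and kaehler: "kaehler_form X \<omega>"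
    and compact_X: "compact_space (topo X)"
begin

abbreviation cont :: "('a \<Rightarrow> 'b::topological_space) \<Rightarrow> bool" where
  "cont f \<equiv> continuous_map (topo X) euclidean f"

section \<open>Charts, continuity and compact covers\<close>

lemma Hausdorff_X: "Hausdorff_space (topo X)"
  using manifold by (simp add: complex_manifold_def)

lemma atlas_cover: "x \<in> pts X \<Longrightarrow> \<exists>c\<in>atlas X. x \<in> fst c"
  using manifold unfolding complex_manifold_def by blast

lemma
  assumes "c \<in> atlas X"
  shows chart_openin: "openin (topo X) (fst c)" and chart_open_image: "open (snd c ` fst c)"
    and chart_homeo: "homeomorphic_map (subtopology (topo X) (fst c)) (top_of_set (snd c ` fst c)) (snd c)"
  using manifold assms unfolding complex_manifold_def by (auto simp: case_prod_beta')

lemma chart_subset: "c \<in> atlas X \<Longrightarrow> fst c \<subseteq> pts X"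
  using chart_openin openin_subset by blast

lemma chart_topspace: "c \<in> atlas X \<Longrightarrow> topspace (subtopology (topo X) (fst c)) = fst c"
  using chart_subset[of c] by (simp add: topspace_subtopology Int_absorb1)

lemma chart_inj:
  assumes c: "c \<in> atlas X"
  shows "inj_on (snd c) (fst c)"
  using homeomorphic_imp_injective_map[OF chart_homeo[OF c]] unfolding chart_topspace[OF c] .

lemma chart_inv_left: "c \<in> atlas X \<Longrightarrow> x \<in> fst c \<Longrightarrow> chart_inv c (snd c x) = x"
  unfolding chart_inv_def by (rule inv_into_f_f[OF chart_inj])

lemma chart_inv_in: "z \<in> snd c ` A \<Longrightarrow> A \<subseteq> fst c \<Longrightarrow> c \<in> atlas X \<Longrightarrow> chart_inv c z \<in> A"
  by (auto simp: chart_inv_left subset_iff)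

lemma chart_open_subset:
  assumes c: "c \<in> atlas X" and W: "openin (topo X) W" "W \<subseteq> fst c"
  shows "open (snd c ` W)"
proof -
  have "openin (subtopology (topo X) (fst c)) W"
    using W by (metis inf.absorb_iff1 openin_subtopology)
  then have "openin (top_of_set (snd c ` fst c)) (snd c ` W)"
    using homeomorphic_map_openness_eq[OF chart_homeo[OF c]] by blast
  then show ?thesis using openin_open_trans chart_open_image[OF c] by blast
qed

lemma chart_compact_subset:
  assumes c: "c \<in> atlas X" and K: "compactin (topo X) K" "K \<subseteq> fst c"
  shows "compact (snd c ` K)"
proof -
  have "compactin (subtopology (topo X) (fst c)) K" using K by (simp add: compactin_subtopology)
  then have "compactin (top_of_set (snd c ` fst c)) (snd c ` K)"
    by (rule image_compactin) (rule homeomorphic_imp_continuous_map[OF chart_homeo[OF c]])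
  then show ?thesis by (simp add: compactin_subtopology)
qed

lemma chart_inv_continuous_map:
  assumes c: "c \<in> atlas X"
  shows "continuous_map (top_of_set (snd c ` fst c)) (topo X) (chart_inv c)"
proof -
  obtain g where g: "homeomorphic_maps (subtopology (topo X) (fst c)) (top_of_set (snd c ` fst c)) (snd c) g"
    using chart_homeo[OF c] homeomorphic_map_maps by blast
  have gl: "g (snd c x) = x" if "x \<in> fst c" for x
    using g that unfolding homeomorphic_maps_def chart_topspace[OF c] by blast
  have "continuous_map (top_of_set (snd c ` fst c)) (subtopology (topo X) (fst c)) g"
    using g by (simp add: homeomorphic_maps_def)
  then have "continuous_map (top_of_set (snd c ` fst c)) (topo X) g"
    by (rule continuous_map_into_fulltopology)
  then show ?thesis
    by (rule continuous_map_eq) (auto simp: gl chart_inv_left[OF c])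
qed

lemma cont_chart:
  assumes c: "c \<in> atlas X" and f: "cont f"
  shows "continuous_on (snd c ` fst c) (\<lambda>z. f (chart_inv c z))"
  using continuous_map_compose[OF chart_inv_continuous_map[OF c] f]
  by (simp only: continuous_map_iff_continuous o_def)

lemma cont_localI:
  assumes "\<And>x. x \<in> pts X \<Longrightarrow> \<exists>c\<in>atlas X. \<exists>W. openin (topo X) W \<and> x \<in> W \<and> W \<subseteq> fst c \<and>
    continuous_on (snd c ` W) (\<lambda>z. f (chart_inv c z))"
  shows "cont f"
proof -
  have "\<exists>W. openin (topo X) W \<and> x \<in> W \<and> W \<subseteq> f -` G" if x: "x \<in> pts X" and G: "open G" "f x \<in> G" for x G
  proof -
    obtain c W where c: "c \<in> atlas X" and W: "openin (topo X) W" "x \<in> W" "W \<subseteq> fst c"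
      and co: "continuous_on (snd c ` W) (\<lambda>z. f (chart_inv c z))" using assms[OF x] by blast
    have "continuous_map (subtopology (topo X) W) (top_of_set (snd c ` W)) (snd c)"
      using homeomorphic_imp_continuous_map[OF chart_homeo[OF c]] W(3)
      by (auto simp: continuous_map_in_subtopology continuous_map_from_subtopology_mono)
    moreover have "continuous_map (top_of_set (snd c ` W)) euclidean (\<lambda>z. f (chart_inv c z))"
      using co by simp
    ultimately have "continuous_map (subtopology (topo X) W) euclidean ((\<lambda>z. f (chart_inv c z)) \<circ> snd c)"
      by (rule continuous_map_compose)
    then have cf: "continuous_map (subtopology (topo X) W) euclidean f"
    proof (rule continuous_map_eq)
      fix y assume "y \<in> topspace (subtopology (topo X) W)"
      then have "y \<in> fst c" using W(3) by (auto simp: topspace_subtopology)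
      then show "((\<lambda>z. f (chart_inv c z)) \<circ> snd c) y = f y" by (simp add: chart_inv_left[OF c])
    qed
    have "openin (subtopology (topo X) W) {y \<in> topspace (subtopology (topo X) W). f y \<in> G}"
      by (rule openin_continuous_map_preimage[OF cf]) (use G in simp)
    then have "openin (topo X) {y \<in> topspace (subtopology (topo X) W). f y \<in> G}"
      using openin_trans_full W(1) by blast
    then show ?thesis using x W G by (intro exI[of _ "{y \<in> topspace (subtopology (topo X) W). f y \<in> G}"]) (auto simp: topspace_subtopology)
  qed
  note nbhd = this
  have "openin (topo X) {x \<in> pts X. f x \<in> G}" if G: "open G" for G
  proof (subst openin_subopen, intro ballI)
    fix x assume "x \<in> {x \<in> pts X. f x \<in> G}"
    then obtain W where W: "openin (topo X) W" "x \<in> W" "W \<subseteq> f -` G" using nbhd[OF _ G, of x] by blast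
    then show "\<exists>T. openin (topo X) T \<and> x \<in> T \<and> T \<subseteq> {x \<in> pts X. f x \<in> G}"
      using openin_subset[OF W(1)] by blast
  qed
  then show ?thesis by (auto simp: continuous_map_def)
qed

text \<open>\<open>vol_integral\<close> selects a cover by \<open>SOME\<close>, which is meaningful
  only if one exists. Closed coordinate balls serve: by compactness finitely many of the open balls
  inside them already cover X.\<close>

lemma chart_cover_exists: "\<exists>cs. chart_cover X cs"
proof -
  have loc: "\<exists>c K W. c \<in> atlas X \<and> compactin (topo X) K \<and> K \<subseteq> fst c \<and> openin (topo X) W \<and> x \<in> W \<and> W \<subseteq> K"
    if x: "x \<in> pts X" for x
  proof -
    obtain c where c: "c \<in> atlas X" "x \<in> fst c" using atlas_cover[OF x] by blast
    obtain e where e: "e > 0" "cball (snd c x) e \<subseteq> snd c ` fst c"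
      using open_contains_cball[of "snd c ` fst c"] chart_open_image[OF c(1)] c(2) by blast
    let ?g = "chart_inv c"
    have "compactin (top_of_set (snd c ` fst c)) (cball (snd c x) e)"
      using e by (simp add: compactin_subtopology)
    then have K: "compactin (topo X) (?g ` cball (snd c x) e)"
      by (rule image_compactin[OF _ chart_inv_continuous_map[OF c(1)]])
    let ?W = "{y \<in> topspace (subtopology (topo X) (fst c)). snd c y \<in> snd c ` fst c \<inter> ball (snd c x) e}"
    have "openin (subtopology (topo X) (fst c)) ?W"
      by (rule openin_continuous_map_preimage[OF homeomorphic_imp_continuous_map[OF chart_homeo[OF c(1)]]])
         (rule openin_open_Int, simp)
    then have W: "openin (topo X) ?W" using openin_trans_full chart_openin[OF c(1)] by blast
    have "?g ` cball (snd c x) e \<subseteq> fst c" using e(2) chart_inv_in[OF _ order_refl c(1)] by blast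
    moreover have "?W \<subseteq> ?g ` cball (snd c x) e"
    proof
      fix y assume "y \<in> ?W"
      then have y: "y \<in> fst c" "snd c y \<in> cball (snd c x) e" using chart_topspace[OF c(1)] by auto
      then show "y \<in> ?g ` cball (snd c x) e" using chart_inv_left[OF c(1) y(1)] by (metis imageI)
    qed
    moreover have "x \<in> ?W" using c e chart_topspace[OF c(1)] by auto
    ultimately show ?thesis using c(1) K W by blast
  qed
  then have "\<forall>x. \<exists>c K W. x \<in> pts X \<longrightarrow> c \<in> atlas X \<and> compactin (topo X) K \<and> K \<subseteq> fst c \<and> openin (topo X) W \<and> x \<in> W \<and> W \<subseteq> K"
    by blast
  then obtain c K W where ckw: "\<forall>x. x \<in> pts X \<longrightarrow> c x \<in> atlas X \<and> compactin (topo X) (K x) \<and> K x \<subseteq> fst (c x) \<and>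
      openin (topo X) (W x) \<and> x \<in> W x \<and> W x \<subseteq> K x"
    by metis
  have "\<exists>\<F>. finite \<F> \<and> \<F> \<subseteq> W ` pts X \<and> pts X \<subseteq> \<Union>\<F>"
    using compact_X[unfolded compact_space_alt, rule_format, of "W ` pts X"] ckw by blast
  then obtain \<F> where F: "finite \<F>" "\<F> \<subseteq> W ` pts X" "pts X \<subseteq> \<Union>\<F>" by blast
  then obtain P where P: "P \<subseteq> pts X" "finite P" "\<F> = W ` P" by (meson finite_subset_image)
  obtain ps where ps: "set ps = P" using finite_list[OF P(2)] by blast
  have "chart_cover X (map (\<lambda>x. (c x, K x)) ps)"
    unfolding chart_cover_def
  proof (intro conjI)
    show "\<forall>(c, K)\<in>set (map (\<lambda>x. (c x, K x)) ps). c \<in> atlas X \<and> compactin (topo X) K \<and> K \<subseteq> fst c"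
      using ckw P ps by auto
    have "K x \<subseteq> pts X" if "x \<in> P" for x using ckw P that compactin_subset_topspace by blast
    moreover have "pts X \<subseteq> (\<Union>x\<in>P. K x)" using F(3) P ckw by blast
    ultimately show "(\<Union>(c, K)\<in>set (map (\<lambda>x. (c x, K x)) ps). K) = pts X" using ps by auto
  qed
  then show ?thesis by blast
qed

text \<open>The same choice term as in \<open>vol_integral\<close>, so that the integral unfolds to
  a sum over pieces without a change of cover.\<close>

definition cover :: "(('a, 'n) chart \<times> 'a set) list" where
  "cover = (SOME cs. chart_cover X cs)"

definition ch :: "nat \<Rightarrow> ('a, 'n) chart" where "ch k = fst (cover ! k)"

definition piece :: "nat \<Rightarrow> 'a set" where
  "piece k = snd (cover ! k) - (\<Union>j<k. snd (cover ! j))"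

lemma chart_cover_cover: "chart_cover X cover"
  unfolding cover_def using chart_cover_exists by (rule someI_ex)

lemma
  assumes "k < length cover"
  shows ch_atlas: "ch k \<in> atlas X" and cover_compact: "compactin (topo X) (snd (cover ! k))"
    and cover_subset: "snd (cover ! k) \<subseteq> fst (ch k)"
  using chart_cover_cover nth_mem[OF assms] unfolding chart_cover_def ch_def by (auto simp: case_prod_beta')

lemma cover_Union: "pts X = (\<Union>k<length cover. snd (cover ! k))"
proof -
  have "(\<Union>(c, K)\<in>set cover. K) = pts X" using chart_cover_cover unfolding chart_cover_def by blast
  then have "pts X = (\<Union>p\<in>set cover. snd p)" by (simp add: case_prod_beta')
  also have "\<dots> = (\<Union>k<length cover. snd (cover ! k))" unfolding set_conv_nth by blast
  finally show ?thesis .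
qed

lemma piece_subset: "k < length cover \<Longrightarrow> piece k \<subseteq> fst (ch k)"
  using cover_subset by (auto simp: piece_def)

definition dens :: "nat \<Rightarrow> complex^'n \<Rightarrow> real" where "dens k = vol_density \<omega> (ch k)"

lemma vol_integral_eq:
  "vol_integral X \<omega> f = (\<Sum>k<length cover. set_lebesgue_integral lborel (snd (ch k) ` piece k)
     (\<lambda>z. dens k z *\<^sub>R f (chart_inv (ch k) z)))"
  unfolding vol_integral_def cover_def[symmetric] Let_def ch_def piece_def dens_def ..

text \<open>In its chart a piece is a difference of two compact sets; the Hausdorff property makes
  the part taken away compact.\<close>

lemma piece_borel:
  assumes k: "k < length cover"
  shows "snd (ch k) ` piece k \<in> sets borel"
proof -
  let ?K = "snd (cover ! k)" and ?L = "\<Union>j<k. snd (cover ! j)"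
  have L: "compactin (topo X) ?L"
    using cover_compact k by (intro compactin_Union[of "(\<lambda>j. snd (cover ! j)) ` {..<k}", simplified]) auto
  have KL: "compactin (topo X) (?K \<inter> ?L)"
    by (rule compactin_Int[OF Hausdorff_X cover_compact[OF k] L])
  note c = ch_atlas[OF k] and s = cover_subset[OF k]
  have "snd (ch k) ` piece k = snd (ch k) ` ?K - snd (ch k) ` (?K \<inter> ?L)"
  proof -
    have "piece k = ?K - (?K \<inter> ?L)" by (auto simp: piece_def)
    then show ?thesis
      using inj_on_image_set_diff[OF chart_inj[OF c], of ?K "?K \<inter> ?L"] s by auto
  qed
  moreover have "compact (snd (ch k) ` ?K)" "compact (snd (ch k) ` (?K \<inter> ?L))"
    using chart_compact_subset[OF c] cover_compact[OF k] KL s by auto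
  ultimately show ?thesis using compact_imp_closed borel_closed by (metis sets.Diff)
qed

lemma piece_integrable:
  fixes f :: "'a \<Rightarrow> 'b::{banach, second_countable_topology}"
  assumes k: "k < length cover" and f: "cont f"
  shows "set_integrable lborel (snd (ch k) ` piece k) (\<lambda>z. dens k z *\<^sub>R f (chart_inv (ch k) z))"
proof (rule set_integrable_subset)
  note c = ch_atlas[OF k] and s = cover_subset[OF k]
  show "set_integrable lborel (snd (ch k) ` snd (cover ! k)) (\<lambda>z. dens k z *\<^sub>R f (chart_inv (ch k) z))"
    unfolding set_integrable_def dens_def
  proof (rule borel_integrable_compact)
    show "compact (snd (ch k) ` snd (cover ! k))" using chart_compact_subset[OF c cover_compact[OF k] s] .
    have "snd (ch k) ` snd (cover ! k) \<subseteq> snd (ch k) ` fst (ch k)" using s by blast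
    then show "continuous_on (snd (ch k) ` snd (cover ! k)) (\<lambda>z. vol_density \<omega> (ch k) z *\<^sub>R f (chart_inv (ch k) z))"
      using continuous_on_subset[OF vol_density_continuous_on[OF kaehler c]] continuous_on_subset[OF cont_chart[OF c f]]
      by (intro continuous_on_scaleR) auto
  qed
qed (use piece_borel[OF k] in \<open>auto simp: piece_def\<close>)

lemma vol_integral_add:
  fixes f g :: "'a \<Rightarrow> 'b::{banach, second_countable_topology}"
  assumes "cont f" "cont g"
  shows "vol_integral X \<omega> (\<lambda>x. f x + g x) = vol_integral X \<omega> f + vol_integral X \<omega> g"
  unfolding vol_integral_eq sum.distrib[symmetric]
  by (intro sum.cong refl) (simp add: scaleR_add_right set_integral_add piece_integrable assms)

text \<open>One statement for real parts, conjugation, multiplication by scalars and the integral of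
  a constant.\<close>

lemma vol_integral_bounded_linear:
  fixes f :: "'a \<Rightarrow> 'b::{banach, second_countable_topology}"
    and A :: "'b \<Rightarrow> 'c::{banach, second_countable_topology}"
  assumes A: "bounded_linear A" and f: "cont f"
  shows "vol_integral X \<omega> (\<lambda>x. A (f x)) = A (vol_integral X \<omega> f)"
proof -
  have "set_lebesgue_integral lborel (snd (ch k) ` piece k) (\<lambda>z. dens k z *\<^sub>R A (f (chart_inv (ch k) z)))
     = A (set_lebesgue_integral lborel (snd (ch k) ` piece k) (\<lambda>z. dens k z *\<^sub>R f (chart_inv (ch k) z)))"
    if k: "k < length cover" for k
    using integral_bounded_linear[OF A piece_integrable[OF k f, unfolded set_integrable_def]]
    unfolding set_lebesgue_integral_def by (simp add: linear_scale[OF bounded_linear.linear[OF A]])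
  then show ?thesis
    unfolding vol_integral_eq linear_sum[OF bounded_linear.linear[OF A]] by (intro sum.cong refl) simp
qed

lemma piece_nonneg:
  assumes k: "k < length cover" and f: "\<And>x. x \<in> pts X \<Longrightarrow> f x \<ge> (0::real)"
  shows "0 \<le> indicator (snd (ch k) ` piece k) z *\<^sub>R (dens k z *\<^sub>R f (chart_inv (ch k) z))"
proof (cases "z \<in> snd (ch k) ` piece k")
  case True
  note c = ch_atlas[OF k]
  have "chart_inv (ch k) z \<in> piece k" using chart_inv_in[OF True piece_subset[OF k] c] .
  then have "f (chart_inv (ch k) z) \<ge> 0" using f piece_subset[OF k] chart_subset[OF c] by blast
  moreover have "dens k z > 0"
    unfolding dens_def using True piece_subset[OF k] by (intro vol_density_pos[OF kaehler c]) auto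
  ultimately show ?thesis using True by simp
qed simp

lemma vol_integral_nonneg:
  assumes "\<And>x. x \<in> pts X \<Longrightarrow> f x \<ge> (0::real)"
  shows "vol_integral X \<omega> f \<ge> 0"
  unfolding vol_integral_eq set_lebesgue_integral_def
  by (intro sum_nonneg Bochner_Integration.integral_nonneg piece_nonneg assms) auto

text \<open>Remove the first compact sets of the cover from \<open>W\<close> as long as something remains.\<close>

lemma open_subset_piece:
  assumes W: "openin (topo X) W" "W \<noteq> {}"
  shows "\<exists>k<length cover. \<exists>O'. openin (topo X) O' \<and> O' \<noteq> {} \<and> O' \<subseteq> W \<and> O' \<subseteq> piece k"
proof -
  define P where "P k \<longleftrightarrow> W \<subseteq> (\<Union>j<k. snd (cover ! j))" for k
  have Pl: "P (length cover)" unfolding P_def using openin_subset[OF W(1)] cover_Union by simp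
  have "\<not> P 0" using W by (auto simp: P_def)
  define m where "m = (LEAST k. P k)"
  have "P m" unfolding m_def using Pl by (rule LeastI)
  have ml: "m \<le> length cover" unfolding m_def using Pl by (rule Least_le)
  obtain k where k: "m = Suc k" using \<open>\<not> P 0\<close> \<open>P m\<close> by (cases m) auto
  have "\<not> P k" using not_less_Least[of k P] k by (simp add: m_def)
  have kl: "k < length cover" using ml k by simp
  have "closedin (topo X) (\<Union>j<k. snd (cover ! j))"
    using kl cover_compact compactin_imp_closedin[OF Hausdorff_X] by (intro closedin_Union) auto
  then have "openin (topo X) (W - (\<Union>j<k. snd (cover ! j)))" using W(1) by (rule openin_diff[rotated])
  moreover have "W - (\<Union>j<k. snd (cover ! j)) \<noteq> {}" using \<open>\<not> P k\<close> by (auto simp: P_def)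
  moreover have "W - (\<Union>j<k. snd (cover ! j)) \<subseteq> piece k"
    using \<open>P m\<close> unfolding P_def k piece_def by (auto simp: lessThan_Suc)
  ultimately show ?thesis using kl by blast
qed

text \<open>A piece may have empty interior, so positivity of f on an open set must be located:
  \<open>open_subset_piece\<close> supplies a piece containing a nonempty open part of that set, and
  nonempty open sets are not negligible.\<close>

lemma vol_integral_pos:
  assumes f: "cont f" and nn: "\<And>x. x \<in> pts X \<Longrightarrow> f x \<ge> (0::real)" and x: "x \<in> pts X" "f x > 0"
  shows "vol_integral X \<omega> f > 0"
proof -
  let ?W = "{y \<in> pts X. f y \<in> {0<..}}"
  have "openin (topo X) ?W" by (rule openin_continuous_map_preimage[OF f]) simp
  moreover have "?W \<noteq> {}" using x by auto
  ultimately obtain k O' where k: "k < length cover" and O: "openin (topo X) O'" "O' \<noteq> {}" "O' \<subseteq> ?W" "O' \<subseteq> piece k"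
    using open_subset_piece by meson
  note c = ch_atlas[OF k]
  let ?I = "\<lambda>k z. indicator (snd (ch k) ` piece k) z *\<^sub>R (dens k z *\<^sub>R f (chart_inv (ch k) z))"
  have Osub: "O' \<subseteq> fst (ch k)" using O(4) piece_subset[OF k] by blast
  have opn: "open (snd (ch k) ` O')" by (rule chart_open_subset[OF c O(1) Osub])
  have pos: "?I k z > 0" if "z \<in> snd (ch k) ` O'" for z
  proof -
    have "z \<in> snd (ch k) ` piece k" using that O(4) by blast
    moreover have "f (chart_inv (ch k) z) > 0" using chart_inv_in[OF that Osub c] O(3) by auto
    moreover have "dens k z > 0" unfolding dens_def
      using that Osub by (intro vol_density_pos[OF kaehler c]) auto
    ultimately show ?thesis by simp
  qed
  have int: "integrable lborel (?I k)"
    using piece_integrable[OF k f] by (simp add: set_integrable_def)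
  have nnI: "AE z in lborel. 0 \<le> ?I k z" by (rule AE_I2) (rule piece_nonneg[OF k nn])
  have "integral\<^sup>L lborel (?I k) \<noteq> 0"
  proof
    assume "integral\<^sup>L lborel (?I k) = 0"
    then have "AE z in lborel. ?I k z = 0"
      using integral_nonneg_eq_0_iff_AE[OF int nnI] by blast
    then have "AE z in lborel. z \<notin> snd (ch k) ` O'"
    proof eventually_elim
      case (elim z)
      then show ?case using pos[of z] by (metis less_irrefl)
    qed
    then have "snd (ch k) ` O' \<in> null_sets lborel"
      using opn by (subst (asm) AE_iff_null_sets[symmetric]) auto
    then have "negligible (snd (ch k) ` O')"
      by (simp add: negligible_iff_null_sets null_sets_completionI)
    then show False using open_not_negligible[OF opn] O(2) by blast
  qed
  moreover have "integral\<^sup>L lborel (?I j) \<ge> 0" if "j < length cover" for j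
    by (intro Bochner_Integration.integral_nonneg piece_nonneg[OF that nn])
  ultimately show ?thesis
    unfolding vol_integral_eq set_lebesgue_integral_def using k
    by (intro sum_pos2[of _ k]) (auto simp: order_less_le)
qed

lemma vol_integral_sum:
  fixes f :: "'i \<Rightarrow> 'a \<Rightarrow> 'b::{banach, second_countable_topology}"
  assumes "finite I" "\<And>i. i \<in> I \<Longrightarrow> cont (f i)"
  shows "vol_integral X \<omega> (\<lambda>x. \<Sum>i\<in>I. f i x) = (\<Sum>i\<in>I. vol_integral X \<omega> (f i))"
  using assms
proof (induction I rule: finite_induct)
  case empty
  have "vol_integral X \<omega> (\<lambda>x. 0 :: 'b) = 0"
    unfolding vol_integral_eq by (simp add: set_lebesgue_integral_def)
  then show ?case by simp
next
  case (insert i I)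
  have "cont (\<lambda>x. \<Sum>i\<in>I. f i x)" using insert by (intro continuous_map_sum) auto
  then show ?case using insert by (simp add: vol_integral_add)
qed

lemma vol_integral_cong:
  assumes "\<And>x. x \<in> pts X \<Longrightarrow> f x = g x"
  shows "vol_integral X \<omega> f = vol_integral X \<omega> g"
  unfolding vol_integral_eq
proof (intro sum.cong refl)
  fix k assume "k \<in> {..<length cover}"
  then have k: "k < length cover" by simp
  have "f (chart_inv (ch k) z) = g (chart_inv (ch k) z)" if "z \<in> snd (ch k) ` piece k" for z
    using chart_inv_in[OF that piece_subset[OF k] ch_atlas[OF k]] piece_subset[OF k] chart_subset[OF ch_atlas[OF k]]
    by (intro assms) blast
  then show "set_lebesgue_integral lborel (snd (ch k) ` piece k) (\<lambda>z. dens k z *\<^sub>R f (chart_inv (ch k) z)) =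
      set_lebesgue_integral lborel (snd (ch k) ` piece k) (\<lambda>z. dens k z *\<^sub>R g (chart_inv (ch k) z))"
    unfolding set_lebesgue_integral_def by (intro Bochner_Integration.integral_cong refl) (auto simp: indicator_def)
qed

lemma vol_integral_mono:
  fixes f g :: "'a \<Rightarrow> real"
  assumes "cont f" "cont g" "\<And>x. x \<in> pts X \<Longrightarrow> f x \<le> g x"
  shows "vol_integral X \<omega> f \<le> vol_integral X \<omega> g"
proof -
  have c: "cont (\<lambda>x. g x - f x)" using assms by (intro continuous_map_diff)
  have "vol_integral X \<omega> (\<lambda>x. f x + (g x - f x)) = vol_integral X \<omega> f + vol_integral X \<omega> (\<lambda>x. g x - f x)"
    by (rule vol_integral_add[OF assms(1) c])
  moreover have "vol_integral X \<omega> (\<lambda>x. g x - f x) \<ge> 0" using assms by (intro vol_integral_nonneg) simp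
  ultimately show ?thesis by simp
qed

text \<open>Continuity of the difference gives equality at every point rather than almost
  everywhere, as the fibrewise equality case of \<open>qform_mono\<close> requires.\<close>

lemma vol_integral_eq_imp_eq:
  fixes f g :: "'a \<Rightarrow> real"
  assumes "cont f" "cont g" "\<And>x. x \<in> pts X \<Longrightarrow> f x \<le> g x"
    and eq: "vol_integral X \<omega> f = vol_integral X \<omega> g" and x: "x \<in> pts X"
  shows "f x = g x"
proof (rule ccontr)
  assume ne: "f x \<noteq> g x"
  have c: "cont (\<lambda>x. g x - f x)" using assms by (intro continuous_map_diff)
  have "vol_integral X \<omega> (\<lambda>x. f x + (g x - f x)) = vol_integral X \<omega> f + vol_integral X \<omega> (\<lambda>x. g x - f x)"
    by (rule vol_integral_add[OF assms(1) c])
  moreover have "vol_integral X \<omega> (\<lambda>x. g x - f x) > 0"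
    using assms(3)[OF x] ne by (intro vol_integral_pos[OF c _ x]) (auto simp: assms(3))
  ultimately show False using eq by simp
qed

lemma Vol_pos: "x \<in> pts X \<Longrightarrow> Vol X \<omega> > 0"
  unfolding Vol_def by (rule vol_integral_pos[where x = x]) auto

end

section \<open>Complex differentiability at a point\<close>

text \<open>Pointwise form of \<open>holo_on\<close>, suited to coefficients whose formula holds
  only near the point in question, such as a quotient by a determinant.\<close>

definition cdiff :: "(complex^'n \<Rightarrow> complex) \<Rightarrow> complex^'n \<Rightarrow> bool" where
  "cdiff f z \<longleftrightarrow> (\<exists>f'. (f has_derivative f') (at z) \<and> (\<forall>c v. f' (c *s v) = c * f' v))"

lemma holo_on_cdiff: "holo_on f S \<longleftrightarrow> (\<forall>z\<in>S. cdiff f z)"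
  by (simp add: holo_on_def cdiff_def)

lemma cdiff_const: "cdiff (\<lambda>z. c) z"
  unfolding cdiff_def by (rule exI[of _ "\<lambda>v. 0"]) simp

lemma cdiff_add:
  assumes "cdiff f z" "cdiff g z"
  shows "cdiff (\<lambda>z. f z + g z) z"
proof -
  obtain f' g' where "(f has_derivative f') (at z)" "\<forall>c v. f' (c *s v) = c * f' v"
    "(g has_derivative g') (at z)" "\<forall>c v. g' (c *s v) = c * g' v" using assms unfolding cdiff_def by blast
  then show ?thesis unfolding cdiff_def
    by (intro exI[of _ "\<lambda>v. f' v + g' v"]) (auto intro: has_derivative_add simp: distrib_left)
qed

lemma cdiff_mult:
  assumes "cdiff f z" "cdiff g z"
  shows "cdiff (\<lambda>z. f z * g z) z"
proof -
  obtain f' g' where "(f has_derivative f') (at z)" "\<forall>c v. f' (c *s v) = c * f' v"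
    "(g has_derivative g') (at z)" "\<forall>c v. g' (c *s v) = c * g' v" using assms unfolding cdiff_def by blast
  then show ?thesis unfolding cdiff_def
    by (intro exI[of _ "\<lambda>v. f z * g' v + f' v * g z"]) (auto intro: has_derivative_mult simp: distrib_left)
qed

lemma cdiff_inverse:
  assumes "cdiff f z" "f z \<noteq> 0"
  shows "cdiff (\<lambda>z. inverse (f z)) z"
proof -
  obtain f' where f': "(f has_derivative f') (at z)" "\<forall>c v. f' (c *s v) = c * f' v"
    using assms unfolding cdiff_def by blast
  have "((\<lambda>z. inverse (f z)) has_derivative (\<lambda>v. - (inverse (f z) * f' v * inverse (f z)))) (at z)"
    by (rule Deriv.has_derivative_inverse) (use assms(2) f' in auto)
  then show ?thesis unfolding cdiff_def
    by (intro exI[of _ "\<lambda>v. - (inverse (f z) * f' v * inverse (f z))"]) (simp add: f')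
qed

lemma cdiff_sum: "(\<And>i. i \<in> I \<Longrightarrow> cdiff (f i) z) \<Longrightarrow> cdiff (\<lambda>z. \<Sum>i\<in>I. f i z) z"
  by (induction I rule: infinite_finite_induct) (auto intro: cdiff_const cdiff_add)

lemma cdiff_prod: "(\<And>i. i \<in> I \<Longrightarrow> cdiff (f i) z) \<Longrightarrow> cdiff (\<lambda>z. \<Prod>i\<in>I. f i z) z"
  by (induction I rule: infinite_finite_induct) (auto intro: cdiff_const cdiff_mult)

lemma cdiff_cong:
  assumes "open S" "z \<in> S" "\<And>w. w \<in> S \<Longrightarrow> f w = g w" "cdiff f z"
  shows "cdiff g z"
  using assms(4) unfolding cdiff_def
  by (metis (no_types, lifting) assms(1-3) has_derivative_transform_within_open)

lemma cdiff_det: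
  fixes A :: "complex^'n \<Rightarrow> complex^'m^'m"
  assumes "\<And>i j. cdiff (\<lambda>z. A z $ i $ j) z"
  shows "cdiff (\<lambda>z. det (A z)) z"
  unfolding det_def by (intro cdiff_sum cdiff_mult cdiff_prod cdiff_const assms)

lemma cdiff_continuous: "cdiff f z \<Longrightarrow> continuous (at z) f"
  unfolding cdiff_def using has_derivative_continuous by blast

text \<open>Near z the matrix \<open>M\<close> is invertible, so A = N M^(-1) there, with the
  inverse written by Cramer's rule. Differentiability of \<open>M\<close> throughout S makes the
  locus where det M is nonzero open.\<close>

lemma cdiff_matrix_solve:
  fixes A M N :: "complex^'n \<Rightarrow> complex^'m^'m"
  assumes S: "open S" "z \<in> S" and eq: "\<And>w. w \<in> S \<Longrightarrow> A w ** M w = N w"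
    and M: "\<And>i j w. w \<in> S \<Longrightarrow> cdiff (\<lambda>z. M z $ i $ j) w" and N: "\<And>i j. cdiff (\<lambda>z. N z $ i $ j) z" and inv: "det (M z) \<noteq> 0"
  shows "cdiff (\<lambda>z. A z $ i $ j) z"
proof -
  have "continuous_on S (\<lambda>w. det (M w))"
    using cdiff_continuous[OF cdiff_det[OF M]] by (intro continuous_at_imp_continuous_on) auto
  then have oS: "open (S \<inter> (\<lambda>w. det (M w)) -` (- {0}))"
    using S(1) by (rule continuous_open_preimage) auto
  let ?S = "S \<inter> (\<lambda>w. det (M w)) -` (- {0})"
  have zS: "z \<in> ?S" using S inv by simp
  let ?C = "\<lambda>k w. (\<chi> p q. if q = k then (if p = j then 1 else 0) else M w $ p $ q) :: complex^'m^'m"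
  show ?thesis
  proof (rule cdiff_cong[OF oS zS])
    fix w assume w: "w \<in> ?S"
    then have "invertible (M w)" by (simp add: invertible_det_nz)
    then obtain B where B: "M w ** B = mat 1" unfolding invertible_def by blast
    have "A w = N w ** B"
      using eq[of w] w B by (metis IntD1 matrix_mul_assoc matrix_mul_rid)
    then have "A w $ i $ j = (\<Sum>k\<in>UNIV. N w $ i $ k * B $ k $ j)" by (simp add: matrix_matrix_mult_def)
    also have "\<dots> = (\<Sum>k\<in>UNIV. N w $ i $ k * (det (?C k w) * inverse (det (M w))))"
      using matrix_inv_entry(1)[OF B] by (simp add: divide_inverse)
    finally show "(\<Sum>k\<in>UNIV. N w $ i $ k * (det (?C k w) * inverse (det (M w)))) = A w $ i $ j" by simp
  next
    have "cdiff (\<lambda>w. ?C k w $ p $ q) z" for k p q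
      using M[OF S(2), of p q] cdiff_const by (cases "q = k") auto
    then show "cdiff (\<lambda>w. \<Sum>k\<in>UNIV. N w $ i $ k * (det (?C k w) * inverse (det (M w)))) z"
      by (intro cdiff_sum cdiff_mult cdiff_inverse cdiff_det N M S inv)
  qed
qed

section \<open>Sections of holomorphic bundles and Hermitian metrics\<close>

text \<open>\<open>ex_basis\<close> carries the finite dimension of the space of sections. In the
  end the balanced metric supplies it, since its definition contains an orthonormal basis.\<close>

locale hol_bundle = compact_kaehler_manifold X \<omega>
  for X :: "('a, 'n::finite) cmfd" and \<omega> +
  fixes E :: "('a, 'v::ab_group_add, 'r::finite) vbundle"
  assumes hvb: "holomorphic_vector_bundle X E"
    and gen: "globally_generated X E"
    and ex_basis: "\<exists>bs. is_basis (sec_scl E) (H0 X E) bs"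
begin

sublocale V: vector_space "scl E"
  using hvb by (simp add: holomorphic_vector_bundle_def)

lemma fibre_subspace: "x \<in> pts X \<Longrightarrow> V.subspace (fibre E x)"
  using hvb by (simp add: holomorphic_vector_bundle_def)

lemma triv_cover: "x \<in> pts X \<Longrightarrow> \<exists>(U, \<theta>)\<in>trivs E. x \<in> U"
proof -
  have "(\<Union>(U, \<theta>)\<in>trivs E. U) = pts X" using hvb unfolding holomorphic_vector_bundle_def by blast
  then show "x \<in> pts X \<Longrightarrow> \<exists>(U, \<theta>)\<in>trivs E. x \<in> U" by blast
qed

lemma
  assumes "(U, \<theta>) \<in> trivs E"
  shows triv_openin: "openin (topo X) U"
    and triv_linear: "\<And>x. x \<in> U \<Longrightarrow> clinear_on (scl E) (fibre E x) (*s) (\<theta> x)"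
    and triv_bij: "\<And>x. x \<in> U \<Longrightarrow> bij_betw (\<theta> x) (fibre E x) UNIV"
  using hvb assms unfolding holomorphic_vector_bundle_def by blast+

lemma triv_pts: "(U, \<theta>) \<in> trivs E \<Longrightarrow> x \<in> U \<Longrightarrow> x \<in> pts X"
  using triv_openin openin_subset by blast

lemma
  assumes t: "(U, \<theta>) \<in> trivs E" "x \<in> U"
  shows triv_add: "\<And>u v. u \<in> fibre E x \<Longrightarrow> v \<in> fibre E x \<Longrightarrow> \<theta> x (u + v) = \<theta> x u + \<theta> x v"
    and triv_scale: "\<And>c u. u \<in> fibre E x \<Longrightarrow> \<theta> x (scl E c u) = c *s \<theta> x u"
  using triv_linear[OF t] unfolding clinear_on_def by blast+

lemma triv_sum:
  assumes t: "(U, \<theta>) \<in> trivs E" "x \<in> U" and f: "\<And>i. i \<in> I \<Longrightarrow> f i \<in> fibre E x"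
  shows "\<theta> x (sum f I) = (\<Sum>i\<in>I. \<theta> x (f i))"
  using f
proof (induction I rule: infinite_finite_induct)
  case (insert i I)
  then have "sum f I \<in> fibre E x" by (intro V.subspace_sum fibre_subspace triv_pts[OF t]) auto
  then show ?case using insert by (simp add: triv_add[OF t])
next
  case empty
  have "0 \<in> fibre E x" by (rule V.subspace_0[OF fibre_subspace[OF triv_pts[OF t]]])
  then show ?case using triv_scale[OF t, of 0 0] by simp
next
  case (infinite A)
  have "0 \<in> fibre E x" by (rule V.subspace_0[OF fibre_subspace[OF triv_pts[OF t]]])
  then show ?case using triv_scale[OF t, of 0 0] infinite by simp
qed

lemma
  assumes t: "(U, \<theta>) \<in> trivs E" "x \<in> U"
  shows frame_in: "frame E \<theta> x j \<in> fibre E x" and triv_frame: "\<theta> x (frame E \<theta> x j) = axis j 1"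
proof -
  have "axis j 1 \<in> \<theta> x ` fibre E x" using triv_bij[OF t] by (simp add: bij_betw_def)
  then show "frame E \<theta> x j \<in> fibre E x" "\<theta> x (frame E \<theta> x j) = axis j 1"
    unfolding frame_def by (rule inv_into_into, rule f_inv_into_f)
qed

lemma frame_expand:
  assumes t: "(U, \<theta>) \<in> trivs E" "x \<in> U" and u: "u \<in> fibre E x"
  shows "(\<Sum>j\<in>UNIV. scl E (\<theta> x u $ j) (frame E \<theta> x j)) = u"
proof -
  let ?s = "\<Sum>j\<in>UNIV. scl E (\<theta> x u $ j) (frame E \<theta> x j)"
  have fs: "scl E c (frame E \<theta> x j) \<in> fibre E x" for c j
    by (intro V.subspace_scale fibre_subspace triv_pts[OF t] frame_in[OF t])
  have "\<theta> x ?s = (\<Sum>j\<in>UNIV. \<theta> x u $ j *s axis j 1)"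
    by (simp add: triv_sum[OF t fs] triv_scale[OF t frame_in[OF t]] triv_frame[OF t])
  also have "\<dots> = \<theta> x u" by (simp add: vec_eq_iff axis_def if_distrib cong: if_cong)
  finally have "\<theta> x ?s = \<theta> x u" .
  moreover have "?s \<in> fibre E x" by (intro V.subspace_sum fibre_subspace triv_pts[OF t] fs)
  ultimately show ?thesis using triv_bij[OF t] u unfolding bij_betw_def inj_on_def by blast
qed

lemma fibre_fd_space:
  assumes "x \<in> pts X"
  shows "fd_space (scl E) (fibre E x)"
proof
  show "V.subspace (fibre E x)" by (rule fibre_subspace[OF assms])
  obtain U \<theta> where t: "(U, \<theta>) \<in> trivs E" "x \<in> U" using triv_cover[OF assms] by blast
  have "u \<in> V.span (frame E \<theta> x ` UNIV)" if "u \<in> fibre E x" for u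
  proof -
    have "(\<Sum>j\<in>UNIV. scl E (\<theta> x u $ j) (frame E \<theta> x j)) \<in> V.span (frame E \<theta> x ` UNIV)"
      by (intro V.span_sum V.span_scale V.span_base) auto
    then show ?thesis unfolding frame_expand[OF t that] .
  qed
  then show "\<exists>B. finite B \<and> fibre E x \<subseteq> V.span B"
    by (intro exI[of _ "frame E \<theta> x ` UNIV"]) auto
qed

lemma vector_space_sections: "vector_space (sec_scl E)"
  by unfold_locales (auto simp: sec_scl_def fun_eq_iff V.scale_right_distrib V.scale_left_distrib)

lemma
  assumes "s \<in> H0 X E"
  shows section_in: "\<And>x. x \<in> pts X \<Longrightarrow> s x \<in> fibre E x" and section_outside: "\<And>x. x \<notin> pts X \<Longrightarrow> s x = 0"
    and section_holo: "\<And>U \<theta> c i. (U, \<theta>) \<in> trivs E \<Longrightarrow> c \<in> atlas X \<Longrightarrow>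
      holo_on (\<lambda>z. \<theta> (chart_inv c z) (s (chart_inv c z)) $ i) (snd c ` (fst c \<inter> U))"
  using assms unfolding H0_def by blast+

lemma overlap_open:
  "(U, \<theta>) \<in> trivs E \<Longrightarrow> c \<in> atlas X \<Longrightarrow> open (snd c ` (fst c \<inter> U))"
  by (intro chart_open_subset openin_Int chart_openin triv_openin) auto

lemma overlap_in:
  assumes "c \<in> atlas X" "z \<in> snd c ` (fst c \<inter> U)"
  shows "chart_inv c z \<in> U" "chart_inv c z \<in> fst c"
  using chart_inv_in[OF assms(2) _ assms(1)] by auto

lemma sectionI:
  fixes s :: "'a \<Rightarrow> 'v"
  assumes "\<And>x. x \<in> pts X \<Longrightarrow> s x \<in> fibre E x" "\<And>x. x \<notin> pts X \<Longrightarrow> s x = 0"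
    and "\<And>U \<theta> c i z. (U, \<theta>) \<in> trivs E \<Longrightarrow> c \<in> atlas X \<Longrightarrow> z \<in> snd c ` (fst c \<inter> U) \<Longrightarrow>
      \<exists>f. cdiff f z \<and> (\<forall>w\<in>snd c ` (fst c \<inter> U). f w = \<theta> (chart_inv c w) (s (chart_inv c w)) $ i)"
  shows "s \<in> H0 X E"
proof -
  have "holo_on (\<lambda>z. \<theta> (chart_inv c z) (s (chart_inv c z)) $ i) (snd c ` (fst c \<inter> U))"
    if t: "(U, \<theta>) \<in> trivs E" and c: "c \<in> atlas X"
    for U c i and \<theta> :: "'a \<Rightarrow> 'v \<Rightarrow> complex^'r"
    unfolding holo_on_cdiff
  proof
    fix z assume z: "z \<in> snd c ` (fst c \<inter> U)"
    obtain f where f: "cdiff f z" "\<forall>w\<in>snd c ` (fst c \<inter> U). f w = \<theta> (chart_inv c w) (s (chart_inv c w)) $ i"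
      using assms(3)[OF t c z, of i] by (elim exE conjE)
    show "cdiff (\<lambda>z. \<theta> (chart_inv c z) (s (chart_inv c z)) $ i) z"
      by (rule cdiff_cong[OF overlap_open[OF t c] z bspec[OF f(2)] f(1)])
  qed
  then show ?thesis unfolding H0_def using assms(1,2) by blast
qed

lemma section_cdiff:
  fixes \<theta> :: "'a \<Rightarrow> 'v \<Rightarrow> complex^'r"
  assumes "s \<in> H0 X E" "(U, \<theta>) \<in> trivs E" "c \<in> atlas X" "z \<in> snd c ` (fst c \<inter> U)"
  shows "cdiff (\<lambda>z. \<theta> (chart_inv c z) (s (chart_inv c z)) $ i) z"
  by (rule bspec[OF section_holo[OF assms(1-3), unfolded holo_on_cdiff] assms(4)])

lemma sections_subspace: "module.subspace (sec_scl E) (H0 X E)"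
proof -
  interpret S: vector_space "sec_scl E" by (rule vector_space_sections)
  show ?thesis
    unfolding S.subspace_def
  proof (intro conjI ballI allI)
    show "0 \<in> H0 X E"
    proof (rule sectionI)
      fix U c i z and \<theta> :: "'a \<Rightarrow> 'v \<Rightarrow> complex^'r"
      assume t: "(U, \<theta>) \<in> trivs E" and c: "c \<in> atlas X" and "z \<in> snd c ` (fst c \<inter> U)"
      have "\<theta> x 0 = 0" if x: "x \<in> U" for x using triv_sum[OF t x, of "{}" "\<lambda>_. 0"] by simp
      then show "\<exists>f. cdiff f z \<and> (\<forall>w\<in>snd c ` (fst c \<inter> U). f w = \<theta> (chart_inv c w) (0 (chart_inv c w)) $ i)"
        using overlap_in[OF c] by (intro exI[of _ "\<lambda>_. 0"]) (simp add: cdiff_const del: image_Int)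
    qed (simp_all add: V.subspace_0[OF fibre_subspace])
    fix s b assume s: "s \<in> H0 X E"
    show "sec_scl E b s \<in> H0 X E"
    proof (rule sectionI)
      fix U c i z and \<theta> :: "'a \<Rightarrow> 'v \<Rightarrow> complex^'r"
      assume t: "(U, \<theta>) \<in> trivs E" and c: "c \<in> atlas X" and z: "z \<in> snd c ` (fst c \<inter> U)"
      show "\<exists>f. cdiff f z \<and> (\<forall>w\<in>snd c ` (fst c \<inter> U). f w = \<theta> (chart_inv c w) (sec_scl E b s (chart_inv c w)) $ i)"
      proof (intro exI conjI ballI)
        show "cdiff (\<lambda>w. b * \<theta> (chart_inv c w) (s (chart_inv c w)) $ i) z"
          by (intro cdiff_mult cdiff_const section_cdiff[OF s t c z])
      qed (use overlap_in[OF c] triv_pts[OF t] s in \<open>simp add: triv_scale[OF t] section_in sec_scl_def\<close>)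
    qed (use s in \<open>simp_all add: sec_scl_def V.subspace_scale[OF fibre_subspace] section_in section_outside\<close>)
    fix t assume t: "t \<in> H0 X E"
    show "s + t \<in> H0 X E"
    proof (rule sectionI)
      fix U c i z and \<theta> :: "'a \<Rightarrow> 'v \<Rightarrow> complex^'r"
      assume tr: "(U, \<theta>) \<in> trivs E" and c: "c \<in> atlas X" and z: "z \<in> snd c ` (fst c \<inter> U)"
      show "\<exists>f. cdiff f z \<and> (\<forall>w\<in>snd c ` (fst c \<inter> U). f w = \<theta> (chart_inv c w) ((s + t) (chart_inv c w)) $ i)"
      proof (intro exI conjI ballI)
        show "cdiff (\<lambda>w. \<theta> (chart_inv c w) (s (chart_inv c w)) $ i + \<theta> (chart_inv c w) (t (chart_inv c w)) $ i) z"
          by (intro cdiff_add section_cdiff[OF s tr c z] section_cdiff[OF t tr c z])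
      qed (use overlap_in[OF c] triv_pts[OF tr] s t in \<open>simp add: triv_add[OF tr] section_in\<close>)
    qed (use s t in \<open>simp_all add: V.subspace_add[OF fibre_subspace] section_in section_outside\<close>)
  qed
qed

sublocale S: fd_space "sec_scl E" "H0 X E"
proof -
  interpret S: vector_space "sec_scl E" by (rule vector_space_sections)
  show "fd_space (sec_scl E) (H0 X E)"
  proof
    show "S.subspace (H0 X E)" by (rule sections_subspace)
    show "\<exists>B. finite B \<and> H0 X E \<subseteq> S.span B"
      using ex_basis unfolding is_basis_def by blast
  qed
qed

abbreviation (input) ev :: "'a \<Rightarrow> ('a \<Rightarrow> 'v) \<Rightarrow> 'v" where "ev x \<equiv> \<lambda>s. s x"

lemma evaluation: "evaluation (sec_scl E) (H0 X E) (scl E) (ev x)"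
  by unfold_locales (simp add: clinear_on_def sec_scl_def)

lemma ev_range: "x \<in> pts X \<Longrightarrow> ev x ` H0 X E = fibre E x"
  using gen by (simp add: globally_generated_def)

lemma metric_frame_expand:
  assumes h: "hermitian_inner (scl E) (fibre E x) h" and t: "(U, \<theta>) \<in> trivs E" "x \<in> U"
    and u: "u \<in> fibre E x" and v: "v \<in> fibre E x"
  shows "h u v = (\<Sum>i\<in>UNIV. \<Sum>j\<in>UNIV. \<theta> x u $ i * (cnj (\<theta> x v $ j) * h (frame E \<theta> x i) (frame E \<theta> x j)))"
proof -
  interpret F: fd_space "scl E" "fibre E x" by (rule fibre_fd_space[OF triv_pts[OF t]])
  note hf = F.herm_hform[OF h]
  have "h (\<Sum>i\<in>UNIV. scl E (\<theta> x u $ i) (frame E \<theta> x i)) v = (\<Sum>i\<in>UNIV. \<theta> x u $ i * h (frame E \<theta> x i) v)"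
    by (rule F.hform_sum[OF hf frame_in[OF t] v])
  also have "\<dots> = (\<Sum>i\<in>UNIV. \<Sum>j\<in>UNIV. \<theta> x u $ i * (cnj (\<theta> x v $ j) * h (frame E \<theta> x i) (frame E \<theta> x j)))"
  proof (intro sum.cong refl)
    fix i :: 'r
    have "h (frame E \<theta> x i) (\<Sum>j\<in>UNIV. scl E (\<theta> x v $ j) (frame E \<theta> x j)) =
        (\<Sum>j\<in>UNIV. cnj (\<theta> x v $ j) * h (frame E \<theta> x i) (frame E \<theta> x j))"
      by (rule F.hform_sum_right[OF hf frame_in[OF t] frame_in[OF t]])
    then show "\<theta> x u $ i * h (frame E \<theta> x i) v = (\<Sum>j\<in>UNIV. \<theta> x u $ i * (cnj (\<theta> x v $ j) * h (frame E \<theta> x i) (frame E \<theta> x j)))"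
      by (simp add: frame_expand[OF t v] sum_distrib_left)
  qed
  finally show ?thesis by (simp add: frame_expand[OF t u])
qed

lemma metric_herm: "h \<in> K_space X E \<Longrightarrow> x \<in> pts X \<Longrightarrow> hermitian_inner (scl E) (fibre E x) (h x)"
  by (simp add: K_space_def)

text \<open>In a local frame the function is a polynomial in the coordinates of the sections, their
  conjugates and the smooth Gram entries of h.\<close>

lemma metric_cont:
  assumes h: "h \<in> K_space X E" and s: "s \<in> H0 X E" "t \<in> H0 X E"
  shows "cont (\<lambda>x. h x (s x) (t x))"
proof (rule cont_localI)
  fix x assume x: "x \<in> pts X"
  obtain c where c: "c \<in> atlas X" "x \<in> fst c" using atlas_cover[OF x] by blast
  obtain U \<theta> where tr: "(U, \<theta>) \<in> trivs E" "x \<in> U" using triv_cover[OF x] by blast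
  let ?W = "fst c \<inter> U"
  let ?y = "chart_inv c"
  have eq: "h (?y z) (s (?y z)) (t (?y z)) = (\<Sum>i\<in>UNIV. \<Sum>j\<in>UNIV. \<theta> (?y z) (s (?y z)) $ i *
      (cnj (\<theta> (?y z) (t (?y z)) $ j) * h (?y z) (frame E \<theta> (?y z) i) (frame E \<theta> (?y z) j)))"
    if z: "z \<in> snd c ` ?W" for z
    using overlap_in[OF c(1) z] triv_pts[OF tr(1)] s
    by (intro metric_frame_expand metric_herm[OF h] section_in) (use tr(1) in auto)
  have c1: "continuous_on (snd c ` ?W) (\<lambda>z. \<theta> (?y z) (s (?y z)) $ i)" if "s \<in> H0 X E" for s i
    by (intro smooth_on_continuous_on holo_on_imp_smooth_on overlap_open[OF tr(1) c(1)] section_holo[OF that tr(1) c(1)])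
  have c2: "continuous_on (snd c ` ?W) (\<lambda>z. h (?y z) (frame E \<theta> (?y z) i) (frame E \<theta> (?y z) j))" for i j
    using h tr(1) c(1) unfolding K_space_def Let_def by (intro smooth_on_continuous_on) blast
  have "continuous_on (snd c ` ?W) (\<lambda>z. \<Sum>i\<in>UNIV. \<Sum>j\<in>UNIV. \<theta> (?y z) (s (?y z)) $ i *
      (cnj (\<theta> (?y z) (t (?y z)) $ j) * h (?y z) (frame E \<theta> (?y z) i) (frame E \<theta> (?y z) j)))"
    by (intro continuous_intros c1[OF s(1)] c1[OF s(2)] c2)
  then have "continuous_on (snd c ` ?W) (\<lambda>z. h (?y z) (s (?y z)) (t (?y z)))"
    by (rule continuous_on_eq) (simp add: eq)
  moreover have "openin (topo X) ?W" by (intro openin_Int chart_openin[OF c(1)] triv_openin[OF tr(1)])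
  ultimately show "\<exists>c\<in>atlas X. \<exists>W. openin (topo X) W \<and> x \<in> W \<and> W \<subseteq> fst c \<and>
      continuous_on (snd c ` W) (\<lambda>z. h (chart_inv c z) (s (chart_inv c z)) (t (chart_inv c z)))"
    using c tr by (intro bexI[of _ c] exI[of _ ?W]) auto
qed

section \<open>The maps \<open>Hilb\<close> and \<open>FS\<close>\<close>

definition hconst :: real where "hconst = real (h0 X E) / (Vol X \<omega> * real CARD('r))"

lemma Hilb_apply:
  "s \<in> H0 X E \<Longrightarrow> t \<in> H0 X E \<Longrightarrow> Hilb X \<omega> E h s t = of_real hconst * vol_integral X \<omega> (\<lambda>x. h x (s x) (t x))"
  by (simp add: Hilb_def L2_inner_def hconst_def)

lemma h0_eq: "is_basis (sec_scl E) (H0 X E) bs \<Longrightarrow> h0 X E = length bs"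
  using S.basis_length by (simp add: h0_def)

lemma nonzero_section:
  assumes "s \<in> H0 X E" "s \<noteq> 0"
  obtains x where "x \<in> pts X" "s x \<noteq> 0"
  using assms section_outside[OF assms(1)] by (auto simp: fun_eq_iff)

text \<open>A nonzero section yields a point of X, hence positive volume, and makes N
  positive.\<close>

lemma hconst_pos:
  assumes "s \<in> H0 X E" "s \<noteq> 0"
  shows "hconst > 0"
proof -
  obtain x where x: "x \<in> pts X" using nonzero_section[OF assms] by blast
  obtain bs where bs: "is_basis (sec_scl E) (H0 X E) bs" using ex_basis by blast
  have "bs \<noteq> []"
  proof
    assume "bs = []"
    then have "H0 X E = {0}" using bs by (simp add: is_basis_def)
    then show False using assms by auto
  qed
  then have "h0 X E > 0" using h0_eq[OF bs] by simp
  then show ?thesis using Vol_pos[OF x] by (simp add: hconst_def)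
qed

lemma Re_Hilb:
  assumes h: "h \<in> K_space X E" and s: "s \<in> H0 X E"
  shows "Re (Hilb X \<omega> E h s s) = hconst * vol_integral X \<omega> (\<lambda>x. Re (h x (s x) (s x)))"
  using vol_integral_bounded_linear[OF bounded_linear_Re metric_cont[OF h s s]] by (simp add: Hilb_apply s)

lemma metric_nonneg:
  assumes h: "h \<in> K_space X E" and s: "s \<in> H0 X E" and x: "x \<in> pts X"
  shows "Re (h x (s x) (s x)) \<ge> 0"
  using fd_space.herm_nonneg[OF fibre_fd_space[OF x] metric_herm[OF h x] section_in[OF s x]] .

lemma Re_metric_cont:
  assumes h: "h \<in> K_space X E" and s: "s \<in> H0 X E"
  shows "cont (\<lambda>x. Re (h x (s x) (s x)))"
proof -
  have "continuous_map euclidean euclidean Re" by (simp add: continuous_on_Re)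
  from continuous_map_compose[OF metric_cont[OF h s s] this] show ?thesis by (simp add: o_def)
qed

lemma Hilb_herm:
  assumes h: "h \<in> K_space X E"
  shows "S.herm (Hilb X \<omega> E h)"
proof (rule S.hermI[OF S.hformI])
  fix s t u c assume s: "s \<in> H0 X E" and u: "u \<in> H0 X E"
  note c = metric_cont[OF h s u]
  have cl: "h x (scl E b (s x)) (u x) = b * h x (s x) (u x)" and cc: "h x (u x) (s x) = cnj (h x (s x) (u x))"
    if x: "x \<in> pts X" for x b
    using fd_space.hform_scale[OF fibre_fd_space[OF x] fd_space.herm_hform[OF fibre_fd_space[OF x] metric_herm[OF h x]]
        section_in[OF s x] section_in[OF u x]]
      fd_space.hform_cnj[OF fibre_fd_space[OF x] fd_space.herm_hform[OF fibre_fd_space[OF x] metric_herm[OF h x]]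
        section_in[OF s x] section_in[OF u x]] by auto
  have "vol_integral X \<omega> (\<lambda>x. h x (sec_scl E c s x) (u x)) = vol_integral X \<omega> (\<lambda>x. c * h x (s x) (u x))"
    by (rule vol_integral_cong) (simp add: sec_scl_def cl)
  then show "Hilb X \<omega> E h (sec_scl E c s) u = c * Hilb X \<omega> E h s u"
    using vol_integral_bounded_linear[OF bounded_linear_mult_right c, of c] s u S.S_scale[OF s, of c]
    by (simp add: Hilb_apply)
  have "vol_integral X \<omega> (\<lambda>x. h x (u x) (s x)) = vol_integral X \<omega> (\<lambda>x. cnj (h x (s x) (u x)))"
    by (rule vol_integral_cong) (rule cc)
  then show "Hilb X \<omega> E h u s = cnj (Hilb X \<omega> E h s u)"
    using vol_integral_bounded_linear[OF bounded_linear_cnj c] s u by (simp add: Hilb_apply)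
  assume t: "t \<in> H0 X E"
  have ca: "h x (s x + t x) (u x) = h x (s x) (u x) + h x (t x) (u x)" if x: "x \<in> pts X" for x
    using fd_space.hform_add[OF fibre_fd_space[OF x] fd_space.herm_hform[OF fibre_fd_space[OF x] metric_herm[OF h x]]
        section_in[OF s x] section_in[OF t x] section_in[OF u x]] .
  have "vol_integral X \<omega> (\<lambda>x. h x ((s + t) x) (u x)) = vol_integral X \<omega> (\<lambda>x. h x (s x) (u x) + h x (t x) (u x))"
    by (rule vol_integral_cong) (simp add: ca)
  then show "Hilb X \<omega> E h (s + t) u = Hilb X \<omega> E h s u + Hilb X \<omega> E h t u"
    using vol_integral_add[OF c metric_cont[OF h t u]] s t u S.S_add[OF s t]
    by (simp add: Hilb_apply distrib_left)
next
  fix s assume s: "s \<in> H0 X E" "s \<noteq> 0"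
  obtain x where x: "x \<in> pts X" "s x \<noteq> 0" using nonzero_section[OF s] .
  have "Re (h x (s x) (s x)) > 0"
    using fd_space.herm_pos[OF fibre_fd_space[OF x(1)] metric_herm[OF h x(1)] section_in[OF s(1) x(1)] x(2)] .
  then have "vol_integral X \<omega> (\<lambda>x. Re (h x (s x) (s x))) > 0"
    by (intro vol_integral_pos[OF Re_metric_cont[OF h s(1)] metric_nonneg[OF h s(1)] x(1)])
  then show "Re (Hilb X \<omega> E h s s) > 0" using hconst_pos[OF s] by (simp add: Re_Hilb[OF h s(1)])
qed (auto simp: Hilb_def L2_inner_def)

text \<open>Explicit candidate for \<open>FS\<close>, which is given by a description only;
  \<open>FS_eq\<close> identifies the two on inner products. Off X the value is the one fixed by
  \<open>K_space\<close>.\<close>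

definition fs_metric :: "('a, 'v) sec_form \<Rightarrow> 'a \<Rightarrow> 'v \<Rightarrow> 'v \<Rightarrow> complex" where
  "fs_metric H = (\<lambda>x. if x \<in> pts X then S.qform H (ev x) else (\<lambda>u v. 0))"

lemma bergman_sum_eq: "bergman_sum E h ss x u = (\<Sum>i<length ss. scl E (h x u ((ss ! i) x)) ((ss ! i) x))"
  by (simp add: bergman_sum_def sum_list_sum_nth atLeast0LessThan)

lemma fs_metric_bergman:
  assumes H: "S.herm H" and ss: "orthonormal_basis (sec_scl E) (H0 X E) H ss" and x: "x \<in> pts X" and u: "u \<in> fibre E x"
  shows "bergman_sum E (fs_metric H) ss x u = u"
  using evaluation.qform_bergman[OF evaluation H S.orthonormal_basis_onb[OF S.herm_hform[OF H] ss], of u x] x u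
  by (simp add: bergman_sum_eq fs_metric_def ev_range)

text \<open>The Bergman identity as a matrix identity: the Gram matrix of h times a matrix built
  from the coordinates of the sections is c times the identity. Both the smoothness of
  \<open>fs_metric\<close> and the trace formula are read off from it.\<close>

lemma bergman_frame:
  assumes t: "(U, \<theta>) \<in> trivs E" "x \<in> U" and h: "hermitian_inner (scl E) (fibre E x) (h x)"
    and ss: "\<And>k. k < length ss \<Longrightarrow> ss ! k \<in> H0 X E"
    and b: "\<And>u. u \<in> fibre E x \<Longrightarrow> bergman_sum E h ss x u = scl E c u"
  shows "(\<Sum>j\<in>UNIV. h x (frame E \<theta> x i) (frame E \<theta> x j) *
      (\<Sum>k<length ss. cnj (\<theta> x ((ss ! k) x) $ j) * \<theta> x ((ss ! k) x) $ l)) = (if i = l then c else 0)"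
proof -
  note x = triv_pts[OF t]
  interpret F: fd_space "scl E" "fibre E x" by (rule fibre_fd_space[OF x])
  let ?e = "frame E \<theta> x" and ?\<sigma> = "\<lambda>k. \<theta> x ((ss ! k) x)"
  let ?B = "\<lambda>i j. h x (?e i) (?e j)"
  have sk: "(ss ! k) x \<in> fibre E x" if "k < length ss" for k by (rule section_in[OF ss[OF that] x])
  have he: "h x (?e i) ((ss ! k) x) = (\<Sum>j\<in>UNIV. cnj (?\<sigma> k $ j) * ?B i j)" if k: "k < length ss" for k
  proof -
    have "h x (?e i) (\<Sum>j\<in>UNIV. scl E (?\<sigma> k $ j) (?e j)) = (\<Sum>j\<in>UNIV. cnj (?\<sigma> k $ j) * h x (?e i) (?e j))"
      by (rule F.hform_sum_right[OF F.herm_hform[OF h] frame_in[OF t] frame_in[OF t]])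
    then show ?thesis by (simp add: frame_expand[OF t sk[OF k]])
  qed
  have "(\<Sum>j\<in>UNIV. ?B i j * (\<Sum>k<length ss. cnj (?\<sigma> k $ j) * ?\<sigma> k $ l)) =
      (\<Sum>j\<in>UNIV. \<Sum>k<length ss. ?B i j * (cnj (?\<sigma> k $ j) * ?\<sigma> k $ l))"
    by (simp add: sum_distrib_left)
  also have "\<dots> = (\<Sum>k<length ss. (\<Sum>j\<in>UNIV. cnj (?\<sigma> k $ j) * ?B i j) * ?\<sigma> k $ l)"
    by (subst sum.swap) (simp add: sum_distrib_left sum_distrib_right mult_ac)
  also have "\<dots> = (\<Sum>k<length ss. h x (?e i) ((ss ! k) x) * ?\<sigma> k $ l)"
    by (intro sum.cong refl) (simp add: he)
  also have "\<dots> = (\<Sum>k<length ss. \<theta> x (scl E (h x (?e i) ((ss ! k) x)) ((ss ! k) x))) $ l"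
    by (simp add: triv_scale[OF t sk])
  also have "(\<Sum>k<length ss. \<theta> x (scl E (h x (?e i) ((ss ! k) x)) ((ss ! k) x))) =
      \<theta> x (\<Sum>k<length ss. scl E (h x (?e i) ((ss ! k) x)) ((ss ! k) x))"
    by (rule triv_sum[OF t, symmetric]) (simp add: F.S_scale sk)
  also have "(\<Sum>k<length ss. scl E (h x (?e i) ((ss ! k) x)) ((ss ! k) x)) = scl E c (?e i)"
    using b[OF frame_in[OF t]] by (simp add: bergman_sum_eq)
  also have "\<theta> x (scl E c (?e i)) $ l = (if i = l then c else 0)"
    by (simp add: triv_frame[OF t] triv_scale[OF t frame_in[OF t]] axis_def)
  finally show ?thesis .
qed

text \<open>The trace of the matrix identity in \<open>bergman_frame\<close>, evaluated once through
  the sections and once as r times c.\<close>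

lemma bergman_trace:
  assumes x: "x \<in> pts X" and h: "hermitian_inner (scl E) (fibre E x) (h x)"
    and ss: "\<And>k. k < length ss \<Longrightarrow> ss ! k \<in> H0 X E"
    and b: "\<And>u. u \<in> fibre E x \<Longrightarrow> bergman_sum E h ss x u = scl E c u"
  shows "(\<Sum>k<length ss. h x ((ss ! k) x) ((ss ! k) x)) = of_nat CARD('r) * c"
proof -
  obtain U \<theta> where t: "(U, \<theta>) \<in> trivs E" "x \<in> U" using triv_cover[OF x] by blast
  let ?e = "frame E \<theta> x" and ?\<sigma> = "\<lambda>k. \<theta> x ((ss ! k) x)"
  have "(\<Sum>k<length ss. h x ((ss ! k) x) ((ss ! k) x)) =
      (\<Sum>k<length ss. \<Sum>i\<in>UNIV. \<Sum>j\<in>UNIV. ?\<sigma> k $ i * (cnj (?\<sigma> k $ j) * h x (?e i) (?e j)))"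
    by (intro sum.cong refl metric_frame_expand[OF h t]) (simp_all add: section_in[OF ss x])
  also have "\<dots> = (\<Sum>i\<in>UNIV. \<Sum>k<length ss. \<Sum>j\<in>UNIV. ?\<sigma> k $ i * (cnj (?\<sigma> k $ j) * h x (?e i) (?e j)))"
    by (rule sum.swap)
  also have "\<dots> = (\<Sum>i\<in>UNIV. \<Sum>j\<in>UNIV. \<Sum>k<length ss. ?\<sigma> k $ i * (cnj (?\<sigma> k $ j) * h x (?e i) (?e j)))"
    by (intro sum.cong refl sum.swap)
  also have "\<dots> = (\<Sum>i\<in>UNIV. \<Sum>j\<in>UNIV. h x (?e i) (?e j) * (\<Sum>k<length ss. cnj (?\<sigma> k $ j) * ?\<sigma> k $ i))"
    by (simp add: sum_distrib_left mult_ac)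
  also have "\<dots> = (\<Sum>i\<in>(UNIV :: 'r set). c)"
    using bergman_frame[OF t h ss b] by simp
  finally show ?thesis by simp
qed

text \<open>Minimal lifts do not visibly depend smoothly on the point. The Bergman identity,
  however, exhibits the Gram matrix of the quotient metric as the inverse of a matrix whose entries
  are sums of products of holomorphic functions and conjugates of such.\<close>

lemma fs_metric_in_K_space:
  assumes H: "S.herm H"
  shows "fs_metric H \<in> K_space X E"
proof -
  have herm: "hermitian_inner (scl E) (fibre E x) (fs_metric H x)" if "x \<in> pts X" for x
    using evaluation.qform_herm[OF evaluation H, of x] that by (simp add: fs_metric_def ev_range)
  obtain ss where ss: "orthonormal_basis (sec_scl E) (H0 X E) H ss" using S.ex_orthonormal_basis[OF H] by blast
  have ssS: "ss ! k \<in> H0 X E" if "k < length ss" for k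
    using S.basis_in[OF _ that] ss by (simp add: orthonormal_basis_def)
  have smooth: "smooth_on (\<lambda>z. fs_metric H (chart_inv c z) (frame E \<theta> (chart_inv c z) i) (frame E \<theta> (chart_inv c z) j))
      (snd c ` (fst c \<inter> U))" if t: "(U, \<theta>) \<in> trivs E" and c: "c \<in> atlas X" for U \<theta> c i j
  proof -
    let ?D = "snd c ` (fst c \<inter> U)" and ?y = "chart_inv c"
    note oD = overlap_open[OF t c]
    define A where "A z = (\<chi> j l. \<Sum>k<length ss. cnj (\<theta> (?y z) ((ss ! k) (?y z)) $ j) * \<theta> (?y z) ((ss ! k) (?y z)) $ l)" for z
    define B where "B z = (\<chi> i j. fs_metric H (?y z) (frame E \<theta> (?y z) i) (frame E \<theta> (?y z) j))" for z
    have "smooth_on (\<lambda>z. \<theta> (?y z) ((ss ! k) (?y z)) $ j) ?D" if "k < length ss" for k j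
      by (intro holo_on_imp_smooth_on oD section_holo[OF ssS[OF that] t c])
    then have smA: "smooth_on (\<lambda>z. A z $ j $ l) ?D" for j l
      unfolding A_def by (simp) (intro smooth_on_sum smooth_on_mult smooth_on_cnj oD; simp)
    have inv: "A z ** B z = mat 1" if z: "z \<in> ?D" for z
    proof -
      let ?x = "?y z"
      have xU: "?x \<in> U" using overlap_in[OF c z] by simp
      note x = triv_pts[OF t xU]
      have "(B z ** A z) $ i $ l = (mat 1 :: complex^'r^'r) $ i $ l" for i l
      proof -
        have b: "bergman_sum E (fs_metric H) ss ?x u = scl E 1 u" if "u \<in> fibre E ?x" for u
          using fs_metric_bergman[OF H ss x that] by simp
        show ?thesis
          using bergman_frame[where h = "fs_metric H" and ss = ss, OF t xU herm[OF x] ssS b, of i l]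
          by (simp add: matrix_matrix_mult_def A_def B_def mat_def)
      qed
      then have "B z ** A z = mat 1" by (simp add: vec_eq_iff)
      then show ?thesis by (simp add: matrix_left_right_inverse)
    qed
    have "smooth_on (\<lambda>z. B z $ i $ j) ?D" by (rule smooth_on_matrix_inverse[OF oD smA inv])
    then show ?thesis by (simp add: B_def)
  qed
  show ?thesis
    unfolding K_space_def Let_def using herm smooth by (auto simp: fs_metric_def)
qed

text \<open>\<open>qform_unique\<close> recovers h in each fibre from the Bergman identity for a
  single orthonormal basis, and \<open>K_space\<close> fixes h off X.\<close>

lemma FS_unique:
  assumes H: "S.herm H" and h: "h \<in> K_space X E" and ss: "orthonormal_basis (sec_scl E) (H0 X E) H ss"
    and b: "\<And>x u. x \<in> pts X \<Longrightarrow> u \<in> fibre E x \<Longrightarrow> bergman_sum E h ss x u = u"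
  shows "h = fs_metric H"
proof
  fix x
  show "h x = fs_metric H x"
  proof (cases "x \<in> pts X")
    case True
    have "h x = S.qform H (ev x)"
      by (rule evaluation.qform_unique[OF evaluation H S.orthonormal_basis_onb[OF S.herm_hform[OF H] ss]])
         (use metric_herm[OF h True] b[OF True] in \<open>simp_all add: ev_range[OF True] bergman_sum_eq\<close>)
    then show ?thesis using True by (simp add: fs_metric_def)
  next
    case False
    then show ?thesis using h by (simp add: fs_metric_def K_space_def)
  qed
qed

lemma FS_eq:
  assumes H: "S.herm H"
  shows "FS X E H = fs_metric H"
  unfolding FS_def
proof (rule the_equality)
  obtain ss where "orthonormal_basis (sec_scl E) (H0 X E) H ss" using S.ex_orthonormal_basis[OF H] by blast
  then show "fs_metric H \<in> K_space X E \<and> (\<exists>ss. orthonormal_basis (sec_scl E) (H0 X E) H ss \<and>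
      (\<forall>x\<in>pts X. \<forall>u\<in>fibre E x. bergman_sum E (fs_metric H) ss x u = u))"
    using fs_metric_in_K_space[OF H] fs_metric_bergman[OF H] by blast
qed (use FS_unique[OF H] in blast)

end

context fd_space
begin

text \<open>Serves the passage between the L2 product and \<open>Hilb\<close>, which differ by the
  factor \<open>hconst\<close>.\<close>

lemma onb_of_scaled_form:
  assumes B: "onb_of G S n e" and G: "hform G" and c: "c > 0"
  shows "onb_of (scaled_form c G) S n (\<lambda>i. sc (of_real (1 / sqrt c)) (e i))"
proof -
  note e = onb_in[OF B]
  let ?k = "complex_of_real (1 / sqrt c)"
  have k: "of_real c * (?k * ?k) = 1" using c by (simp flip: of_real_mult)
  have "scaled_form c G (sc ?k (e i)) (sc ?k (e j)) = of_real c * (?k * ?k) * G (e i) (e j)" if "i < n" "j < n" for i j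
    using that e by (simp add: scaled_form_def hform_scale[OF G] hform_scale_right[OF G] S_scale)
  then have 1: "orthonormal_upto (scaled_form c G) (\<lambda>i. sc ?k (e i)) n"
    using onb_on[OF B] k by (simp add: orthonormal_upto_def)
  have "(\<Sum>i<n. sc (scaled_form c G u (sc ?k (e i))) (sc ?k (e i))) = u" if u: "u \<in> S" for u
  proof -
    have "(\<Sum>i<n. sc (scaled_form c G u (sc ?k (e i))) (sc ?k (e i))) = (\<Sum>i<n. sc (G u (e i)) (e i))"
    proof (intro sum.cong refl)
      fix i assume "i \<in> {..<n}"
      then have "scaled_form c G u (sc ?k (e i)) * ?k = of_real c * (?k * ?k) * G u (e i)"
        using e u by (simp add: scaled_form_def hform_scale_right[OF G])
      then show "sc (scaled_form c G u (sc ?k (e i))) (sc ?k (e i)) = sc (G u (e i)) (e i)"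
        unfolding k by simp
    qed
    then show ?thesis using onb_ex[OF B u] by simp
  qed
  then show ?thesis unfolding onb_of_def using 1 e by (auto intro: S_scale)
qed

end

lemma tendsto_fun_componentwise:
  fixes f :: "'x \<Rightarrow> 'i \<Rightarrow> 'b::topological_space"
  assumes "\<And>i. ((\<lambda>m. f m i) \<longlongrightarrow> l i) F"
  shows "(f \<longlongrightarrow> l) F"
proof -
  have "limitin (product_topology (\<lambda>i::'i. euclidean :: 'b topology) UNIV) f l F"
    unfolding limitin_componentwise using assms by auto
  then show ?thesis by (simp only: euclidean_product_topology limitin_canonical_iff)
qed

section \<open>The map \<open>T\<close>\<close>

context hol_bundle
begin

abbreviation T where "T \<equiv> T_map X \<omega> E"

lemma T_eq: "S.herm H \<Longrightarrow> T H = Hilb X \<omega> E (fs_metric H)"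
  by (simp add: T_map_def FS_eq)

lemma T_herm: "S.herm H \<Longrightarrow> S.herm (T H)"
  by (simp add: T_eq Hilb_herm fs_metric_in_K_space)

lemma Re_T: "S.herm H \<Longrightarrow> s \<in> H0 X E \<Longrightarrow>
    Re (T H s s) = hconst * vol_integral X \<omega> (\<lambda>x. Re (fs_metric H x (s x) (s x)))"
  by (simp add: T_eq Re_Hilb fs_metric_in_K_space)

lemma Re_T_0:
  assumes "S.herm H"
  shows "Re (T H 0 0) = 0"
  using S.hform_0[OF S.herm_hform[OF T_herm[OF assms]] S.S_0] by simp

lemma fs_metric_mono:
  assumes "S.herm H" "S.herm K" "S.form_le K H" "s \<in> H0 X E" "x \<in> pts X"
  shows "Re (fs_metric K x (s x) (s x)) \<le> Re (fs_metric H x (s x) (s x))"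
  using evaluation.qform_mono[OF evaluation assms(1,2,3), of "s x" x] assms(4,5) by (simp add: fs_metric_def)

lemma T_mono:
  assumes "S.herm H" "S.herm K" "S.form_le K H"
  shows "S.form_le (T K) (T H)"
  unfolding S.form_le_def
proof
  fix s assume s: "s \<in> H0 X E"
  show "Re (T K s s) \<le> Re (T H s s)"
  proof (cases "s = 0")
    case True
    then show ?thesis using Re_T_0[OF assms(1)] Re_T_0[OF assms(2)] by simp
  next
    case False
    have "vol_integral X \<omega> (\<lambda>x. Re (fs_metric K x (s x) (s x))) \<le> vol_integral X \<omega> (\<lambda>x. Re (fs_metric H x (s x) (s x)))"
      by (intro vol_integral_mono Re_metric_cont fs_metric_in_K_space fs_metric_mono assms s)
    then show ?thesis using hconst_pos[OF s False] by (simp add: Re_T assms s)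
  qed
qed

lemma T_outside: "s \<notin> H0 X E \<or> t \<notin> H0 X E \<Longrightarrow> T H s t = 0"
  by (auto simp: T_map_def Hilb_def L2_inner_def)

lemma T_homog:
  assumes H: "S.herm H" and c: "c > 0"
  shows "T (S.scaled_form c H) = S.scaled_form c (T H)"
proof (intro ext)
  fix s t
  show "T (S.scaled_form c H) s t = S.scaled_form c (T H) s t"
  proof (cases "s \<in> H0 X E \<and> t \<in> H0 X E")
    case True
    have q: "fs_metric (S.scaled_form c H) x u v = of_real c * fs_metric H x u v" for x u v
      using evaluation.qform_scaled_form[OF evaluation[of x] c, of H u v] by (simp add: fs_metric_def)
    have "vol_integral X \<omega> (\<lambda>x. of_real c * fs_metric H x (s x) (t x)) = of_real c * vol_integral X \<omega> (\<lambda>x. fs_metric H x (s x) (t x))"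
      by (rule vol_integral_bounded_linear[OF bounded_linear_mult_right metric_cont[OF fs_metric_in_K_space[OF H]]]) (use True in auto)
    then show ?thesis
      using True by (simp add: T_eq H S.herm_scaled_form[OF H c] Hilb_apply q S.scaled_form_def[of c "Hilb X \<omega> E (fs_metric H)"])
  next
    case False
    then show ?thesis using T_outside[of s t] by (simp add: S.scaled_form_def)
  qed
qed

abbreviation L where "L H x \<equiv> S.lift H (\<lambda>s. s x)"

text \<open>Since T H = H, membership of s says that two integrals of pointwise ordered continuous
  functions agree. The integrands then agree in every fibre, and \<open>qform_eq_imp_eqset\<close>
  applies.\<close>

lemma lift_in_eqset:
  assumes H: "S.herm H" and fp: "T H = H" and K: "S.herm K" and le: "S.form_le K H"
    and s: "s \<in> S.eqset H (T K)" and x: "x \<in> pts X"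
  shows "L H x (s x) \<in> S.eqset H K"
proof -
  have sH: "s \<in> H0 X E" and eq: "Re (T K s s) = Re (T H s s)" using s fp by (auto simp: S.eqset_def)
  have sx: "s x \<in> (\<lambda>s. s x) ` H0 X E" using sH by blast
  have "Re (fs_metric K x (s x) (s x)) = Re (fs_metric H x (s x) (s x))"
  \<comment> \<open>The zero section is separated because \<open>hconst\<close> is known to be
    positive only in the presence of a nonzero section.\<close>
  proof (cases "s = 0")
    case True
    have "fs_metric G x 0 0 = 0" if "S.herm G" for G
      by (rule fd_space.hform_0[OF fibre_fd_space[OF x] fd_space.herm_hform[OF fibre_fd_space[OF x]
          metric_herm[OF fs_metric_in_K_space[OF that] x]] V.subspace_0[OF fibre_subspace[OF x]]])
    then show ?thesis using True H K by simp
  next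
    case False
    have "vol_integral X \<omega> (\<lambda>x. Re (fs_metric K x (s x) (s x))) = vol_integral X \<omega> (\<lambda>x. Re (fs_metric H x (s x) (s x)))"
      using eq hconst_pos[OF sH False] by (simp add: Re_T H K sH)
    then show ?thesis
      by (rule vol_integral_eq_imp_eq[OF Re_metric_cont[OF fs_metric_in_K_space[OF K] sH] Re_metric_cont[OF fs_metric_in_K_space[OF H] sH]
          fs_metric_mono[OF H K le sH] _ x, rotated])
  qed
  then show ?thesis
    using evaluation.qform_eq_imp_eqset[OF evaluation H K le sx] x by (simp add: fs_metric_def)
qed

text \<open>A fixed point \<open>H\<close> of \<open>T\<close> exhibits every section as an average of the sections
  \<open>L H x (s x)\<close>, which all lie in \<open>eqset H K\<close>.\<close>

lemma eqset_T_subset: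
  assumes H: "S.herm H" and fp: "T H = H" and K: "S.herm K" and le: "S.form_le K H"
  shows "S.eqset H (T K) \<subseteq> S.eqset H K"
proof
  fix s assume s: "s \<in> S.eqset H (T K)"
  let ?W = "S.eqset H K"
  note hf = S.herm_hform[OF H]
  have W: "S.subspace ?W" "?W \<subseteq> H0 X E"
    using S.eqset_subspace[OF hf S.herm_hform[OF K] le] by (auto simp: S.eqset_def)
  have sH: "s \<in> H0 X E" using s by (auto simp: S.eqset_def)
  let ?p = "S.oproj H ?W s"
  have p: "?p \<in> ?W" "\<And>w. w \<in> ?W \<Longrightarrow> H (s - ?p) w = 0"
    using S.oproj_in[OF H W sH] S.oproj_orth[OF H W sH] by auto
  have pH: "?p \<in> H0 X E" using p W by blast
  have dH: "s - ?p \<in> H0 X E" using sH pH by (rule S.S_diff)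
  \<comment> \<open>The average is used weakly, without integrating sections: the component of s
    orthogonal to the null space is orthogonal to each lift, which by adjointness gives zero in each
    fibre, and integration gives orthogonality to s because H is fixed.\<close>
  have q0: "fs_metric H x (s x) ((s - ?p) x) = 0" if x: "x \<in> pts X" for x
  proof -
    have sx: "s x \<in> (\<lambda>s. s x) ` H0 X E" using sH by blast
    have l: "L H x (s x) \<in> ?W" by (rule lift_in_eqset[OF H fp K le s x])
    have "fs_metric H x (s x) ((s - ?p) x) = H (L H x (s x)) (s - ?p)"
    proof -
      have e: "fs_metric H x = S.qform H (\<lambda>s. s x)" using x by (simp add: fs_metric_def)
      show ?thesis unfolding e by (rule evaluation.lift_adjoint[OF evaluation H sx dH, symmetric])
    qed
    also have "\<dots> = cnj (H (s - ?p) (L H x (s x)))"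
      by (rule S.hform_cnj[OF hf dH]) (use l W in blast)
    finally show ?thesis using p(2)[OF l] by simp
  qed
  have "vol_integral X \<omega> (\<lambda>x. fs_metric H x (s x) ((s - ?p) x)) = vol_integral X \<omega> (\<lambda>x. 0)"
    by (rule vol_integral_cong) (rule q0)
  also have "\<dots> = 0" by (simp add: vol_integral_eq set_lebesgue_integral_def)
  finally have "T H s (s - ?p) = 0"
    unfolding T_eq[OF H] Hilb_apply[OF sH dH] by (simp only: mult_zero_right)
  then have s0: "H s (s - ?p) = 0" unfolding fp .
  have "H ?p (s - ?p) = cnj (H (s - ?p) ?p)" by (rule S.hform_cnj[OF hf dH pH])
  then have p0: "H ?p (s - ?p) = 0" using p by simp
  have "H (s - ?p) (s - ?p) = 0"
    using S.hform_diff[OF hf sH pH dH] s0 p0 by simp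
  then have "s - ?p = 0" using S.herm_zero_iff[OF H dH] by simp
  then show "s \<in> ?W" using p(1) by simp
qed

section \<open>Endomorphisms induced by operators on sections\<close>

text \<open>The last clause lets an operator on sections act on values: the kernel of evaluation at
  each point is preserved.\<close>

definition section_op :: "(('a \<Rightarrow> 'v) \<Rightarrow> 'a \<Rightarrow> 'v) \<Rightarrow> bool" where
  "section_op Q \<longleftrightarrow> (\<forall>s\<in>H0 X E. Q s \<in> H0 X E) \<and> (\<forall>s\<in>H0 X E. \<forall>t\<in>H0 X E. Q (s + t) = Q s + Q t) \<and>
     (\<forall>c. \<forall>s\<in>H0 X E. Q (sec_scl E c s) = sec_scl E c (Q s)) \<and>
     (\<forall>x\<in>pts X. \<forall>s\<in>H0 X E. s x = 0 \<longrightarrow> Q s x = 0)"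

lemma section_op_in: "section_op Q \<Longrightarrow> s \<in> H0 X E \<Longrightarrow> Q s \<in> H0 X E"
  and section_op_add: "section_op Q \<Longrightarrow> s \<in> H0 X E \<Longrightarrow> t \<in> H0 X E \<Longrightarrow> Q (s + t) = Q s + Q t"
  and section_op_scale: "section_op Q \<Longrightarrow> s \<in> H0 X E \<Longrightarrow> Q (sec_scl E c s) = sec_scl E c (Q s)"
  and section_op_vanish: "section_op Q \<Longrightarrow> s \<in> H0 X E \<Longrightarrow> x \<in> pts X \<Longrightarrow> s x = 0 \<Longrightarrow> Q s x = 0"
  unfolding section_op_def by metis+

text \<open>Global generation provides a section through u, and for a \<open>section_op\<close>
  every choice of it gives the same value, by \<open>endo_section\<close>.\<close>

definition endo :: "(('a \<Rightarrow> 'v) \<Rightarrow> 'a \<Rightarrow> 'v) \<Rightarrow> 'a \<Rightarrow> 'v \<Rightarrow> 'v" where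
  "endo Q x u = (if x \<in> pts X \<and> u \<in> fibre E x then Q (SOME s. s \<in> H0 X E \<and> s x = u) x else 0)"

lemma fibre_section:
  assumes "x \<in> pts X" "u \<in> fibre E x"
  obtains s where "s \<in> H0 X E" "s x = u"
  using assms ev_range[OF assms(1)] by (metis (no_types, lifting) image_iff)

lemma endo_section:
  assumes Q: "section_op Q" and x: "x \<in> pts X" and s: "s \<in> H0 X E"
  shows "endo Q x (s x) = Q s x"
proof -
  define t where "t = (SOME t. t \<in> H0 X E \<and> t x = s x)"
  have t: "t \<in> H0 X E" "t x = s x" unfolding t_def using someI[of "\<lambda>t. t \<in> H0 X E \<and> t x = s x" s] s by auto
  have d: "s - t \<in> H0 X E" using s t by (intro S.S_diff)
  have "Q (s - t) x = 0" by (rule section_op_vanish[OF Q d x]) (simp add: t)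
  moreover have "Q ((s - t) + t) = Q (s - t) + Q t" by (rule section_op_add[OF Q d t(1)])
  then have "Q s x = Q (s - t) x + Q t x" by (simp add: fun_eq_iff)
  ultimately show ?thesis using x section_in[OF s x] by (simp add: endo_def t_def)
qed

lemma endo_linear:
  assumes Q: "section_op Q" and x: "x \<in> pts X"
  shows "clinear_on (scl E) (fibre E x) (scl E) (endo Q x)" "endo Q x ` fibre E x \<subseteq> fibre E x"
proof -
  show "clinear_on (scl E) (fibre E x) (scl E) (endo Q x)"
    unfolding clinear_on_def
  proof (intro conjI ballI allI)
    fix u v c assume "u \<in> fibre E x"
    then obtain s where s: "s \<in> H0 X E" "s x = u" by (rule fibre_section[OF x])
    have "endo Q x (sec_scl E c s x) = Q (sec_scl E c s) x" by (rule endo_section[OF Q x S.S_scale[OF s(1)]])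
    also have "Q (sec_scl E c s) = sec_scl E c (Q s)" by (rule section_op_scale[OF Q s(1)])
    finally show "endo Q x (scl E c u) = scl E c (endo Q x u)"
      using endo_section[OF Q x s(1)] s(2) by (simp add: sec_scl_def)
    assume "v \<in> fibre E x"
    then obtain t where t: "t \<in> H0 X E" "t x = v" by (rule fibre_section[OF x])
    have "endo Q x ((s + t) x) = Q (s + t) x" by (rule endo_section[OF Q x S.S_add[OF s(1) t(1)]])
    also have "Q (s + t) = Q s + Q t" by (rule section_op_add[OF Q s(1) t(1)])
    finally show "endo Q x (u + v) = endo Q x u + endo Q x v"
      using endo_section[OF Q x s(1)] endo_section[OF Q x t(1)] s(2) t(2) by simp
  qed
  show "endo Q x ` fibre E x \<subseteq> fibre E x"
  proof
    fix w assume "w \<in> endo Q x ` fibre E x"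
    then obtain u where u: "u \<in> fibre E x" "w = endo Q x u" by blast
    obtain s where s: "s \<in> H0 X E" "s x = u" by (rule fibre_section[OF x u(1)])
    have "Q s \<in> H0 X E" by (rule section_op_in[OF Q s(1)])
    then show "w \<in> fibre E x" using endo_section[OF Q x s(1)] s(2) u(2) section_in[OF _ x] by metis
  qed
qed

text \<open>Sections are chosen whose values at z form the frame. Their coordinates and those of
  their images under Q are holomorphic, and the matrix of the endomorphism carries the former to the
  latter; near z this linear system can be solved for the matrix.\<close>

lemma endo_holo:
  assumes Q: "section_op Q"
  shows "holo_endomorphism X E (endo Q)"
proof -
  have "holo_on (\<lambda>z. \<theta> (chart_inv c z) (endo Q (chart_inv c z) (frame E \<theta> (chart_inv c z) j)) $ i) (snd c ` (fst c \<inter> U))"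
    if t: "(U, \<theta>) \<in> trivs E" and c: "c \<in> atlas X" for U \<theta> c i j
    unfolding holo_on_cdiff
  proof
    let ?y = "chart_inv c" and ?D = "snd c ` (fst c \<inter> U)"
    fix z assume z: "z \<in> ?D"
    have zU: "?y z \<in> U" using overlap_in[OF c z] by simp
    note zp = triv_pts[OF t zU]
    have "\<forall>j. \<exists>s. s \<in> H0 X E \<and> s (?y z) = frame E \<theta> (?y z) j"
      using fibre_section[OF zp frame_in[OF t zU]] by metis
    then obtain \<tau> where \<tau>: "\<And>j. \<tau> j \<in> H0 X E" "\<And>j. \<tau> j (?y z) = frame E \<theta> (?y z) j" by metis
    have Q\<tau>: "Q (\<tau> j) \<in> H0 X E" for j by (rule section_op_in[OF Q \<tau>(1)])
    define A where "A w = (\<chi> i j. \<theta> (?y w) (endo Q (?y w) (frame E \<theta> (?y w) j)) $ i)" for w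
    define M where "M w = (\<chi> k j. \<theta> (?y w) (\<tau> j (?y w)) $ k)" for w
    define N where "N w = (\<chi> i j. \<theta> (?y w) (Q (\<tau> j) (?y w)) $ i)" for w
    have "cdiff (\<lambda>w. A w $ i $ j) z"
    proof (rule cdiff_matrix_solve[OF overlap_open[OF t c] z])
      show "cdiff (\<lambda>w. M w $ k $ l) w" if w: "w \<in> ?D" for k l w
        using bspec[OF section_holo[OF \<tau>(1) t c, unfolded holo_on_cdiff] w, of l k] by (simp add: M_def)
      show "cdiff (\<lambda>w. N w $ k $ l) z" for k l
        using bspec[OF section_holo[OF Q\<tau> t c, unfolded holo_on_cdiff] z, of l k] by (simp add: N_def)
      have "M z = mat 1"
        by (simp add: M_def \<tau>(2) triv_frame[OF t zU] vec_eq_iff mat_def axis_def)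
      then show "det (M z) \<noteq> 0" by simp
      fix w assume w: "w \<in> ?D"
      have wU: "?y w \<in> U" using overlap_in[OF c w] by simp
      note wp = triv_pts[OF t wU]
      interpret F: fd_space "scl E" "fibre E (?y w)" by (rule fibre_fd_space[OF wp])
      interpret A: evaluation "scl E" "fibre E (?y w)" "scl E" "endo Q (?y w)"
        by unfold_locales (rule endo_linear[OF Q wp])
      note fr = frame_in[OF t wU]
      have efr: "endo Q (?y w) (frame E \<theta> (?y w) k) \<in> fibre E (?y w)" for k
        using endo_linear(2)[OF Q wp] fr by blast
      have "(A w ** M w) $ i $ j = N w $ i $ j" for i j
      proof -
        let ?a = "\<lambda>k. \<theta> (?y w) (\<tau> j (?y w)) $ k"
        have "\<theta> (?y w) (Q (\<tau> j) (?y w)) = \<theta> (?y w) (endo Q (?y w) (\<tau> j (?y w)))"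
          by (simp add: endo_section[OF Q wp \<tau>(1)])
        also have "\<tau> j (?y w) = (\<Sum>k\<in>UNIV. scl E (?a k) (frame E \<theta> (?y w) k))"
          by (rule frame_expand[OF t wU section_in[OF \<tau>(1) wp], symmetric])
        also have "endo Q (?y w) (\<Sum>k\<in>UNIV. scl E (?a k) (frame E \<theta> (?y w) k)) =
            (\<Sum>k\<in>UNIV. scl E (?a k) (endo Q (?y w) (frame E \<theta> (?y w) k)))"
          by (subst A.ev_sum) (auto simp: A.ev_scale[OF fr] intro: F.S_scale fr)
        also have "\<theta> (?y w) \<dots> = (\<Sum>k\<in>UNIV. ?a k *s \<theta> (?y w) (endo Q (?y w) (frame E \<theta> (?y w) k)))"
          by (subst triv_sum[OF t wU]) (auto simp: triv_scale[OF t wU efr] intro: F.S_scale efr)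
        finally show ?thesis
          by (simp add: A_def M_def N_def matrix_matrix_mult_def mult.commute)
      qed
      then show "A w ** M w = N w" by (simp add: vec_eq_iff)
    qed
    then show "cdiff (\<lambda>z. \<theta> (?y z) (endo Q (?y z) (frame E \<theta> (?y z) j)) $ i) z" by (simp add: A_def)
  qed
  then show ?thesis
    unfolding holo_endomorphism_def Let_def using endo_linear[OF Q] by (auto simp: endo_def)
qed

lemma endo_comp:
  assumes Q: "section_op Q" and R: "section_op R" and id: "\<And>s. s \<in> H0 X E \<Longrightarrow> Q (R s) = s"
    and x: "x \<in> pts X" "u \<in> fibre E x"
  shows "endo Q x (endo R x u) = u"
proof -
  obtain s where s: "s \<in> H0 X E" "s x = u" by (rule fibre_section[OF x])
  have Rs: "R s \<in> H0 X E" by (rule section_op_in[OF R s(1)])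
  have "endo Q x (endo R x u) = endo Q x (R s x)" using endo_section[OF R x(1) s(1)] s(2) by simp
  also have "\<dots> = Q (R s) x" by (rule endo_section[OF Q x(1) Rs])
  finally show ?thesis using id[OF s(1)] s(2) by simp
qed

text \<open>If \<open>W\<close> is invariant under all projections \<open>s \<mapsto> L H x (s x)\<close>, then the orthogonal projection \<open>P\<close>
  onto \<open>W\<close> descends to an idempotent endomorphism \<open>p\<close> of \<open>E\<close>, and \<open>1 + p\<close> is an automorphism with
  inverse \<open>1 - p/2\<close>.\<close>

lemma invariant_subspace_trivial:
  assumes simple: "simple_bundle X E" and H: "S.herm H" and W: "S.subspace W" "W \<subseteq> H0 X E" "W \<noteq> {0}"
    and inv: "\<And>s x. s \<in> W \<Longrightarrow> x \<in> pts X \<Longrightarrow> L H x (s x) \<in> W"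
  shows "W = H0 X E"
proof -
  note hf = S.herm_hform[OF H]
  let ?P = "S.oproj H W"
  have PW: "?P s \<in> W" and Porth: "\<And>w. w \<in> W \<Longrightarrow> H (s - ?P s) w = 0" if "s \<in> H0 X E" for s
    using S.oproj_in[OF H W(1,2) that] S.oproj_orth[OF H W(1,2) that] by auto
  have PH: "?P s \<in> H0 X E" if "s \<in> H0 X E" for s using PW[OF that] W by blast
  have Pid: "?P w = w" if "w \<in> W" for w
    by (rule S.oproj_eqI[OF H W(1,2)]) (use that W S.hform_0[OF hf] in auto)
  \<comment> \<open>For s vanishing at x, the values at x of \<open>?P s\<close> and of the error s
    - \<open>?P s\<close> are opposite. The lift of the former lies in W, so it is orthogonal to the
    error; moving the lift to the other argument by self-adjointness shows that the quotient norm of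
    the value is zero.\<close>
  have key: "?P s x = 0" if s: "s \<in> H0 X E" and x: "x \<in> pts X" and sx: "s x = 0" for s x
  proof -
    interpret A: evaluation "sec_scl E" "H0 X E" "scl E" "\<lambda>s. s x" by (rule evaluation)
    let ?w = "?P s" and ?d = "s - ?P s"
    have d: "?d \<in> H0 X E" using s PH by (intro S.S_diff)
    have wx: "?w x \<in> (\<lambda>s. s x) ` H0 X E" using PH[OF s] by blast
    have l: "L H x (?w x) \<in> W" by (rule inv[OF PW[OF s] x])
    have dx: "?d x = - ?w x" using sx by simp
    have "H ?d (L H x (?w x)) = 0" by (rule Porth[OF s l])
    moreover have "H ?d (L H x (?w x)) = H (L H x (?d x)) ?w"
      by (rule A.lift_self_adjoint[OF H d PH[OF s], symmetric])
    moreover have "L H x (?d x) = - L H x (?w x)"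
      using A.lift_scale[OF H wx, of "-1"] dx by (simp add: V.scale_minus_left S.scale_minus_left)
    moreover have "H (- L H x (?w x)) ?w = - H (L H x (?w x)) ?w"
      using S.hform_scale[OF hf A.lift_in[OF H wx] PH[OF s], of "-1"] by (simp add: S.scale_minus_left)
    ultimately have "H (L H x (?w x)) ?w = 0" by simp
    then have "S.qform H (\<lambda>s. s x) (?w x) (?w x) = 0" using A.lift_adjoint[OF H wx PH[OF s]] by simp
    then have "H (L H x (?w x)) (L H x (?w x)) = 0" using A.qform_diag[OF wx] by simp
    then have "L H x (?w x) = 0" using S.herm_zero_iff[OF H A.lift_in[OF H wx]] by simp
    then show ?thesis using A.ev_lift[OF H wx] by simp
  qed
  have op: "section_op (\<lambda>s. s + sec_scl E b (?P s))" for b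
    unfolding section_op_def
  proof (intro conjI ballI allI impI)
    fix s t c x assume s: "s \<in> H0 X E"
    show "s + sec_scl E b (?P s) \<in> H0 X E" by (intro S.S_add S.S_scale s PH)
    show "sec_scl E c s + sec_scl E b (?P (sec_scl E c s)) = sec_scl E c (s + sec_scl E b (?P s))"
      by (simp add: S.oproj_scale[OF H W(1,2) s] S.scale_right_distrib mult.commute)
    show "s + t + sec_scl E b (?P (s + t)) = s + sec_scl E b (?P s) + (t + sec_scl E b (?P t))" if t: "t \<in> H0 X E"
      by (simp add: S.oproj_add[OF H W(1,2) s t] S.scale_right_distrib add_ac)
    show "(s + sec_scl E b (?P s)) x = 0" if "x \<in> pts X" "s x = 0"
      using key[OF s that] that by (simp add: sec_scl_def)
  qed
  let ?Q = "\<lambda>b s. s + sec_scl E b (?P s)"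
  \<comment> \<open>As P is idempotent, (1 + b P)(1 + b' P) = 1 + (b + b' + b b') P; the pair 1 and
    -1/2 annihilates the coefficient in either order.\<close>
  have comp: "?Q b (?Q b' s) = s" if s: "s \<in> H0 X E" and b: "b + b' + b * b' = 0" for b b' s
  proof -
    have "?P (?Q b' s) = ?P s + sec_scl E b' (?P s)"
      using S.oproj_add[OF H W(1,2) s S.S_scale[OF PH[OF s]]] S.oproj_scale[OF H W(1,2) PH[OF s]] Pid[OF PW[OF s]]
      by simp
    then have "?Q b (?Q b' s) = s + sec_scl E (b' + (b + b * b')) (?P s)"
      by (simp add: S.scale_right_distrib S.scale_left_distrib add_ac)
    moreover have "b' + (b + b * b') = 0" using b by (simp add: add_ac)
    ultimately show ?thesis by (simp only: S.scale_zero_left add_0_right)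
  qed
  let ?h = "- 1 / 2 :: complex"
  have "\<forall>x\<in>pts X. \<forall>u\<in>fibre E x. endo (?Q 1) x (endo (?Q ?h) x u) = u \<and> endo (?Q ?h) x (endo (?Q 1) x u) = u"
    by (intro ballI conjI endo_comp[OF op op comp]) auto
  then have "endo (?Q 1) \<in> Aut X E"
    unfolding Aut_def using endo_holo[OF op[of 1]] endo_holo[OF op[of ?h]] by blast
  then obtain c where c: "endo (?Q 1) = homothety X E c"
    using simple unfolding simple_bundle_def bij_betw_def by blast
  \<comment> \<open>The automorphism 1 + p is the same scalar c in all fibres, so the projection is
    multiplication by c - 1 on sections.\<close>
  have Pc: "?P s = sec_scl E (c - 1) s" if s: "s \<in> H0 X E" for s
  proof
    fix x
    show "?P s x = sec_scl E (c - 1) s x"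
    proof (cases "x \<in> pts X")
      case True
      have "endo (?Q 1) x (s x) = (s + sec_scl E 1 (?P s)) x" by (rule endo_section[OF op True s])
      then have "s x + ?P s x = homothety X E c x (s x)" unfolding c by (simp add: sec_scl_def)
      also have "\<dots> = scl E c (s x)" using section_in[OF s True] True by (simp add: homothety_def)
      finally show ?thesis by (simp add: sec_scl_def V.scale_left_diff_distrib algebra_simps)
    next
      case False
      then show ?thesis using section_outside[OF s] section_outside[OF PH[OF s]] by (simp add: sec_scl_def)
    qed
  qed
  \<comment> \<open>A nonzero element of W is fixed by the projection, which forces c = 2 and makes
    the projection the identity.\<close>
  obtain w where w: "w \<in> W" "w \<noteq> 0" using W(3) S.subspace_0[OF W(1)] by blast
  have "sec_scl E (c - 1) w = sec_scl E 1 w" using Pc[of w] Pid[OF w(1)] w(1) W(2) by auto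
  then have "c - 1 = 1" using w(2) S.scale_cancel_right by blast
  then have "s \<in> W" if "s \<in> H0 X E" for s using Pc[OF that] PW[OF that] by simp
  then show ?thesis using W(2) by blast
qed

section \<open>Balanced metrics and fixed points\<close>

lemma L2_inner_eq: "Hilb X \<omega> E h = S.scaled_form hconst (L2_inner X \<omega> E h)"
  by (simp add: Hilb_def S.scaled_form_def hconst_def)

lemma bergman_scaled:
  assumes B: "\<And>k. k < length ss \<Longrightarrow> ss ! k \<in> H0 X E" and c: "c > 0" and h: "hermitian_inner (scl E) (fibre E x) (h x)"
    and x: "x \<in> pts X" and u: "u \<in> fibre E x"
  shows "(\<Sum>i<length ss. scl E (h x u (sec_scl E (of_real (1 / sqrt c)) (ss ! i) x)) (sec_scl E (of_real (1 / sqrt c)) (ss ! i) x))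
     = scl E (of_real (1 / c)) (bergman_sum E h ss x u)"
proof -
  let ?k = "complex_of_real (1 / sqrt c)"
  have k: "?k * ?k = of_real (1 / c)" using c by (simp flip: of_real_mult)
  interpret F: fd_space "scl E" "fibre E x" by (rule fibre_fd_space[OF x])
  have "h x u (scl E ?k ((ss ! i) x)) = ?k * h x u ((ss ! i) x)" if "i < length ss" for i
    using F.hform_scale_right[OF F.herm_hform[OF h] section_in[OF B[OF that] x] u, of ?k] by simp
  then have "(\<Sum>i<length ss. scl E (h x u (sec_scl E ?k (ss ! i) x)) (sec_scl E ?k (ss ! i) x)) =
      (\<Sum>i<length ss. scl E (?k * ?k) (scl E (h x u ((ss ! i) x)) ((ss ! i) x)))"
    by (intro sum.cong refl) (simp add: sec_scl_def mult_ac)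
  then show ?thesis unfolding k by (simp add: bergman_sum_eq V.scale_sum_right)
qed

text \<open>Integrating the trace identity gives N = V r c, so the Bergman constant c is
  \<open>hconst\<close>. Rescaling the basis to one orthonormal for \<open>Hilb\<close> turns the
  Bergman sum into the identity; hence h is the quotient metric of its own \<open>Hilb\<close>
  form.\<close>

lemma balanced_fixed_point:
  assumes bal: "balanced_metric X \<omega> E h" and z: "z \<in> H0 X E" "z \<noteq> 0"
  shows "T (Hilb X \<omega> E h) = Hilb X \<omega> E h"
proof -
  note C = hconst_pos[OF z]
  have h: "h \<in> K_space X E" using bal by (simp add: balanced_metric_def)
  obtain ss c where ss: "orthonormal_basis (sec_scl E) (H0 X E) (L2_inner X \<omega> E h) ss"
    and c: "\<And>x u. x \<in> pts X \<Longrightarrow> u \<in> fibre E x \<Longrightarrow> bergman_sum E h ss x u = scl E c u"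
    using bal unfolding balanced_metric_def by blast
  note HH = Hilb_herm[OF h]
  have L2: "L2_inner X \<omega> E h = S.scaled_form (1 / hconst) (Hilb X \<omega> E h)"
    using C by (simp add: L2_inner_eq S.scaled_form_scaled_form S.scaled_form_1)
  have hL2: "S.hform (L2_inner X \<omega> E h)" unfolding L2 by (rule S.hform_scaled_form[OF S.herm_hform[OF HH]])
  have bs: "is_basis (sec_scl E) (H0 X E) ss" using ss by (simp add: orthonormal_basis_def)
  note ssS = S.basis_in[OF bs]
  have "c = of_real hconst"
  proof -
    have "(\<Sum>k<length ss. vol_integral X \<omega> (\<lambda>x. h x ((ss ! k) x) ((ss ! k) x))) = (\<Sum>k<length ss. 1)"
    proof (intro sum.cong refl)
      fix k assume "k \<in> {..<length ss}"
      then show "vol_integral X \<omega> (\<lambda>x. h x ((ss ! k) x) ((ss ! k) x)) = 1"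
        using ss ssS by (auto simp: orthonormal_basis_def L2_inner_def)
    qed
    moreover have "(\<Sum>k<length ss. vol_integral X \<omega> (\<lambda>x. h x ((ss ! k) x) ((ss ! k) x))) =
        vol_integral X \<omega> (\<lambda>x. \<Sum>k<length ss. h x ((ss ! k) x) ((ss ! k) x))"
      by (rule vol_integral_sum[symmetric]) (use metric_cont[OF h] ssS in auto)
    \<comment> \<open>Writing the constant as a multiple of 1 lets
      \<open>vol_integral_bounded_linear\<close> reduce its integral to \<open>Vol\<close>.\<close>
    moreover have "\<dots> = vol_integral X \<omega> (\<lambda>x. (1::real) *\<^sub>R (of_nat CARD('r) * c))"
      by (rule vol_integral_cong) (simp add: bergman_trace[where h = h and ss = ss, OF _ metric_herm[OF h] ssS c])
    moreover have "\<dots> = Vol X \<omega> *\<^sub>R (of_nat CARD('r) * c)"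
      unfolding Vol_def by (rule vol_integral_bounded_linear[OF bounded_linear_scaleR_left]) simp
    ultimately have e: "of_nat (length ss) = of_real (Vol X \<omega>) * (of_nat CARD('r) * c)"
      by (simp add: scaleR_conv_of_real)
    obtain x where "x \<in> pts X" using nonzero_section[OF z] by blast
    then have "Vol X \<omega> > 0" by (rule Vol_pos)
    then show ?thesis using e h0_eq[OF bs] by (simp add: hconst_def field_simps)
  qed
  note c = c[unfolded this]
  have B: "S.onb_of (Hilb X \<omega> E h) (H0 X E) (length ss) (\<lambda>i. sec_scl E (of_real (1 / sqrt hconst)) (ss ! i))"
    using S.onb_of_scaled_form[OF S.orthonormal_basis_onb[OF hL2 ss] hL2 C] by (simp add: L2_inner_eq)
  have "h = fs_metric (Hilb X \<omega> E h)"
  proof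
    fix x
    show "h x = fs_metric (Hilb X \<omega> E h) x"
    proof (cases "x \<in> pts X")
      case True
      have "h x = S.qform (Hilb X \<omega> E h) (\<lambda>s. s x)"
      proof (rule evaluation.qform_unique[OF evaluation HH B])
        show "hermitian_inner (scl E) ((\<lambda>s. s x) ` H0 X E) (h x)" using metric_herm[OF h True] by (simp add: ev_range[OF True])
        fix u assume "u \<in> (\<lambda>s. s x) ` H0 X E"
        then have u: "u \<in> fibre E x" by (simp add: ev_range[OF True])
        show "(\<Sum>i<length ss. scl E (h x u (sec_scl E (of_real (1 / sqrt hconst)) (ss ! i) x)) (sec_scl E (of_real (1 / sqrt hconst)) (ss ! i) x)) = u"
          using bergman_scaled[where h = h and ss = ss, OF ssS C metric_herm[OF h True] True u] C by (simp add: c[OF True u])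
      qed
      then show ?thesis using True by (simp add: fs_metric_def)
    next
      case False
      then show ?thesis using h by (simp add: fs_metric_def K_space_def)
    qed
  qed
  then show ?thesis using T_eq[OF HH] by simp
qed

text \<open>At a fixed point the L2 product of FS(H) is H divided by \<open>hconst\<close>. A basis
  orthonormal for it is one for H up to scaling, and the scaling changes the Bergman sum from the
  identity to \<open>hconst\<close> times the identity.\<close>

lemma fixed_point_balanced:
  assumes H: "S.herm H" and fp: "T H = H" and z: "z \<in> H0 X E" "z \<noteq> 0"
  shows "balanced_metric X \<omega> E (FS X E H)"
proof -
  note C = hconst_pos[OF z]
  have L2: "L2_inner X \<omega> E (fs_metric H) = S.scaled_form (1 / hconst) H"
  proof -
    have e: "H = S.scaled_form hconst (L2_inner X \<omega> E (fs_metric H))" using fp by (simp add: T_eq[OF H] L2_inner_eq)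
    show ?thesis using C by (subst (2) e) (simp add: S.scaled_form_scaled_form S.scaled_form_1)
  qed
  have hL2: "S.herm (L2_inner X \<omega> E (fs_metric H))" unfolding L2 using S.herm_scaled_form[OF H] C by simp
  obtain ss where ss: "orthonormal_basis (sec_scl E) (H0 X E) (L2_inner X \<omega> E (fs_metric H)) ss"
    using S.ex_orthonormal_basis[OF hL2] by (rule exE)
  have bs: "is_basis (sec_scl E) (H0 X E) ss" using ss by (simp add: orthonormal_basis_def)
  have HL: "S.scaled_form hconst (L2_inner X \<omega> E (fs_metric H)) = H" using C by (simp add: L2 S.scaled_form_scaled_form S.scaled_form_1)
  have B: "S.onb_of H (H0 X E) (length ss) (\<lambda>i. sec_scl E (of_real (1 / sqrt hconst)) (ss ! i))"
    using S.onb_of_scaled_form[OF S.orthonormal_basis_onb[OF S.herm_hform[OF hL2] ss] S.herm_hform[OF hL2] C] by (simp add: HL)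
  have "bergman_sum E (fs_metric H) ss x u = scl E (of_real hconst) u" if x: "x \<in> pts X" and u: "u \<in> fibre E x" for x u
  proof -
    have "scl E (of_real (1 / hconst)) (bergman_sum E (fs_metric H) ss x u) = u"
      using evaluation.qform_bergman[OF evaluation H B, of u x] u x
        bergman_scaled[where h = "fs_metric H" and ss = ss, OF S.basis_in[OF bs] C metric_herm[OF fs_metric_in_K_space[OF H] x] x u]
      by (simp add: ev_range fs_metric_def)
    then have "scl E (of_real hconst) (scl E (of_real (1 / hconst)) (bergman_sum E (fs_metric H) ss x u)) = scl E (of_real hconst) u"
      by simp
    then show ?thesis using C by simp
  qed
  then show ?thesis unfolding balanced_metric_def FS_eq[OF H] using fs_metric_in_K_space[OF H] ss by blast
qed

text \<open>The topology is pulled back along the Gram matrix of one chosen basis, so convergence of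
  its entries at that basis is enough.\<close>

lemma M_topology_limit:
  assumes F: "\<And>m. S.herm (F m)" and H: "S.herm H"
    and lim: "\<And>s t. s \<in> H0 X E \<Longrightarrow> t \<in> H0 X E \<Longrightarrow> (\<lambda>m. F m s t) \<longlonglongrightarrow> H s t"
  shows "limitin (M_topology X E) F H sequentially"
proof -
  define bs where "bs = (SOME bs. is_basis (sec_scl E) (H0 X E) bs)"
  have bs: "is_basis (sec_scl E) (H0 X E) bs" unfolding bs_def using ex_basis by (rule someI_ex)
  have "(\<lambda>m. gram_matrix bs (F m) i j) \<longlonglongrightarrow> gram_matrix bs H i j" for i j
    using lim[OF S.basis_in[OF bs] S.basis_in[OF bs], of i j] by (auto simp: gram_matrix_def)
  then have g: "((\<lambda>m. gram_matrix bs (F m)) \<longlongrightarrow> gram_matrix bs H) sequentially"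
    by (intro tendsto_fun_componentwise)
  have M: "F m \<in> M_space X E" "H \<in> M_space X E" for m using F H by (simp_all add: M_space_def)
  show ?thesis
    unfolding limitin_def
  proof (intro conjI allI impI)
    show "H \<in> topspace (M_topology X E)" using M by (simp add: M_topology_def topspace_pullback_topology)
    fix U assume U: "openin (M_topology X E) U \<and> H \<in> U"
    then obtain G where G: "open G" "U = gram_matrix bs -` G \<inter> M_space X E"
      unfolding M_topology_def bs_def[symmetric] openin_pullback_topology by auto
    have "gram_matrix bs H \<in> G" using U G by auto
    then have "eventually (\<lambda>m. gram_matrix bs (F m) \<in> G) sequentially"
      using topological_tendstoD[OF g G(1)] by blast
    then show "eventually (\<lambda>m. F m \<in> U) sequentially"
      by eventually_elim (simp add: G(2) M)
  qed
qed

theorem iteration_converges: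
  assumes simple: "simple_bundle X E" and bal: "balanced_metric X \<omega> E h" and H0: "S.herm H"
  shows "\<exists>Hlim. S.herm Hlim \<and> limitin (M_topology X E) (\<lambda>m. (T ^^ m) H) Hlim sequentially \<and>
    T Hlim = Hlim \<and> balanced_metric X \<omega> E (FS X E Hlim)"
proof (cases "\<exists>z\<in>H0 X E. z \<noteq> 0")
  case True
  then obtain z where z: "z \<in> H0 X E" "z \<noteq> 0" by blast
  define Hs where "Hs = Hilb X \<omega> E h"
  have Hs: "S.herm Hs" unfolding Hs_def using bal by (intro Hilb_herm) (simp add: balanced_metric_def)
  have fp: "T Hs = Hs" unfolding Hs_def by (rule balanced_fixed_point[OF bal z])
  \<comment> \<open>When K and T K have the same null space, \<open>lift_in_eqset\<close> says that
    it is stable under sending s to the lift of s(x).\<close>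
  have r2: "S.eqset Hs K = H0 X E" if K: "S.herm K" "S.form_le K Hs" and eq: "S.eqset Hs (T K) = S.eqset Hs K"
    and ne: "S.eqset Hs K \<noteq> {0}" for K
  proof (rule invariant_subspace_trivial[OF simple Hs _ _ ne])
    show "S.subspace (S.eqset Hs K)" by (rule S.eqset_subspace[OF S.herm_hform[OF Hs] S.herm_hform[OF K(1)] K(2)])
    show "S.eqset Hs K \<subseteq> H0 X E" by (auto simp: S.eqset_def)
    show "L Hs x (s x) \<in> S.eqset Hs K" if "s \<in> S.eqset Hs K" "x \<in> pts X" for s x
      using lift_in_eqset[OF Hs fp K] that eq by simp
  qed
  obtain b where b: "b > 0" "\<And>s t. s \<in> H0 X E \<Longrightarrow> t \<in> H0 X E \<Longrightarrow> (\<lambda>m. (T ^^ m) H s t) \<longlonglongrightarrow> of_real b * Hs s t"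
    using S.iteration_convergence[OF T_herm T_mono T_homog Hs fp eqset_T_subset[OF Hs fp] r2 H0 z] by blast
  have lim: "S.herm (S.scaled_form b Hs)" by (rule S.herm_scaled_form[OF Hs b(1)])
  have fpl: "T (S.scaled_form b Hs) = S.scaled_form b Hs" using T_homog[OF Hs b(1)] fp by simp
  have Tm: "S.herm ((T ^^ m) H)" for m by (induction m) (auto intro: H0 T_herm)
  have "limitin (M_topology X E) (\<lambda>m. (T ^^ m) H) (S.scaled_form b Hs) sequentially"
    by (rule M_topology_limit[OF Tm lim]) (simp add: S.scaled_form_def b(2))
  then show ?thesis using lim fpl fixed_point_balanced[OF lim fpl z] by blast
next
  case False
  \<comment> \<open>Without nonzero sections the zero form is the only inner product, the orbit is
    constant, and the empty list is an orthonormal basis.\<close>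
  then have trivial: "H0 X E = {0}" using S.S_0 by blast
  have zero: "G = (\<lambda>s t. 0)" if "S.herm G" for G
  proof (intro ext)
    fix s t show "G s t = 0"
      using S.herm_outside[OF that, of s t] S.herm_zero_iff[OF that S.S_0] trivial by (cases "s = 0 \<and> t = 0") auto
  qed
  have TH: "T H = H" using zero[OF H0] zero[OF T_herm[OF H0]] by simp
  have Tm: "(T ^^ m) H = H" for m by (induction m) (auto simp: TH)
  have "limitin (M_topology X E) (\<lambda>m. (T ^^ m) H) H sequentially"
    by (rule M_topology_limit) (auto simp: Tm H0)
  moreover have "balanced_metric X \<omega> E (FS X E H)"
  proof -
    have on: "orthonormal_basis (sec_scl E) (H0 X E) (L2_inner X \<omega> E (fs_metric H)) []"
      by (simp add: orthonormal_basis_def is_basis_def trivial S.independent_empty)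
    have "bergman_sum E (fs_metric H) [] x u = scl E 1 u" if "x \<in> pts X" "u \<in> fibre E x" for x u
      using that ev_range[OF that(1)] trivial by (auto simp: bergman_sum_def)
    then show ?thesis unfolding balanced_metric_def FS_eq[OF H0] using on fs_metric_in_K_space[OF H0] by blast
  qed
  ultimately show ?thesis using H0 TH by blast
qed

end

theorem theorem1p1:
  fixes X :: "('a, 'n::finite) cmfd"
    and \<omega> :: "('a, 'n) two_form"
    and E :: "('a, 'v::ab_group_add, 'r::finite) vbundle"
    and H\<^sub>0 :: "('a, 'v) sec_form"
  assumes "complex_manifold X" and "kaehler_form X \<omega>"
    and "compact_space (topo X)" and "connected_space (topo X)"
    and "holomorphic_vector_bundle X E"
    and "very_ample X E"
    and "simple_bundle X E"
    and "\<exists>h. balanced_metric X \<omega> E h"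
    and "H\<^sub>0 \<in> M_space X E"
  shows "\<exists>Hlim \<in> M_space X E.
      limitin (M_topology X E) (\<lambda>m. (T_map X \<omega> E ^^ m) H\<^sub>0) Hlim sequentially \<and>
      T_map X \<omega> E Hlim = Hlim \<and>
      Hlim = Hilb X \<omega> E (FS X E Hlim) \<and>
      balanced_metric X \<omega> E (FS X E Hlim)"
proof -
  obtain h where h: "balanced_metric X \<omega> E h" using assms(8) by blast
  interpret hol_bundle X \<omega> E
  proof
    show "globally_generated X E" using assms(6) by (simp add: very_ample_def)
    show "\<exists>bs. is_basis (sec_scl E) (H0 X E) bs"
      using h unfolding balanced_metric_def orthonormal_basis_def by blast
  qed (use assms in auto)
  have "hermitian_inner (sec_scl E) (H0 X E) H\<^sub>0" using assms(9) by (simp add: M_space_def)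
  from iteration_converges[OF assms(7) h this] obtain Hlim
    where "hermitian_inner (sec_scl E) (H0 X E) Hlim"
      "limitin (M_topology X E) (\<lambda>m. (T_map X \<omega> E ^^ m) H\<^sub>0) Hlim sequentially"
      "T_map X \<omega> E Hlim = Hlim" "balanced_metric X \<omega> E (FS X E Hlim)" by blast
  then show ?thesis by (intro bexI[of _ Hlim]) (auto simp: M_space_def T_map_def)
qed

end
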